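(* The composition lax functors $$-\otimes-\colon\mathbf{Lax}(\mathfrak B,\mathfrak C)\times\mathbf{Lax}(\mathfrak A,\mathfrak B)\to\mathbf{Lax}(\mathfrak A,\mathfrak C)$$ make 2-categories, 2-functors, lax natural transformations and modifications into a lax 3-category, denoted by $\mathbf{Lax}$, i.e. a category enriched in the cartesian monoidal category $|\mathbf{2Cat}_{lax}|$ of 2-categories and (normalized) lax functors, with hom-2-categories $\mathbf{Lax}(\mathfrak A,\mathfrak B)$.
   Context: 2-categories and 2-functors are strict. A lax natural transformation $\alpha\colon F\Rightarrow G$ of 2-functors $F,G\colon\mathfrak K\to\mathfrak L$ consists of arrows $\alpha_A\colon FA\to GA$ of $\mathfrak L$ indexed by the objects $A$ of $\mathfrak K$ and, for each arrow $f\colon A\to B$ of $\mathfrak K$, a distinguished 2-cell $\alpha_f\colon Gf\,\alpha_A\Rightarrow\alpha_B\,Ff$, satisfying two compatibility conditions: (1) $\alpha_{gf}=(\alpha_g\ast Ff)(Gg\ast\alpha_f)$ for composable $f,g$; (2) $(\alpha_B\ast F\theta)\alpha_f=\alpha_g(G\theta\ast\alpha_A)$ for each 2-cell $\theta\colon f\Rightarrow g$. A modification $m\colon\alpha\Rrightarrow\gamma$ is a family of 2-cells $m_A\colon\alpha_A\Rightarrow\gamma_A$ with $(m_B\ast Ff)\alpha_f=\gamma_f(Gf\ast m_A)$ for all $f\colon A\to B$. $\mathbf{Lax}(\mathfrak A,\mathfrak B)$ is the 2-category of 2-functors $\mathfrak A\to\mathfrak B$, lax natural transformations and modifications; composites of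 lax natural transformations are $(\beta\alpha)_A=\beta_A\alpha_A$ with 2-cell at $f$ the pasting of $\alpha_f$ and $\beta_f$, and modifications compose vertically and horizontally as 2-cells of $\mathfrak B$. A (normalized) lax functor $F\colon\mathfrak A\to\mathfrak B$ of 2-categories assigns objects, arrows and 2-cells, strictly preserving domains, codomains, sources, targets, identity arrows, identity 2-cells and vertical composition of 2-cells, and comes equipped with coherence 2-cells $\phi_{f,g}\colon Fg\,Ff\Rightarrow F(gf)$ for composable $f,g$ such that $\phi_{gf,h}(Fh\ast\phi_{f,g})=\phi_{f,hg}(\phi_{g,h}\ast Ff)$ for composable $f,g,h$ and, for horizontally composable 2-cells $\alpha\colon f\Rightarrow g$ and $\beta\colon h\Rightarrow k$ with $f,g\colon A\to B$ and $h,k\colon B\to C$, $\phi_{g,k}(F\beta\ast F\alpha)=F(\beta\ast\alpha)\phi_{f,h}$. $|\mathbf{2Cat}_{lax}|$ is the 1-category of 2-categories and such lax functors, cartesian monoidal with the ordinary cartesian product of 2-categories. The composition $\otimes$: on objects, $G\otimes F=GF$. For lax natural transformations $\alpha\colon F\Rightarrow H$ ($F,H\colon\mathfrak A\to\mathfrak B$) and $\beta\colon G\Rightarrow K$ ($G,K\colon\mathfrak B\to\mathfrak C$), $(\beta\otimes\alpha)_A=\beta_{HA}\,G\alpha_A$, with 2-cell at $f\colon A\to B$ the pasting of $G\alpha_f$ and $\beta_{Hf}$. For further $\alpha'\colon F\Rightarrow H$, $\beta'\colon G\Rightarrow K$ and modifications $m\colon\alpha\Rrightarrow\alpha'$ and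 $n\colon\beta\Rrightarrow\beta'$, $(n\otimes m)_A=n_{HA}\ast Gm_A$. For further lax natural transformations $\gamma\colon H\Rightarrow L$ and $\delta\colon K\Rightarrow M$, the coherence cell $(\delta\otimes\gamma)(\beta\otimes\alpha)\Rrightarrow\delta\beta\otimes\gamma\alpha$ has component at $A$ the 2-cell $\delta_{LA}\ast\beta_{\gamma_A}\ast G\alpha_A\colon\delta_{LA}K(\gamma_A)\beta_{HA}G(\alpha_A)\Rightarrow\delta_{LA}\beta_{LA}G(\gamma_A)G(\alpha_A)$.
   Formalization: Lax natural transformations are also required to satisfy the unit condition that the 2-cell at an identity arrow 1_A is the identity 2-cell of α_A; with only conditions (1) and (2) this 2-cell may be a non-identity idempotent and the right unit law of the enriched category fails. *)

theory Defs
  imports "HOL-Library.FuncSet"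
begin

section \<open>Strict 2-categories\<close>

text \<open>
  Arrows and 2-cells are composed in applicative order: \<open>g \<odot> f\<close> is \<open>f\<close> followed by \<open>g\<close>,
  \<open>\<tau> \<bullet> \<sigma>\<close> is the vertical composite of \<open>\<sigma>\<close> followed by \<open>\<tau>\<close>, and \<open>\<beta> \<star> \<alpha>\<close> is the
  horizontal composite of \<open>\<alpha> : f \<Rightarrow> g\<close> and \<open>\<beta> : h \<Rightarrow> k\<close>, a 2-cell \<open>h \<odot> f \<Rightarrow> k \<odot> g\<close>.
\<close>

record ('o, 'a, 'c) two_cat =
  Obj :: "'o set"
  Arr :: "'a set"
  Cell :: "'c set"
  Dom :: "'a \<Rightarrow> 'o"
  Cod :: "'a \<Rightarrow> 'o"
  Src :: "'c \<Rightarrow> 'a"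
  Tgt :: "'c \<Rightarrow> 'a"
  id_arr :: "'o \<Rightarrow> 'a"
  id_cell :: "'a \<Rightarrow> 'c"
  comp :: "'a \<Rightarrow> 'a \<Rightarrow> 'a"  (infixr \<open>\<odot>\<index>\<close> 75)
  vcomp :: "'c \<Rightarrow> 'c \<Rightarrow> 'c"  (infixr \<open>\<bullet>\<index>\<close> 65)
  hcomp :: "'c \<Rightarrow> 'c \<Rightarrow> 'c"  (infixr \<open>\<star>\<index>\<close> 70)

abbreviation lwhisker :: "('o, 'a, 'c) two_cat \<Rightarrow> 'a \<Rightarrow> 'c \<Rightarrow> 'c"
  where "lwhisker K g \<theta> \<equiv> hcomp K (id_cell K g) \<theta>"

abbreviation rwhisker :: "('o, 'a, 'c) two_cat \<Rightarrow> 'c \<Rightarrow> 'a \<Rightarrow> 'c"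
  where "rwhisker K \<theta> f \<equiv> hcomp K \<theta> (id_cell K f)"

notation lwhisker (\<open>(_ \<lhd>\<index> _)\<close> [73, 72] 72)
notation rwhisker (\<open>(_ \<rhd>\<index> _)\<close> [72, 73] 72)

definition is_arr :: "('o, 'a, 'c) two_cat \<Rightarrow> 'a \<Rightarrow> 'o \<Rightarrow> 'o \<Rightarrow> bool"
  where "is_arr K f A B \<longleftrightarrow> f \<in> Arr K \<and> Dom K f = A \<and> Cod K f = B"

definition is_cell :: "('o, 'a, 'c) two_cat \<Rightarrow> 'c \<Rightarrow> 'a \<Rightarrow> 'a \<Rightarrow> bool"
  where "is_cell K \<theta> f g \<longleftrightarrow> \<theta> \<in> Cell K \<and> Src K \<theta> = f \<and> Tgt K \<theta> = g"

locale two_category =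
  fixes K :: "('o, 'a, 'c) two_cat" (structure)
  assumes Dom_closed: "f \<in> Arr K \<Longrightarrow> Dom K f \<in> Obj K"
    and Cod_closed: "f \<in> Arr K \<Longrightarrow> Cod K f \<in> Obj K"
    and Src_closed: "\<theta> \<in> Cell K \<Longrightarrow> Src K \<theta> \<in> Arr K"
    and Tgt_closed: "\<theta> \<in> Cell K \<Longrightarrow> Tgt K \<theta> \<in> Arr K"
    and Dom_Src: "\<theta> \<in> Cell K \<Longrightarrow> Dom K (Src K \<theta>) = Dom K (Tgt K \<theta>)"
    and Cod_Src: "\<theta> \<in> Cell K \<Longrightarrow> Cod K (Src K \<theta>) = Cod K (Tgt K \<theta>)"
    and id_arr: "A \<in> Obj K \<Longrightarrow> is_arr K (id_arr K A) A A"
    and id_cell: "f \<in> Arr K \<Longrightarrow> is_cell K (id_cell K f) f f"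
    and comp: "\<lbrakk>is_arr K f A B; is_arr K g B C\<rbrakk> \<Longrightarrow> is_arr K (g \<odot> f) A C"
    and comp_id_left: "is_arr K f A B \<Longrightarrow> id_arr K B \<odot> f = f"
    and comp_id_right: "is_arr K f A B \<Longrightarrow> f \<odot> id_arr K A = f"
    and comp_assoc: "\<lbrakk>is_arr K f A B; is_arr K g B C; is_arr K h C D\<rbrakk>
      \<Longrightarrow> (h \<odot> g) \<odot> f = h \<odot> (g \<odot> f)"
    and vcomp: "\<lbrakk>is_cell K \<sigma> f g; is_cell K \<tau> g h\<rbrakk> \<Longrightarrow> is_cell K (\<tau> \<bullet> \<sigma>) f h"
    and vcomp_id_left: "is_cell K \<sigma> f g \<Longrightarrow> id_cell K g \<bullet> \<sigma> = \<sigma>"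
    and vcomp_id_right: "is_cell K \<sigma> f g \<Longrightarrow> \<sigma> \<bullet> id_cell K f = \<sigma>"
    and vcomp_assoc: "\<lbrakk>is_cell K \<sigma> f g; is_cell K \<tau> g h; is_cell K \<upsilon> h k\<rbrakk>
      \<Longrightarrow> (\<upsilon> \<bullet> \<tau>) \<bullet> \<sigma> = \<upsilon> \<bullet> (\<tau> \<bullet> \<sigma>)"
    and hcomp: "\<lbrakk>is_cell K \<alpha> f g; is_cell K \<beta> h k; Cod K f = Dom K h\<rbrakk>
      \<Longrightarrow> is_cell K (\<beta> \<star> \<alpha>) (h \<odot> f) (k \<odot> g)"
    and hcomp_id_left: "is_cell K \<alpha> f g \<Longrightarrow> id_cell K (id_arr K (Cod K f)) \<star> \<alpha> = \<alpha>"
    and hcomp_id_right: "is_cell K \<alpha> f g \<Longrightarrow> \<alpha> \<star> id_cell K (id_arr K (Dom K f)) = \<alpha>"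
    and hcomp_assoc: "\<lbrakk>is_cell K \<alpha> f f'; is_cell K \<beta> g g'; is_cell K \<gamma> h h';
        Cod K f = Dom K g; Cod K g = Dom K h\<rbrakk> \<Longrightarrow> (\<gamma> \<star> \<beta>) \<star> \<alpha> = \<gamma> \<star> (\<beta> \<star> \<alpha>)"
    and hcomp_id_cell: "\<lbrakk>is_arr K f A B; is_arr K g B C\<rbrakk>
      \<Longrightarrow> id_cell K g \<star> id_cell K f = id_cell K (g \<odot> f)"
    and interchange: "\<lbrakk>is_cell K \<sigma> f g; is_cell K \<tau> g h; is_cell K \<sigma>' f' g'; is_cell K \<tau>' g' h';
        Cod K f = Dom K f'\<rbrakk> \<Longrightarrow> (\<tau>' \<bullet> \<sigma>') \<star> (\<tau> \<bullet> \<sigma>) = (\<tau>' \<star> \<tau>) \<bullet> (\<sigma>' \<star> \<sigma>)"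

definition prod_cat ::
    "('o, 'a, 'c) two_cat \<Rightarrow> ('p, 'q, 'r) two_cat \<Rightarrow> ('o \<times> 'p, 'a \<times> 'q, 'c \<times> 'r) two_cat"
  (infixr \<open>\<times>\<^sub>2\<close> 80)
  where "K \<times>\<^sub>2 L = \<lparr>
    Obj = Obj K \<times> Obj L, Arr = Arr K \<times> Arr L, Cell = Cell K \<times> Cell L,
    Dom = (\<lambda>(f, g). (Dom K f, Dom L g)), Cod = (\<lambda>(f, g). (Cod K f, Cod L g)),
    Src = (\<lambda>(\<sigma>, \<tau>). (Src K \<sigma>, Src L \<tau>)), Tgt = (\<lambda>(\<sigma>, \<tau>). (Tgt K \<sigma>, Tgt L \<tau>)),
    id_arr = (\<lambda>(A, B). (id_arr K A, id_arr L B)),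
    id_cell = (\<lambda>(f, g). (id_cell K f, id_cell L g)),
    comp = (\<lambda>(f', g') (f, g). (comp K f' f, comp L g' g)),
    vcomp = (\<lambda>(\<sigma>', \<tau>') (\<sigma>, \<tau>). (vcomp K \<sigma>' \<sigma>, vcomp L \<tau>' \<tau>)),
    hcomp = (\<lambda>(\<sigma>', \<tau>') (\<sigma>, \<tau>). (hcomp K \<sigma>' \<sigma>, hcomp L \<tau>' \<tau>))\<rparr>"

definition unit_cat :: "(unit, unit, unit) two_cat"
  where "unit_cat = \<lparr>
    Obj = UNIV, Arr = UNIV, Cell = UNIV,
    Dom = (\<lambda>_. ()), Cod = (\<lambda>_. ()), Src = (\<lambda>_. ()), Tgt = (\<lambda>_. ()),
    id_arr = (\<lambda>_. ()), id_cell = (\<lambda>_. ()),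
    comp = (\<lambda>_ _. ()), vcomp = (\<lambda>_ _. ()), hcomp = (\<lambda>_ _. ())\<rparr>"


section \<open>2-functors\<close>

text \<open>
  All maps are extensional, i.e.\ \<^const>\<open>undefined\<close> outside the carriers. Hence equality of
  records (of functors, transformations, modifications) is equality of the mathematical data.
\<close>

record ('o, 'a, 'c, 'p, 'q, 'r) two_fun =
  fobj :: "'o \<Rightarrow> 'p"
  farr :: "'a \<Rightarrow> 'q"
  fcell :: "'c \<Rightarrow> 'r"

text \<open>The part common to 2-functors and lax functors.\<close>

locale two_map = A: two_category A + B: two_category B
  for A :: "('o, 'a, 'c) two_cat" and B :: "('p, 'q, 'r) two_cat" +
  fixes F :: "('o, 'a, 'c, 'p, 'q, 'r, 'z) two_fun_scheme"
  assumes fobj: "fobj F \<in> Obj A \<rightarrow>\<^sub>E Obj B"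
    and farr: "farr F \<in> Arr A \<rightarrow>\<^sub>E Arr B"
    and fcell: "fcell F \<in> Cell A \<rightarrow>\<^sub>E Cell B"
    and map_Dom: "f \<in> Arr A \<Longrightarrow> Dom B (farr F f) = fobj F (Dom A f)"
    and map_Cod: "f \<in> Arr A \<Longrightarrow> Cod B (farr F f) = fobj F (Cod A f)"
    and map_Src: "\<theta> \<in> Cell A \<Longrightarrow> Src B (fcell F \<theta>) = farr F (Src A \<theta>)"
    and map_Tgt: "\<theta> \<in> Cell A \<Longrightarrow> Tgt B (fcell F \<theta>) = farr F (Tgt A \<theta>)"
    and map_id_arr: "X \<in> Obj A \<Longrightarrow> farr F (id_arr A X) = id_arr B (fobj F X)"
    and map_id_cell: "f \<in> Arr A \<Longrightarrow> fcell F (id_cell A f) = id_cell B (farr F f)"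
    and map_vcomp: "\<lbrakk>is_cell A \<sigma> f g; is_cell A \<tau> g h\<rbrakk>
      \<Longrightarrow> fcell F (\<tau> \<bullet>\<^bsub>A\<^esub> \<sigma>) = fcell F \<tau> \<bullet>\<^bsub>B\<^esub> fcell F \<sigma>"

locale two_functor = two_map A B F
  for A :: "('o, 'a, 'c) two_cat" and B :: "('p, 'q, 'r) two_cat"
    and F :: "('o, 'a, 'c, 'p, 'q, 'r) two_fun" +
  assumes map_comp: "\<lbrakk>is_arr A f X Y; is_arr A g Y Z\<rbrakk>
      \<Longrightarrow> farr F (g \<odot>\<^bsub>A\<^esub> f) = farr F g \<odot>\<^bsub>B\<^esub> farr F f"
    and map_hcomp: "\<lbrakk>is_cell A \<alpha> f g; is_cell A \<beta> h k; Cod A f = Dom A h\<rbrakk>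
      \<Longrightarrow> fcell F (\<beta> \<star>\<^bsub>A\<^esub> \<alpha>) = fcell F \<beta> \<star>\<^bsub>B\<^esub> fcell F \<alpha>"

definition id_fun :: "('o, 'a, 'c) two_cat \<Rightarrow> ('o, 'a, 'c, 'o, 'a, 'c) two_fun"
  where "id_fun A = \<lparr>fobj = (\<lambda>X\<in>Obj A. X), farr = (\<lambda>f\<in>Arr A. f), fcell = (\<lambda>\<theta>\<in>Cell A. \<theta>)\<rparr>"

definition comp_fun :: "('o, 'a, 'c) two_cat \<Rightarrow> ('p, 'q, 'r, 's, 't, 'u) two_fun
    \<Rightarrow> ('o, 'a, 'c, 'p, 'q, 'r) two_fun \<Rightarrow> ('o, 'a, 'c, 's, 't, 'u) two_fun"
  where "comp_fun A G F = \<lparr>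
    fobj = (\<lambda>X\<in>Obj A. fobj G (fobj F X)),
    farr = (\<lambda>f\<in>Arr A. farr G (farr F f)),
    fcell = (\<lambda>\<theta>\<in>Cell A. fcell G (fcell F \<theta>))\<rparr>"


section \<open>Lax natural transformations and modifications\<close>

record ('o, 'a, 'c, 'p, 'q, 'r) lax_nat =
  tdom :: "('o, 'a, 'c, 'p, 'q, 'r) two_fun"
  tcod :: "('o, 'a, 'c, 'p, 'q, 'r) two_fun"
  tobj :: "'o \<Rightarrow> 'q"
  tarr :: "'a \<Rightarrow> 'r"

text \<open>
  The unit condition \<open>tarr_id\<close> is the nullary case of \<open>tarr_comp\<close>. It does not follow from the
  binary one, which only makes the 2-cell at an identity arrow idempotent.
\<close>

locale lax_transformation =
  fixes A :: "('o, 'a, 'c) two_cat" and B :: "('p, 'q, 'r) two_cat"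
    and \<alpha> :: "('o, 'a, 'c, 'p, 'q, 'r) lax_nat"
  assumes tdom: "two_functor A B (tdom \<alpha>)"
    and tcod: "two_functor A B (tcod \<alpha>)"
    and tobj_ext: "tobj \<alpha> \<in> extensional (Obj A)"
    and tarr_ext: "tarr \<alpha> \<in> extensional (Arr A)"
    and tobj: "X \<in> Obj A \<Longrightarrow> is_arr B (tobj \<alpha> X) (fobj (tdom \<alpha>) X) (fobj (tcod \<alpha>) X)"
    and tarr: "is_arr A f X Y \<Longrightarrow> is_cell B (tarr \<alpha> f)
      (farr (tcod \<alpha>) f \<odot>\<^bsub>B\<^esub> tobj \<alpha> X) (tobj \<alpha> Y \<odot>\<^bsub>B\<^esub> farr (tdom \<alpha>) f)"
    and tarr_id: "X \<in> Obj A \<Longrightarrow> tarr \<alpha> (id_arr A X) = id_cell B (tobj \<alpha> X)"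
    and tarr_comp: "\<lbrakk>is_arr A f X Y; is_arr A g Y Z\<rbrakk> \<Longrightarrow> tarr \<alpha> (g \<odot>\<^bsub>A\<^esub> f) =
      (tarr \<alpha> g \<rhd>\<^bsub>B\<^esub> farr (tdom \<alpha>) f) \<bullet>\<^bsub>B\<^esub> (farr (tcod \<alpha>) g \<lhd>\<^bsub>B\<^esub> tarr \<alpha> f)"
    and tarr_natural: "\<lbrakk>is_arr A f X Y; is_arr A g X Y; is_cell A \<theta> f g\<rbrakk> \<Longrightarrow>
      (tobj \<alpha> Y \<lhd>\<^bsub>B\<^esub> fcell (tdom \<alpha>) \<theta>) \<bullet>\<^bsub>B\<^esub> tarr \<alpha> f =
      tarr \<alpha> g \<bullet>\<^bsub>B\<^esub> (fcell (tcod \<alpha>) \<theta> \<rhd>\<^bsub>B\<^esub> tobj \<alpha> X)"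

record ('o, 'a, 'c, 'p, 'q, 'r) modif =
  msrc :: "('o, 'a, 'c, 'p, 'q, 'r) lax_nat"
  mtgt :: "('o, 'a, 'c, 'p, 'q, 'r) lax_nat"
  mobj :: "'o \<Rightarrow> 'r"

locale modification =
  fixes A :: "('o, 'a, 'c) two_cat" and B :: "('p, 'q, 'r) two_cat"
    and m :: "('o, 'a, 'c, 'p, 'q, 'r) modif"
  assumes msrc: "lax_transformation A B (msrc m)"
    and mtgt: "lax_transformation A B (mtgt m)"
    and tdom_eq: "tdom (msrc m) = tdom (mtgt m)"
    and tcod_eq: "tcod (msrc m) = tcod (mtgt m)"
    and mobj_ext: "mobj m \<in> extensional (Obj A)"
    and mobj: "X \<in> Obj A \<Longrightarrow> is_cell B (mobj m X) (tobj (msrc m) X) (tobj (mtgt m) X)"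
    and mobj_natural: "is_arr A f X Y \<Longrightarrow>
      (mobj m Y \<rhd>\<^bsub>B\<^esub> farr (tdom (msrc m)) f) \<bullet>\<^bsub>B\<^esub> tarr (msrc m) f =
      tarr (mtgt m) f \<bullet>\<^bsub>B\<^esub> (farr (tcod (msrc m)) f \<lhd>\<^bsub>B\<^esub> mobj m X)"


section \<open>The 2-category of 2-functors, lax natural transformations and modifications\<close>

definition id_nat :: "('o, 'a, 'c) two_cat \<Rightarrow> ('p, 'q, 'r) two_cat
    \<Rightarrow> ('o, 'a, 'c, 'p, 'q, 'r) two_fun \<Rightarrow> ('o, 'a, 'c, 'p, 'q, 'r) lax_nat"
  where "id_nat A B F = \<lparr>tdom = F, tcod = F,
    tobj = (\<lambda>X\<in>Obj A. id_arr B (fobj F X)),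
    tarr = (\<lambda>f\<in>Arr A. id_cell B (farr F f))\<rparr>"

definition comp_nat :: "('o, 'a, 'c) two_cat \<Rightarrow> ('p, 'q, 'r) two_cat
    \<Rightarrow> ('o, 'a, 'c, 'p, 'q, 'r) lax_nat \<Rightarrow> ('o, 'a, 'c, 'p, 'q, 'r) lax_nat
    \<Rightarrow> ('o, 'a, 'c, 'p, 'q, 'r) lax_nat"
  where "comp_nat A B \<beta> \<alpha> = \<lparr>tdom = tdom \<alpha>, tcod = tcod \<beta>,
    tobj = (\<lambda>X\<in>Obj A. tobj \<beta> X \<odot>\<^bsub>B\<^esub> tobj \<alpha> X),
    tarr = (\<lambda>f\<in>Arr A. (tobj \<beta> (Cod A f) \<lhd>\<^bsub>B\<^esub> tarr \<alpha> f) \<bullet>\<^bsub>B\<^esub> (tarr \<beta> f \<rhd>\<^bsub>B\<^esub> tobj \<alpha> (Dom A f)))\<rparr>"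

definition Lax :: "('o, 'a, 'c) two_cat \<Rightarrow> ('p, 'q, 'r) two_cat
    \<Rightarrow> (('o, 'a, 'c, 'p, 'q, 'r) two_fun, ('o, 'a, 'c, 'p, 'q, 'r) lax_nat,
        ('o, 'a, 'c, 'p, 'q, 'r) modif) two_cat"
  where "Lax A B = \<lparr>
    Obj = {F. two_functor A B F},
    Arr = {\<alpha>. lax_transformation A B \<alpha>},
    Cell = {m. modification A B m},
    Dom = tdom, Cod = tcod, Src = msrc, Tgt = mtgt,
    id_arr = id_nat A B,
    id_cell = (\<lambda>\<alpha>. \<lparr>msrc = \<alpha>, mtgt = \<alpha>, mobj = (\<lambda>X\<in>Obj A. id_cell B (tobj \<alpha> X))\<rparr>),
    comp = comp_nat A B,
    vcomp = (\<lambda>n m. \<lparr>msrc = msrc m, mtgt = mtgt n,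
      mobj = (\<lambda>X\<in>Obj A. mobj n X \<bullet>\<^bsub>B\<^esub> mobj m X)\<rparr>),
    hcomp = (\<lambda>n m. \<lparr>msrc = comp_nat A B (msrc n) (msrc m), mtgt = comp_nat A B (mtgt n) (mtgt m),
      mobj = (\<lambda>X\<in>Obj A. mobj n X \<star>\<^bsub>B\<^esub> mobj m X)\<rparr>)\<rparr>"


section \<open>Lax functors\<close>

text \<open>
  \<^term>\<open>coh F (f, g)\<close> is the coherence 2-cell \<open>Fg \<odot> Ff \<Rightarrow> F(g \<odot> f)\<close>. Identity arrows are
  preserved strictly; no further condition is imposed on \<^term>\<open>coh F (f, g)\<close> when \<open>f\<close> or \<open>g\<close>
  is an identity.
\<close>

record ('o, 'a, 'c, 'p, 'q, 'r) lax_fun = "('o, 'a, 'c, 'p, 'q, 'r) two_fun" +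
  coh :: "'a \<times> 'a \<Rightarrow> 'r"

definition composable :: "('o, 'a, 'c) two_cat \<Rightarrow> ('a \<times> 'a) set"
  where "composable A = {(f, g). f \<in> Arr A \<and> g \<in> Arr A \<and> Cod A f = Dom A g}"

locale lax_functor = two_map A B F
  for A :: "('o, 'a, 'c) two_cat" and B :: "('p, 'q, 'r) two_cat"
    and F :: "('o, 'a, 'c, 'p, 'q, 'r) lax_fun" +
  assumes coh_ext: "coh F \<in> extensional (composable A)"
    and coh: "\<lbrakk>is_arr A f X Y; is_arr A g Y Z\<rbrakk>
      \<Longrightarrow> is_cell B (coh F (f, g)) (farr F g \<odot>\<^bsub>B\<^esub> farr F f) (farr F (g \<odot>\<^bsub>A\<^esub> f))"
    and coh_assoc: "\<lbrakk>is_arr A f W X; is_arr A g X Y; is_arr A h Y Z\<rbrakk> \<Longrightarrow>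
      coh F (g \<odot>\<^bsub>A\<^esub> f, h) \<bullet>\<^bsub>B\<^esub> (farr F h \<lhd>\<^bsub>B\<^esub> coh F (f, g)) =
      coh F (f, h \<odot>\<^bsub>A\<^esub> g) \<bullet>\<^bsub>B\<^esub> (coh F (g, h) \<rhd>\<^bsub>B\<^esub> farr F f)"
    and coh_natural: "\<lbrakk>is_arr A f X Y; is_arr A g X Y; is_arr A h Y Z; is_arr A k Y Z;
        is_cell A \<alpha> f g; is_cell A \<beta> h k\<rbrakk> \<Longrightarrow>
      coh F (g, k) \<bullet>\<^bsub>B\<^esub> (fcell F \<beta> \<star>\<^bsub>B\<^esub> fcell F \<alpha>) =
      fcell F (\<beta> \<star>\<^bsub>A\<^esub> \<alpha>) \<bullet>\<^bsub>B\<^esub> coh F (f, h)"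

text \<open>A 2-functor regarded as a lax functor with identity coherence 2-cells.\<close>

definition strict :: "('o, 'a, 'c) two_cat \<Rightarrow> ('p, 'q, 'r) two_cat
    \<Rightarrow> ('o, 'a, 'c, 'p, 'q, 'r) two_fun \<Rightarrow> ('o, 'a, 'c, 'p, 'q, 'r) lax_fun"
  where "strict A B F = \<lparr>fobj = fobj F, farr = farr F, fcell = fcell F,
    coh = (\<lambda>(f, g)\<in>composable A. id_cell B (farr F (g \<odot>\<^bsub>A\<^esub> f)))\<rparr>"

definition id_lax :: "('o, 'a, 'c) two_cat \<Rightarrow> ('o, 'a, 'c, 'o, 'a, 'c) lax_fun"
  where "id_lax A = strict A A (id_fun A)"

text \<open>The composite of \<open>F : A \<rightarrow> B\<close> and \<open>G : B \<rightarrow> C\<close>.\<close>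

definition comp_lax :: "('o, 'a, 'c) two_cat \<Rightarrow> ('s, 't, 'u) two_cat
    \<Rightarrow> ('p, 'q, 'r, 's, 't, 'u) lax_fun \<Rightarrow> ('o, 'a, 'c, 'p, 'q, 'r) lax_fun
    \<Rightarrow> ('o, 'a, 'c, 's, 't, 'u) lax_fun"
  where "comp_lax A C G F = \<lparr>
    fobj = (\<lambda>X\<in>Obj A. fobj G (fobj F X)),
    farr = (\<lambda>f\<in>Arr A. farr G (farr F f)),
    fcell = (\<lambda>\<theta>\<in>Cell A. fcell G (fcell F \<theta>)),
    coh = (\<lambda>(f, g)\<in>composable A. fcell G (coh F (f, g)) \<bullet>\<^bsub>C\<^esub> coh G (farr F f, farr F g))\<rparr>"

text \<open>The product of \<open>F : A \<rightarrow> B\<close> and \<open>F' : A' \<rightarrow> B'\<close>.\<close>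

definition prod_lax :: "('o, 'a, 'c) two_cat \<Rightarrow> ('o1, 'a1, 'c1) two_cat
    \<Rightarrow> ('o, 'a, 'c, 'p, 'q, 'r) lax_fun \<Rightarrow> ('o1, 'a1, 'c1, 'p1, 'q1, 'r1) lax_fun
    \<Rightarrow> ('o \<times> 'o1, 'a \<times> 'a1, 'c \<times> 'c1, 'p \<times> 'p1, 'q \<times> 'q1, 'r \<times> 'r1) lax_fun"
  where "prod_lax A A' F F' = \<lparr>
    fobj = (\<lambda>(X, X')\<in>Obj (A \<times>\<^sub>2 A'). (fobj F X, fobj F' X')),
    farr = (\<lambda>(f, f')\<in>Arr (A \<times>\<^sub>2 A'). (farr F f, farr F' f')),
    fcell = (\<lambda>(\<theta>, \<theta>')\<in>Cell (A \<times>\<^sub>2 A'). (fcell F \<theta>, fcell F' \<theta>')),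
    coh = (\<lambda>((f, f'), (g, g'))\<in>composable (A \<times>\<^sub>2 A'). (coh F (f, g), coh F' (f', g')))\<rparr>"

definition assoc_lax :: "('o, 'a, 'c) two_cat \<Rightarrow> ('p, 'q, 'r) two_cat \<Rightarrow> ('s, 't, 'u) two_cat
    \<Rightarrow> (('o \<times> 'p) \<times> 's, ('a \<times> 'q) \<times> 't, ('c \<times> 'r) \<times> 'u,
        'o \<times> 'p \<times> 's, 'a \<times> 'q \<times> 't, 'c \<times> 'r \<times> 'u) lax_fun"
  where "assoc_lax A B C = strict ((A \<times>\<^sub>2 B) \<times>\<^sub>2 C) (A \<times>\<^sub>2 (B \<times>\<^sub>2 C)) \<lparr>
    fobj = (\<lambda>((X, Y), Z)\<in>Obj ((A \<times>\<^sub>2 B) \<times>\<^sub>2 C). (X, Y, Z)),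
    farr = (\<lambda>((f, g), h)\<in>Arr ((A \<times>\<^sub>2 B) \<times>\<^sub>2 C). (f, g, h)),
    fcell = (\<lambda>((\<theta>, \<eta>), \<zeta>)\<in>Cell ((A \<times>\<^sub>2 B) \<times>\<^sub>2 C). (\<theta>, \<eta>, \<zeta>))\<rparr>"

definition lunit_lax :: "('o, 'a, 'c) two_cat
    \<Rightarrow> (unit \<times> 'o, unit \<times> 'a, unit \<times> 'c, 'o, 'a, 'c) lax_fun"
  where "lunit_lax A = strict (unit_cat \<times>\<^sub>2 A) A \<lparr>
    fobj = restrict snd (Obj (unit_cat \<times>\<^sub>2 A)),
    farr = restrict snd (Arr (unit_cat \<times>\<^sub>2 A)),
    fcell = restrict snd (Cell (unit_cat \<times>\<^sub>2 A))\<rparr>"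

definition runit_lax :: "('o, 'a, 'c) two_cat
    \<Rightarrow> ('o \<times> unit, 'a \<times> unit, 'c \<times> unit, 'o, 'a, 'c) lax_fun"
  where "runit_lax A = strict (A \<times>\<^sub>2 unit_cat) A \<lparr>
    fobj = restrict fst (Obj (A \<times>\<^sub>2 unit_cat)),
    farr = restrict fst (Arr (A \<times>\<^sub>2 unit_cat)),
    fcell = restrict fst (Cell (A \<times>\<^sub>2 unit_cat))\<rparr>"


section \<open>Lax 3-categories\<close>

text \<open>
  Categories enriched in the cartesian monoidal category of 2-categories and lax functors. The
  composition \<^term>\<open>enr_comp V X Y Z\<close> goes from \<open>hom Y Z \<times> hom X Y\<close> to \<open>hom X Z\<close>, and
  \<^term>\<open>enr_unit V X\<close> goes from the terminal 2-category to \<open>hom X X\<close>.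
\<close>

record ('x, 'o, 'a, 'c) enriched =
  enr_obj :: "'x set"
  enr_hom :: "'x \<Rightarrow> 'x \<Rightarrow> ('o, 'a, 'c) two_cat"
  enr_comp :: "'x \<Rightarrow> 'x \<Rightarrow> 'x \<Rightarrow> ('o \<times> 'o, 'a \<times> 'a, 'c \<times> 'c, 'o, 'a, 'c) lax_fun"
  enr_unit :: "'x \<Rightarrow> (unit, unit, unit, 'o, 'a, 'c) lax_fun"

locale lax_3_category =
  fixes V :: "('x, 'o, 'a, 'c) enriched"
  assumes hom: "\<lbrakk>X \<in> enr_obj V; Y \<in> enr_obj V\<rbrakk> \<Longrightarrow> two_category (enr_hom V X Y)"
    and comp: "\<lbrakk>X \<in> enr_obj V; Y \<in> enr_obj V; Z \<in> enr_obj V\<rbrakk> \<Longrightarrow>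
      lax_functor (enr_hom V Y Z \<times>\<^sub>2 enr_hom V X Y) (enr_hom V X Z) (enr_comp V X Y Z)"
    and unit: "X \<in> enr_obj V \<Longrightarrow> lax_functor unit_cat (enr_hom V X X) (enr_unit V X)"
    and assoc: "\<lbrakk>W \<in> enr_obj V; X \<in> enr_obj V; Y \<in> enr_obj V; Z \<in> enr_obj V\<rbrakk> \<Longrightarrow>
      comp_lax ((enr_hom V Y Z \<times>\<^sub>2 enr_hom V X Y) \<times>\<^sub>2 enr_hom V W X) (enr_hom V W Z)
        (enr_comp V W X Z)
        (prod_lax (enr_hom V Y Z \<times>\<^sub>2 enr_hom V X Y) (enr_hom V W X)
          (enr_comp V X Y Z) (id_lax (enr_hom V W X))) =
      comp_lax ((enr_hom V Y Z \<times>\<^sub>2 enr_hom V X Y) \<times>\<^sub>2 enr_hom V W X) (enr_hom V W Z)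
        (enr_comp V W Y Z)
        (comp_lax ((enr_hom V Y Z \<times>\<^sub>2 enr_hom V X Y) \<times>\<^sub>2 enr_hom V W X)
          (enr_hom V Y Z \<times>\<^sub>2 enr_hom V W Y)
          (prod_lax (enr_hom V Y Z) (enr_hom V X Y \<times>\<^sub>2 enr_hom V W X)
            (id_lax (enr_hom V Y Z)) (enr_comp V W X Y))
          (assoc_lax (enr_hom V Y Z) (enr_hom V X Y) (enr_hom V W X)))"
    and unit_left: "\<lbrakk>X \<in> enr_obj V; Y \<in> enr_obj V\<rbrakk> \<Longrightarrow>
      comp_lax (unit_cat \<times>\<^sub>2 enr_hom V X Y) (enr_hom V X Y)
        (enr_comp V X Y Y)
        (prod_lax unit_cat (enr_hom V X Y) (enr_unit V Y) (id_lax (enr_hom V X Y))) =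
      lunit_lax (enr_hom V X Y)"
    and unit_right: "\<lbrakk>X \<in> enr_obj V; Y \<in> enr_obj V\<rbrakk> \<Longrightarrow>
      comp_lax (enr_hom V X Y \<times>\<^sub>2 unit_cat) (enr_hom V X Y)
        (enr_comp V X X Y)
        (prod_lax (enr_hom V X Y) unit_cat (id_lax (enr_hom V X Y)) (enr_unit V X)) =
      runit_lax (enr_hom V X Y)"


section \<open>The composition of lax natural transformations and modifications\<close>

definition tensor_nat :: "('o, 'a, 'c) two_cat \<Rightarrow> ('s, 't, 'u) two_cat
    \<Rightarrow> ('p, 'q, 'r, 's, 't, 'u) lax_nat \<Rightarrow> ('o, 'a, 'c, 'p, 'q, 'r) lax_nat
    \<Rightarrow> ('o, 'a, 'c, 's, 't, 'u) lax_nat"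
  where "tensor_nat A C \<beta> \<alpha> = (let G = tdom \<beta>; H = tcod \<alpha> in \<lparr>
    tdom = comp_fun A (tdom \<beta>) (tdom \<alpha>),
    tcod = comp_fun A (tcod \<beta>) (tcod \<alpha>),
    tobj = (\<lambda>X\<in>Obj A. tobj \<beta> (fobj H X) \<odot>\<^bsub>C\<^esub> farr G (tobj \<alpha> X)),
    tarr = (\<lambda>f\<in>Arr A.
      (tobj \<beta> (fobj H (Cod A f)) \<lhd>\<^bsub>C\<^esub> fcell G (tarr \<alpha> f)) \<bullet>\<^bsub>C\<^esub>
      (tarr \<beta> (farr H f) \<rhd>\<^bsub>C\<^esub> farr G (tobj \<alpha> (Dom A f))))\<rparr>)"

definition tensor_modif :: "('o, 'a, 'c) two_cat \<Rightarrow> ('s, 't, 'u) two_cat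
    \<Rightarrow> ('p, 'q, 'r, 's, 't, 'u) modif \<Rightarrow> ('o, 'a, 'c, 'p, 'q, 'r) modif
    \<Rightarrow> ('o, 'a, 'c, 's, 't, 'u) modif"
  where "tensor_modif A C n m = (let G = tdom (msrc n); H = tcod (msrc m) in \<lparr>
    msrc = tensor_nat A C (msrc n) (msrc m),
    mtgt = tensor_nat A C (mtgt n) (mtgt m),
    mobj = (\<lambda>X\<in>Obj A. mobj n (fobj H X) \<star>\<^bsub>C\<^esub> fcell G (mobj m X))\<rparr>)"

text \<open>The coherence cell \<open>(\<delta> \<otimes> \<gamma>)(\<beta> \<otimes> \<alpha>) \<Rrightarrow> \<delta>\<beta> \<otimes> \<gamma>\<alpha>\<close>.\<close>

definition tensor_coh ::
    "('o, 'a, 'c) two_cat \<Rightarrow> ('p, 'q, 'r) two_cat \<Rightarrow> ('s, 't, 'u) two_cat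
    \<Rightarrow> ('p, 'q, 'r, 's, 't, 'u) lax_nat \<Rightarrow> ('o, 'a, 'c, 'p, 'q, 'r) lax_nat
    \<Rightarrow> ('p, 'q, 'r, 's, 't, 'u) lax_nat \<Rightarrow> ('o, 'a, 'c, 'p, 'q, 'r) lax_nat
    \<Rightarrow> ('o, 'a, 'c, 's, 't, 'u) modif"
  where "tensor_coh A B C \<delta> \<gamma> \<beta> \<alpha> = (let G = tdom \<beta>; L = tcod \<gamma> in \<lparr>
    msrc = comp_nat A C (tensor_nat A C \<delta> \<gamma>) (tensor_nat A C \<beta> \<alpha>),
    mtgt = tensor_nat A C (comp_nat B C \<delta> \<beta>) (comp_nat A B \<gamma> \<alpha>),
    mobj = (\<lambda>X\<in>Obj A.
      (tobj \<delta> (fobj L X) \<lhd>\<^bsub>C\<^esub> tarr \<beta> (tobj \<gamma> X)) \<rhd>\<^bsub>C\<^esub> farr G (tobj \<alpha> X))\<rparr>)"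

definition tensor :: "('o, 'a, 'c) two_cat \<Rightarrow> ('p, 'q, 'r) two_cat \<Rightarrow> ('s, 't, 'u) two_cat
    \<Rightarrow> (('p, 'q, 'r, 's, 't, 'u) two_fun \<times> ('o, 'a, 'c, 'p, 'q, 'r) two_fun,
        ('p, 'q, 'r, 's, 't, 'u) lax_nat \<times> ('o, 'a, 'c, 'p, 'q, 'r) lax_nat,
        ('p, 'q, 'r, 's, 't, 'u) modif \<times> ('o, 'a, 'c, 'p, 'q, 'r) modif,
        ('o, 'a, 'c, 's, 't, 'u) two_fun,
        ('o, 'a, 'c, 's, 't, 'u) lax_nat,
        ('o, 'a, 'c, 's, 't, 'u) modif) lax_fun"
  where "tensor A B C = \<lparr>
    fobj = (\<lambda>(G, F)\<in>Obj (Lax B C \<times>\<^sub>2 Lax A B). comp_fun A G F),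
    farr = (\<lambda>(\<beta>, \<alpha>)\<in>Arr (Lax B C \<times>\<^sub>2 Lax A B). tensor_nat A C \<beta> \<alpha>),
    fcell = (\<lambda>(n, m)\<in>Cell (Lax B C \<times>\<^sub>2 Lax A B). tensor_modif A C n m),
    coh = (\<lambda>((\<beta>, \<alpha>), (\<delta>, \<gamma>))\<in>composable (Lax B C \<times>\<^sub>2 Lax A B). tensor_coh A B C \<delta> \<gamma> \<beta> \<alpha>)\<rparr>"

text \<open>The strict 2-functor from the terminal 2-category to \<^term>\<open>K\<close> that picks the object \<^term>\<open>X\<close>.\<close>

definition point :: "('o, 'a, 'c) two_cat \<Rightarrow> 'o \<Rightarrow> (unit, unit, unit, 'o, 'a, 'c) lax_fun"
  where "point K X = strict unit_cat K \<lparr>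
    fobj = (\<lambda>_. X), farr = (\<lambda>_. id_arr K X), fcell = (\<lambda>_. id_cell K (id_arr K X))\<rparr>"

text \<open>
  The objects are all 2-categories whose objects, arrows and 2-cells are drawn from the types
  \<open>'o\<close>, \<open>'a\<close>, \<open>'c\<close>, which play the role of the universe of small sets.
\<close>

definition Lax_3Cat :: "(('o, 'a, 'c) two_cat,
    ('o, 'a, 'c, 'o, 'a, 'c) two_fun, ('o, 'a, 'c, 'o, 'a, 'c) lax_nat,
    ('o, 'a, 'c, 'o, 'a, 'c) modif) enriched"
  where "Lax_3Cat = \<lparr>
    enr_obj = {A. two_category A},
    enr_hom = Lax,
    enr_comp = tensor,
    enr_unit = (\<lambda>A. point (Lax A A) (id_fun A))\<rparr>"

end

theory Submission
  imports Defs
begin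

text \<open>
  Precomposition \<open>(-)F\<close> with a 2-functor and postcomposition \<open>G(-)\<close> with a 2-functor are strict
  2-functors between the 2-categories \<open>Lax\<close>, and they commute with each other. In terms of them,
  \<open>\<beta> \<otimes> \<alpha> = (\<beta>H)(G\<alpha>)\<close> and \<open>n \<otimes> m = nH \<star> Gm\<close>. The only non-strict datum is the interchanger
  \<open>\<chi>(\<beta>, \<gamma>) : (K\<gamma>)(\<beta>F) \<Rrightarrow> (\<beta>L)(G\<gamma>)\<close> of \<open>\<gamma> : F \<Rightarrow> L\<close> and \<open>\<beta> : G \<Rightarrow> K\<close>, whose component at \<open>X\<close> is the
  2-cell of \<open>\<beta>\<close> at the arrow \<open>\<gamma>\<^sub>X\<close>; the coherence cell of \<open>\<otimes>\<close> is \<open>\<delta>L \<star> \<chi>(\<beta>, \<gamma>) \<star> G\<alpha>\<close>. The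
  interchanger is natural in both variables, compatible with composition in both variables, and
  compatible with pre- and postcomposition. Given this, the laws of the lax 3-category are
  calculations in a single 2-category \<open>Lax A C\<close>, without reference to components; the coherence laws
  come down to interchanging two whiskered interchangers.
\<close>

section \<open>Calculus in 2-categories\<close>

text \<open>Lax transformations \<beta> : G \<Rightarrow> K and \<gamma> : F \<Rightarrow> L give
  two arrows from GF to KL, and \<beta> supplies a 2-cell between them in one direction only; hence
  \<otimes> is lax. Each axiom of a lax transformation turns into one law of the interchanger:
  naturality at 2-cells makes it a modification and natural in \<gamma>, the law at composites
  expands it along a composite \<gamma>, and the unit law makes it an identity at an identity
  \<gamma>.

  The obstacle is that all laws are equations of records. A modification carries its source and
  target, and these carry their 2-functors, so equations such as (HG)F = H(GF) must be rewritten
  inside every term, and a law for 2-cells presupposes the same law for arrows. Whiskering laws are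
  therefore proved for arrows before cells, and the locales \<open>lax_arrow\<close>,
  \<open>lax_cell\<close> and \<open>lax_pair\<close> keep track of the boundaries.\<close>

context two_category
begin

text \<open>
  The simplification rules bring every 2-cell into a right-nested vertical composite of whiskered cells
  \<open>id g \<star> (\<theta> \<star> id f)\<close>, so that only the interchange steps remain to be done by hand.
\<close>

lemma arr_closed [simp]:
  assumes "f \<in> Arr K"
  shows "Dom K f \<in> Obj K" "Cod K f \<in> Obj K"
  using assms Dom_closed Cod_closed by auto

text \<open>The last two equations fix a normal form: the end objects of a 2-cell are always read
  off its source arrow.\<close>

lemma cell_closed [simp]:
  assumes "\<theta> \<in> Cell K"
  shows "Src K \<theta> \<in> Arr K" "Tgt K \<theta> \<in> Arr K"
    "Dom K (Tgt K \<theta>) = Dom K (Src K \<theta>)" "Cod K (Tgt K \<theta>) = Cod K (Src K \<theta>)"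
  using assms Src_closed Tgt_closed Dom_Src Cod_Src by auto

lemma id_arr_simps [simp]:
  assumes "X \<in> Obj K"
  shows "id_arr K X \<in> Arr K" "Dom K (id_arr K X) = X" "Cod K (id_arr K X) = X"
  using id_arr[OF assms] by (auto simp: is_arr_def)

lemma id_cell_simps [simp]:
  assumes "f \<in> Arr K"
  shows "id_cell K f \<in> Cell K" "Src K (id_cell K f) = f" "Tgt K (id_cell K f) = f"
  using id_cell[OF assms] by (auto simp: is_cell_def)

lemma comp_simps [simp]:
  assumes "f \<in> Arr K" "g \<in> Arr K" "Cod K f = Dom K g"
  shows "g \<odot> f \<in> Arr K" "Dom K (g \<odot> f) = Dom K f" "Cod K (g \<odot> f) = Cod K g"
  using comp[of f "Dom K f" "Dom K g" g "Cod K g"] assms by (auto simp: is_arr_def)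

text \<open>The object of the identity is a variable with an equational premise, so the rule matches
  whichever term denotes that object. The unit rules for both compositions of 2-cells have the same
  shape.\<close>

lemma comp_unit_simps [simp]:
  assumes "f \<in> Arr K"
  shows "Cod K f = Y \<Longrightarrow> id_arr K Y \<odot> f = f" "Dom K f = X \<Longrightarrow> f \<odot> id_arr K X = f"
  using assms comp_id_left comp_id_right by (auto simp: is_arr_def)

lemma comp_assoc' [simp]:
  "\<lbrakk>f \<in> Arr K; g \<in> Arr K; h \<in> Arr K; Cod K f = Dom K g; Cod K g = Dom K h\<rbrakk>
    \<Longrightarrow> (h \<odot> g) \<odot> f = h \<odot> (g \<odot> f)"
  using comp_assoc by (auto simp: is_arr_def)

lemma vcomp_simps [simp]:
  assumes "\<sigma> \<in> Cell K" "\<tau> \<in> Cell K" "Tgt K \<sigma> = Src K \<tau>"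
  shows "\<tau> \<bullet> \<sigma> \<in> Cell K" "Src K (\<tau> \<bullet> \<sigma>) = Src K \<sigma>" "Tgt K (\<tau> \<bullet> \<sigma>) = Tgt K \<tau>"
  using vcomp[of \<sigma> "Src K \<sigma>" "Src K \<tau>" \<tau> "Tgt K \<tau>"] assms by (auto simp: is_cell_def)

lemma vcomp_unit_simps [simp]:
  assumes "\<sigma> \<in> Cell K"
  shows "Tgt K \<sigma> = g \<Longrightarrow> id_cell K g \<bullet> \<sigma> = \<sigma>" "Src K \<sigma> = f \<Longrightarrow> \<sigma> \<bullet> id_cell K f = \<sigma>"
  using assms vcomp_id_left vcomp_id_right by (auto simp: is_cell_def)

lemma vcomp_assoc' [simp]:
  "\<lbrakk>\<sigma> \<in> Cell K; \<tau> \<in> Cell K; \<upsilon> \<in> Cell K; Tgt K \<sigma> = Src K \<tau>; Tgt K \<tau> = Src K \<upsilon>\<rbrakk>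
    \<Longrightarrow> (\<upsilon> \<bullet> \<tau>) \<bullet> \<sigma> = \<upsilon> \<bullet> (\<tau> \<bullet> \<sigma>)"
  using vcomp_assoc by (auto simp: is_cell_def)

lemma hcomp_simps [simp]:
  assumes "\<alpha> \<in> Cell K" "\<beta> \<in> Cell K" "Cod K (Src K \<alpha>) = Dom K (Src K \<beta>)"
  shows "\<beta> \<star> \<alpha> \<in> Cell K" "Src K (\<beta> \<star> \<alpha>) = Src K \<beta> \<odot> Src K \<alpha>"
    "Tgt K (\<beta> \<star> \<alpha>) = Tgt K \<beta> \<odot> Tgt K \<alpha>"
  using hcomp[of \<alpha> "Src K \<alpha>" "Tgt K \<alpha>" \<beta> "Src K \<beta>" "Tgt K \<beta>"] assms by (auto simp: is_cell_def)

lemma hcomp_unit_simps [simp]: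
  assumes "\<alpha> \<in> Cell K"
  shows "Cod K (Src K \<alpha>) = Y \<Longrightarrow> id_cell K (id_arr K Y) \<star> \<alpha> = \<alpha>"
    "Dom K (Src K \<alpha>) = X \<Longrightarrow> \<alpha> \<star> id_cell K (id_arr K X) = \<alpha>"
  using assms hcomp_id_left hcomp_id_right by (auto simp: is_cell_def)

lemma hcomp_assoc' [simp]:
  assumes "\<alpha> \<in> Cell K" "\<beta> \<in> Cell K" "\<gamma> \<in> Cell K"
    "Cod K (Src K \<alpha>) = Dom K (Src K \<beta>)" "Cod K (Src K \<beta>) = Dom K (Src K \<gamma>)"
  shows "(\<gamma> \<star> \<beta>) \<star> \<alpha> = \<gamma> \<star> (\<beta> \<star> \<alpha>)"
  using hcomp_assoc[of \<alpha> "Src K \<alpha>" "Tgt K \<alpha>" \<beta> "Src K \<beta>" "Tgt K \<beta>" \<gamma> "Src K \<gamma>" "Tgt K \<gamma>"] assms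
  by (auto simp: is_cell_def)

lemma hcomp_id_cell' [simp]:
  "\<lbrakk>f \<in> Arr K; g \<in> Arr K; Cod K f = Dom K g\<rbrakk> \<Longrightarrow> id_cell K g \<star> id_cell K f = id_cell K (g \<odot> f)"
  using hcomp_id_cell by (auto simp: is_arr_def)

text \<open>Closes a critical pair: on the left, \<open>hcomp_assoc'\<close> separates two adjacent
  identity whiskers before \<open>hcomp_id_cell'\<close> can merge them. On the right the same rule
  brings them together.\<close>

lemma lwhisker_comp [simp]:
  "\<lbrakk>f \<in> Arr K; g \<in> Arr K; \<theta> \<in> Cell K; Cod K f = Dom K g; Cod K (Src K \<theta>) = Dom K f\<rbrakk>
    \<Longrightarrow> id_cell K g \<star> (id_cell K f \<star> \<theta>) = id_cell K (g \<odot> f) \<star> \<theta>"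
  using hcomp_assoc'[of \<theta> "id_cell K f" "id_cell K g"] by simp

lemma interchange':
  assumes "\<sigma> \<in> Cell K" "\<tau> \<in> Cell K" "\<sigma>' \<in> Cell K" "\<tau>' \<in> Cell K"
    "Tgt K \<sigma> = Src K \<tau>" "Tgt K \<sigma>' = Src K \<tau>'" "Cod K (Src K \<sigma>) = Dom K (Src K \<sigma>')"
  shows "(\<tau>' \<bullet> \<sigma>') \<star> (\<tau> \<bullet> \<sigma>) = (\<tau>' \<star> \<tau>) \<bullet> (\<sigma>' \<star> \<sigma>)"
  using interchange[of \<sigma> "Src K \<sigma>" "Src K \<tau>" \<tau> "Tgt K \<tau>" \<sigma>' "Src K \<sigma>'" "Src K \<tau>'" \<tau>' "Tgt K \<tau>'"] assms
  by (auto simp: is_cell_def)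

lemma lwhisker_vcomp [simp]:
  assumes "g \<in> Arr K" "\<sigma> \<in> Cell K" "\<tau> \<in> Cell K" "Tgt K \<sigma> = Src K \<tau>" "Cod K (Src K \<sigma>) = Dom K g"
  shows "id_cell K g \<star> (\<tau> \<bullet> \<sigma>) = (id_cell K g \<star> \<tau>) \<bullet> (id_cell K g \<star> \<sigma>)"
  using interchange'[of \<sigma> \<tau> "id_cell K g" "id_cell K g"] assms by simp

lemma rwhisker_vcomp [simp]:
  assumes "f \<in> Arr K" "\<sigma> \<in> Cell K" "\<tau> \<in> Cell K" "Tgt K \<sigma> = Src K \<tau>" "Cod K f = Dom K (Src K \<sigma>)"
  shows "(\<tau> \<bullet> \<sigma>) \<star> id_cell K f = (\<tau> \<star> id_cell K f) \<bullet> (\<sigma> \<star> id_cell K f)"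
  using interchange'[of "id_cell K f" "id_cell K f" \<sigma> \<tau>] assms by simp

text \<open>Both sides equal \<tau> \<star> \<sigma>: by interchange it does not matter which factor
  is delayed by an identity. This is the only genuine 2-dimensional move in the later
  calculations.\<close>

lemma whisker_swap:
  assumes "\<sigma> \<in> Cell K" "\<tau> \<in> Cell K" "Cod K (Src K \<sigma>) = Dom K (Src K \<tau>)"
  shows "(id_cell K (Tgt K \<tau>) \<star> \<sigma>) \<bullet> (\<tau> \<star> id_cell K (Src K \<sigma>)) =
    (\<tau> \<star> id_cell K (Tgt K \<sigma>)) \<bullet> (id_cell K (Src K \<tau>) \<star> \<sigma>)"
  using assms interchange'[of "id_cell K (Src K \<sigma>)" \<sigma> \<tau> "id_cell K (Tgt K \<tau>)"]
    interchange'[of \<sigma> "id_cell K (Tgt K \<sigma>)" "id_cell K (Src K \<tau>)" \<tau>] by simp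

lemma hcomp_decompose:
  assumes "\<sigma> \<in> Cell K" "\<tau> \<in> Cell K" "Cod K (Src K \<sigma>) = Dom K (Src K \<tau>)"
  shows "\<tau> \<star> \<sigma> = (\<tau> \<star> id_cell K (Tgt K \<sigma>)) \<bullet> (id_cell K (Src K \<tau>) \<star> \<sigma>)"
  using assms interchange'[of \<sigma> "id_cell K (Tgt K \<sigma>)" "id_cell K (Src K \<tau>)" \<tau>] by simp

text \<open>Oriented against the whisker rules: it gathers a vertical composite into one horizontal
  composite, so that a law for the middle factor can be applied in place.\<close>

lemma vcomp_hcomp3:
  assumes "\<sigma>\<^sub>1 \<in> Cell K" "\<sigma>\<^sub>2 \<in> Cell K" "\<sigma>\<^sub>3 \<in> Cell K" "\<tau>\<^sub>1 \<in> Cell K" "\<tau>\<^sub>2 \<in> Cell K" "\<tau>\<^sub>3 \<in> Cell K"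
    "Tgt K \<sigma>\<^sub>1 = Src K \<tau>\<^sub>1" "Tgt K \<sigma>\<^sub>2 = Src K \<tau>\<^sub>2" "Tgt K \<sigma>\<^sub>3 = Src K \<tau>\<^sub>3"
    "Cod K (Src K \<sigma>\<^sub>2) = Dom K (Src K \<sigma>\<^sub>1)" "Cod K (Src K \<sigma>\<^sub>3) = Dom K (Src K \<sigma>\<^sub>2)"
  shows "(\<tau>\<^sub>1 \<star> (\<tau>\<^sub>2 \<star> \<tau>\<^sub>3)) \<bullet> (\<sigma>\<^sub>1 \<star> (\<sigma>\<^sub>2 \<star> \<sigma>\<^sub>3)) = (\<tau>\<^sub>1 \<bullet> \<sigma>\<^sub>1) \<star> ((\<tau>\<^sub>2 \<bullet> \<sigma>\<^sub>2) \<star> (\<tau>\<^sub>3 \<bullet> \<sigma>\<^sub>3))"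
proof -
  \<comment> \<open>The hypotheses rewrite \<open>Tgt\<close> of each \<sigma> to \<open>Src\<close>
    of the matching \<tau>, after which \<open>cell_closed\<close> no longer matches; the boundary
    equations are therefore supplied by hand.\<close>
  have "Dom K (Src K \<tau>\<^sub>1) = Dom K (Src K \<sigma>\<^sub>1)" "Dom K (Src K \<tau>\<^sub>2) = Dom K (Src K \<sigma>\<^sub>2)" "Cod K (Src K \<tau>\<^sub>2) = Cod K (Src K \<sigma>\<^sub>2)"
    "Cod K (Src K \<tau>\<^sub>3) = Cod K (Src K \<sigma>\<^sub>3)"
    using assms cell_closed(3,4) by metis+
  then show ?thesis using assms by (simp add: interchange')
qed

text \<open>In a right-nested composite the pair \<tau> \<bullet> \<sigma> is not a subterm once
  another cell precedes it. Carrying the tail \<rho> along lets a two-cell equation act inside a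
  longer composite.\<close>

lemma vcomp_swap:
  assumes "\<tau> \<bullet> \<sigma> = \<tau>' \<bullet> \<sigma>'" "\<sigma> \<in> Cell K" "\<tau> \<in> Cell K" "\<sigma>' \<in> Cell K" "\<tau>' \<in> Cell K" "\<rho> \<in> Cell K"
    "Tgt K \<sigma> = Src K \<tau>" "Tgt K \<sigma>' = Src K \<tau>'" "Tgt K \<rho> = Src K \<sigma>" "Tgt K \<rho> = Src K \<sigma>'"
  shows "\<tau> \<bullet> (\<sigma> \<bullet> \<rho>) = \<tau>' \<bullet> (\<sigma>' \<bullet> \<rho>)"
  using assms vcomp_assoc'[of \<rho> \<sigma> \<tau>] vcomp_assoc'[of \<rho> \<sigma>' \<tau>'] by metis

end

section \<open>Boundary rules, composition and extensionality of 2-functors\<close>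

context two_map
begin

lemma map_obj_closed [simp]: "X \<in> Obj A \<Longrightarrow> fobj F X \<in> Obj B"
  using fobj by auto

lemma map_arr_simps [simp]:
  assumes "f \<in> Arr A"
  shows "farr F f \<in> Arr B" "Dom B (farr F f) = fobj F (Dom A f)" "Cod B (farr F f) = fobj F (Cod A f)"
  using assms farr map_Dom map_Cod by auto

lemma map_cell_simps [simp]:
  assumes "\<theta> \<in> Cell A"
  shows "fcell F \<theta> \<in> Cell B" "Src B (fcell F \<theta>) = farr F (Src A \<theta>)" "Tgt B (fcell F \<theta>) = farr F (Tgt A \<theta>)"
  using assms fcell map_Src map_Tgt by auto

declare map_id_arr [simp] map_id_cell [simp]

lemma map_vcomp' [simp]:
  "\<lbrakk>\<sigma> \<in> Cell A; \<tau> \<in> Cell A; Tgt A \<sigma> = Src A \<tau>\<rbrakk> \<Longrightarrow> fcell F (\<tau> \<bullet>\<^bsub>A\<^esub> \<sigma>) = fcell F \<tau> \<bullet>\<^bsub>B\<^esub> fcell F \<sigma>"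
  using map_vcomp by (auto simp: is_cell_def)

end

context two_functor
begin

lemma map_comp' [simp]:
  "\<lbrakk>f \<in> Arr A; g \<in> Arr A; Cod A f = Dom A g\<rbrakk> \<Longrightarrow> farr F (g \<odot>\<^bsub>A\<^esub> f) = farr F g \<odot>\<^bsub>B\<^esub> farr F f"
  using map_comp by (auto simp: is_arr_def)

lemma map_hcomp' [simp]:
  "\<lbrakk>\<alpha> \<in> Cell A; \<beta> \<in> Cell A; Cod A (Src A \<alpha>) = Dom A (Src A \<beta>)\<rbrakk>
    \<Longrightarrow> fcell F (\<beta> \<star>\<^bsub>A\<^esub> \<alpha>) = fcell F \<beta> \<star>\<^bsub>B\<^esub> fcell F \<alpha>"
  using map_hcomp by (auto simp: is_cell_def)

end

lemma comp_fun_simps [simp]: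
  "X \<in> Obj A \<Longrightarrow> fobj (comp_fun A G F) X = fobj G (fobj F X)"
  "f \<in> Arr A \<Longrightarrow> farr (comp_fun A G F) f = farr G (farr F f)"
  "\<theta> \<in> Cell A \<Longrightarrow> fcell (comp_fun A G F) \<theta> = fcell G (fcell F \<theta>)"
  by (simp_all add: comp_fun_def)

lemma id_fun_simps [simp]:
  "X \<in> Obj A \<Longrightarrow> fobj (id_fun A) X = X"
  "f \<in> Arr A \<Longrightarrow> farr (id_fun A) f = f"
  "\<theta> \<in> Cell A \<Longrightarrow> fcell (id_fun A) \<theta> = \<theta>"
  by (simp_all add: id_fun_def)

lemma two_functor_id_fun:
  assumes "two_category A"
  shows "two_functor A A (id_fun A)"
proof -
  interpret two_category A by fact
  have "fobj (id_fun A) \<in> Obj A \<rightarrow>\<^sub>E Obj A" "farr (id_fun A) \<in> Arr A \<rightarrow>\<^sub>E Arr A"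
    "fcell (id_fun A) \<in> Cell A \<rightarrow>\<^sub>E Cell A"
    by (auto simp: id_fun_def)
  then show ?thesis by unfold_locales (auto simp: is_arr_def is_cell_def)
qed

lemma two_functor_comp_fun:
  assumes "two_functor A B F" "two_functor B C G"
  shows "two_functor A C (comp_fun A G F)"
proof -
  interpret F: two_functor A B F by fact
  interpret G: two_functor B C G by fact
  have "fobj (comp_fun A G F) \<in> Obj A \<rightarrow>\<^sub>E Obj C" "farr (comp_fun A G F) \<in> Arr A \<rightarrow>\<^sub>E Arr C"
    "fcell (comp_fun A G F) \<in> Cell A \<rightarrow>\<^sub>E Cell C"
    by (auto simp: comp_fun_def)
  then show ?thesis by unfold_locales (auto simp: is_arr_def is_cell_def)
qed

lemma two_fun_eqI:
  fixes F F' :: "('o, 'a, 'c, 'p, 'q, 'r) two_fun"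
  assumes "two_functor A B F" "two_functor A B F'"
    and "\<And>X. X \<in> Obj A \<Longrightarrow> fobj F X = fobj F' X"
    and "\<And>f. f \<in> Arr A \<Longrightarrow> farr F f = farr F' f"
    and "\<And>\<theta>. \<theta> \<in> Cell A \<Longrightarrow> fcell F \<theta> = fcell F' \<theta>"
  shows "F = F'"
proof -
  interpret F: two_functor A B F by fact
  interpret F': two_functor A B F' by fact
  have "fobj F = fobj F'" "farr F = farr F'" "fcell F = fcell F'"
    using PiE_ext[OF F.fobj F'.fobj assms(3)] PiE_ext[OF F.farr F'.farr assms(4)]
      PiE_ext[OF F.fcell F'.fcell assms(5)] by auto
  then show ?thesis by simp
qed

lemma comp_fun_assoc:
  assumes "two_functor A B F"
  shows "comp_fun A (comp_fun B H G) F = comp_fun A H (comp_fun A G F)"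
proof -
  interpret F: two_functor A B F by fact
  show ?thesis unfolding comp_fun_def by (auto intro!: restrict_ext)
qed

lemma comp_fun_id:
  assumes "two_functor A B F"
  shows "comp_fun A F (id_fun A) = F" "comp_fun A (id_fun B) F = F"
proof -
  interpret F: two_functor A B F by fact
  note I = two_functor_id_fun[OF F.A.two_category_axioms] two_functor_id_fun[OF F.B.two_category_axioms]
  show "comp_fun A F (id_fun A) = F"
    by (rule two_fun_eqI[OF two_functor_comp_fun[OF I(1) assms] assms]) auto
  show "comp_fun A (id_fun B) F = F"
    by (rule two_fun_eqI[OF two_functor_comp_fun[OF assms I(2)] assms]) auto
qed

section \<open>Boundary rules and extensionality for lax transformations and modifications\<close>

context lax_transformation
begin

lemma tobj_simps [simp]:
  assumes "X \<in> Obj A"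
  shows "tobj \<alpha> X \<in> Arr B" "Dom B (tobj \<alpha> X) = fobj (tdom \<alpha>) X" "Cod B (tobj \<alpha> X) = fobj (tcod \<alpha>) X"
  using tobj[OF assms] by (auto simp: is_arr_def)

lemma tarr_simps [simp]:
  assumes "f \<in> Arr A"
  shows "tarr \<alpha> f \<in> Cell B"
    "Src B (tarr \<alpha> f) = farr (tcod \<alpha>) f \<odot>\<^bsub>B\<^esub> tobj \<alpha> (Dom A f)"
    "Tgt B (tarr \<alpha> f) = tobj \<alpha> (Cod A f) \<odot>\<^bsub>B\<^esub> farr (tdom \<alpha>) f"
  using tarr[of f "Dom A f" "Cod A f"] assms by (auto simp: is_arr_def is_cell_def)

declare tarr_id [simp]

lemma tarr_comp':
  "\<lbrakk>f \<in> Arr A; g \<in> Arr A; Cod A f = Dom A g\<rbrakk> \<Longrightarrow> tarr \<alpha> (g \<odot>\<^bsub>A\<^esub> f) =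
      (tarr \<alpha> g \<rhd>\<^bsub>B\<^esub> farr (tdom \<alpha>) f) \<bullet>\<^bsub>B\<^esub> (farr (tcod \<alpha>) g \<lhd>\<^bsub>B\<^esub> tarr \<alpha> f)"
  using tarr_comp by (auto simp: is_arr_def)

text \<open>All boundaries are computed from \<theta>, so an instance at a concrete 2-cell can be
  simplified straight into normal form.\<close>

lemma tarr_natural':
  assumes "\<theta> \<in> Cell A"
  shows "(tobj \<alpha> (Cod A (Src A \<theta>)) \<lhd>\<^bsub>B\<^esub> fcell (tdom \<alpha>) \<theta>) \<bullet>\<^bsub>B\<^esub> tarr \<alpha> (Src A \<theta>) =
      tarr \<alpha> (Tgt A \<theta>) \<bullet>\<^bsub>B\<^esub> (fcell (tcod \<alpha>) \<theta> \<rhd>\<^bsub>B\<^esub> tobj \<alpha> (Dom A (Src A \<theta>)))"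
proof -
  interpret two_functor A B "tdom \<alpha>" by (rule tdom)
  show ?thesis using assms by (intro tarr_natural) (auto simp: is_arr_def is_cell_def)
qed

end

context modification
begin

lemma mobj_simps [simp]:
  assumes "X \<in> Obj A"
  shows "mobj m X \<in> Cell B" "Src B (mobj m X) = tobj (msrc m) X" "Tgt B (mobj m X) = tobj (mtgt m) X"
  using mobj[OF assms] by (auto simp: is_cell_def)

lemma mobj_natural':
  "f \<in> Arr A \<Longrightarrow>
      (mobj m (Cod A f) \<rhd>\<^bsub>B\<^esub> farr (tdom (msrc m)) f) \<bullet>\<^bsub>B\<^esub> tarr (msrc m) f =
      tarr (mtgt m) f \<bullet>\<^bsub>B\<^esub> (farr (tcod (msrc m)) f \<lhd>\<^bsub>B\<^esub> mobj m (Dom A f))"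
  using mobj_natural by (auto simp: is_arr_def)

end

lemma lax_nat_eqI:
  fixes \<alpha> \<beta> :: "('o, 'a, 'c, 'p, 'q, 'r) lax_nat"
  assumes "tdom \<alpha> = tdom \<beta>" "tcod \<alpha> = tcod \<beta>"
    and "tobj \<alpha> \<in> extensional (Obj A)" "tobj \<beta> \<in> extensional (Obj A)"
    and "tarr \<alpha> \<in> extensional (Arr A)" "tarr \<beta> \<in> extensional (Arr A)"
    and "\<And>X. X \<in> Obj A \<Longrightarrow> tobj \<alpha> X = tobj \<beta> X"
    and "\<And>f. f \<in> Arr A \<Longrightarrow> tarr \<alpha> f = tarr \<beta> f"
  shows "\<alpha> = \<beta>"
proof -
  have "tobj \<alpha> = tobj \<beta>" "tarr \<alpha> = tarr \<beta>"
    using extensionalityI[OF assms(3,4,7)] extensionalityI[OF assms(5,6,8)] by auto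
  then show ?thesis using assms by simp
qed

lemma modif_eqI:
  fixes m n :: "('o, 'a, 'c, 'p, 'q, 'r) modif"
  assumes "msrc m = msrc n" "mtgt m = mtgt n"
    and "mobj m \<in> extensional (Obj A)" "mobj n \<in> extensional (Obj A)"
    and "\<And>X. X \<in> Obj A \<Longrightarrow> mobj m X = mobj n X"
  shows "m = n"
  using extensionalityI[OF assms(3,4,5)] assms by simp

section \<open>The 2-category \<open>Lax A B\<close>\<close>

lemma id_nat_simps [simp]:
  "tdom (id_nat A B F) = F" "tcod (id_nat A B F) = F"
  "tobj (id_nat A B F) \<in> extensional (Obj A)" "tarr (id_nat A B F) \<in> extensional (Arr A)"
  "X \<in> Obj A \<Longrightarrow> tobj (id_nat A B F) X = id_arr B (fobj F X)"
  "f \<in> Arr A \<Longrightarrow> tarr (id_nat A B F) f = id_cell B (farr F f)"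
  by (simp_all add: id_nat_def)

lemma comp_nat_simps [simp]:
  "tdom (comp_nat A B \<beta> \<alpha>) = tdom \<alpha>" "tcod (comp_nat A B \<beta> \<alpha>) = tcod \<beta>"
  "tobj (comp_nat A B \<beta> \<alpha>) \<in> extensional (Obj A)" "tarr (comp_nat A B \<beta> \<alpha>) \<in> extensional (Arr A)"
  "X \<in> Obj A \<Longrightarrow> tobj (comp_nat A B \<beta> \<alpha>) X = tobj \<beta> X \<odot>\<^bsub>B\<^esub> tobj \<alpha> X"
  "f \<in> Arr A \<Longrightarrow> tarr (comp_nat A B \<beta> \<alpha>) f =
    (tobj \<beta> (Cod A f) \<lhd>\<^bsub>B\<^esub> tarr \<alpha> f) \<bullet>\<^bsub>B\<^esub> (tarr \<beta> f \<rhd>\<^bsub>B\<^esub> tobj \<alpha> (Dom A f))"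
  by (simp_all add: comp_nat_def)

text \<open>Not declared as simplification rules: unfolding \<open>Lax A B\<close> by default would
  hide its operations from the 2-category calculus.\<close>

lemma Lax_simps:
  "Obj (Lax A B) = {F. two_functor A B F}" "Arr (Lax A B) = {\<alpha>. lax_transformation A B \<alpha>}"
  "Cell (Lax A B) = {m. modification A B m}"
  "Dom (Lax A B) = tdom" "Cod (Lax A B) = tcod" "Src (Lax A B) = msrc" "Tgt (Lax A B) = mtgt"
  "id_arr (Lax A B) = id_nat A B"
  "id_cell (Lax A B) \<alpha> = \<lparr>msrc = \<alpha>, mtgt = \<alpha>, mobj = (\<lambda>X\<in>Obj A. id_cell B (tobj \<alpha> X))\<rparr>"
  "comp (Lax A B) = comp_nat A B"
  "vcomp (Lax A B) n m = \<lparr>msrc = msrc m, mtgt = mtgt n, mobj = (\<lambda>X\<in>Obj A. mobj n X \<bullet>\<^bsub>B\<^esub> mobj m X)\<rparr>"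
  "hcomp (Lax A B) n m = \<lparr>msrc = comp_nat A B (msrc n) (msrc m), mtgt = comp_nat A B (mtgt n) (mtgt m),
      mobj = (\<lambda>X\<in>Obj A. mobj n X \<star>\<^bsub>B\<^esub> mobj m X)\<rparr>"
  by (simp_all add: Lax_def)

lemma lax_transformation_id_nat:
  assumes "two_functor A B F"
  shows "lax_transformation A B (id_nat A B F)"
proof -
  interpret two_functor A B F by fact
  show ?thesis
    by (rule lax_transformation.intro) (auto simp: is_arr_def is_cell_def two_functor_axioms)
qed

lemma lax_transformation_comp_nat:
  assumes "lax_transformation A B \<alpha>" "lax_transformation A B \<beta>" "tcod \<alpha> = tdom \<beta>"
  shows "lax_transformation A B (comp_nat A B \<beta> \<alpha>)"
proof -
  \<comment> \<open>Naming the functors turns every \<open>tdom\<close> and \<open>tcod\<close> into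
    a variable, and the shared middle functor becomes a single term.\<close>
  define F where "F = tdom \<alpha>"
  define G where "G = tdom \<beta>"
  define H where "H = tcod \<beta>"
  have [simp]: "tdom \<alpha> = F" "tcod \<alpha> = G" "tdom \<beta> = G" "tcod \<beta> = H"
    by (simp_all add: F_def G_def H_def assms)
  interpret \<alpha>: lax_transformation A B \<alpha> by fact
  interpret \<beta>: lax_transformation A B \<beta> by fact
  interpret F: two_functor A B F using \<alpha>.tdom by simp
  interpret G: two_functor A B G using \<beta>.tdom by simp
  interpret H: two_functor A B H using \<beta>.tcod by simp
  show ?thesis
  proof (rule lax_transformation.intro)
    fix f g X Y Z assume "is_arr A f X Y" "is_arr A g Y Z"
    then have fg [simp]: "f \<in> Arr A" "g \<in> Arr A" "Dom A f = X" "Cod A f = Y" "Dom A g = Y" "Cod A g = Z"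
      by (auto simp: is_arr_def)
    from fg(1,2) have [simp]: "X \<in> Obj A" "Y \<in> Obj A" "Z \<in> Obj A"
      using F.A.arr_closed fg(3-) by metis+
    \<comment> \<open>At a composite gf the two sides differ only in the order of the 2-cell of
      \<alpha> at f and that of \<beta> at g, which act on different factors.\<close>
    note eq = F.B.whisker_swap[of "tarr \<alpha> f" "tarr \<beta> g", simplified]
    show "tarr (comp_nat A B \<beta> \<alpha>) (g \<odot>\<^bsub>A\<^esub> f) =
       (tarr (comp_nat A B \<beta> \<alpha>) g \<rhd>\<^bsub>B\<^esub> farr (tdom (comp_nat A B \<beta> \<alpha>)) f) \<bullet>\<^bsub>B\<^esub>
       (farr (tcod (comp_nat A B \<beta> \<alpha>)) g \<lhd>\<^bsub>B\<^esub> tarr (comp_nat A B \<beta> \<alpha>) f)"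
      by (simp add: \<alpha>.tarr_comp' \<beta>.tarr_comp' F.B.vcomp_swap[OF eq])
  next
    fix f g X Y \<theta> assume "is_arr A f X Y" "is_arr A g X Y" "is_cell A \<theta> f g"
    then have fg [simp]: "f \<in> Arr A" "g \<in> Arr A" "Dom A f = X" "Cod A f = Y" "Dom A g = X" "Cod A g = Y"
      "\<theta> \<in> Cell A" "Src A \<theta> = f" "Tgt A \<theta> = g"
      by (auto simp: is_arr_def is_cell_def)
    from fg(1,2) have [simp]: "X \<in> Obj A" "Y \<in> Obj A"
      using F.A.arr_closed fg(3-) by metis+
    \<comment> \<open>The 2-cell \<theta> passes \<alpha> first and \<beta> second; each naturality
      square is whiskered by the component of the other transformation.\<close>
    note eq1 = arg_cong[OF \<alpha>.tarr_natural'[of \<theta>], where f = "\<lambda>x. tobj \<beta> Y \<lhd>\<^bsub>B\<^esub> x", simplified]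
    note eq2 = arg_cong[OF \<beta>.tarr_natural'[of \<theta>], where f = "\<lambda>x. x \<rhd>\<^bsub>B\<^esub> tobj \<alpha> X", simplified]
    show "(tobj (comp_nat A B \<beta> \<alpha>) Y \<lhd>\<^bsub>B\<^esub> fcell (tdom (comp_nat A B \<beta> \<alpha>)) \<theta>) \<bullet>\<^bsub>B\<^esub> tarr (comp_nat A B \<beta> \<alpha>) f =
       tarr (comp_nat A B \<beta> \<alpha>) g \<bullet>\<^bsub>B\<^esub> (fcell (tcod (comp_nat A B \<beta> \<alpha>)) \<theta> \<rhd>\<^bsub>B\<^esub> tobj (comp_nat A B \<beta> \<alpha>) X)"
      by (simp add: eq2 F.B.vcomp_swap[OF eq1])
  qed (auto simp: is_arr_def is_cell_def F.two_functor_axioms H.two_functor_axioms)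
qed

lemma comp_nat_id:
  assumes "lax_transformation A B \<alpha>"
  shows "comp_nat A B (id_nat A B (tcod \<alpha>)) \<alpha> = \<alpha>" "comp_nat A B \<alpha> (id_nat A B (tdom \<alpha>)) = \<alpha>"
proof -
  interpret \<alpha>: lax_transformation A B \<alpha> by fact
  interpret F: two_functor A B "tdom \<alpha>" by (rule \<alpha>.tdom)
  interpret G: two_functor A B "tcod \<alpha>" by (rule \<alpha>.tcod)
  show "comp_nat A B (id_nat A B (tcod \<alpha>)) \<alpha> = \<alpha>" "comp_nat A B \<alpha> (id_nat A B (tdom \<alpha>)) = \<alpha>"
    by (rule lax_nat_eqI[of _ _ A]; simp add: \<alpha>.tobj_ext \<alpha>.tarr_ext)+
qed

lemma comp_nat_assoc:
  assumes "lax_transformation A B \<alpha>" "lax_transformation A B \<beta>" "lax_transformation A B \<gamma>"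
    and [simp]: "tcod \<alpha> = tdom \<beta>" "tcod \<beta> = tdom \<gamma>"
  shows "comp_nat A B (comp_nat A B \<gamma> \<beta>) \<alpha> = comp_nat A B \<gamma> (comp_nat A B \<beta> \<alpha>)"
proof -
  interpret \<alpha>: lax_transformation A B \<alpha> by fact
  interpret \<beta>: lax_transformation A B \<beta> by fact
  interpret \<gamma>: lax_transformation A B \<gamma> by fact
  interpret F: two_functor A B "tdom \<alpha>" by (rule \<alpha>.tdom)
  interpret G: two_functor A B "tdom \<beta>" by (rule \<beta>.tdom)
  interpret H: two_functor A B "tdom \<gamma>" by (rule \<gamma>.tdom)
  interpret L: two_functor A B "tcod \<gamma>" by (rule \<gamma>.tcod)
  show ?thesis
    by (rule lax_nat_eqI[of _ _ A]; simp)
qed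

lemma modification_id:
  assumes "lax_transformation A B \<alpha>"
  shows "modification A B (id_cell (Lax A B) \<alpha>)"
proof -
  interpret \<alpha>: lax_transformation A B \<alpha> by fact
  interpret F: two_functor A B "tdom \<alpha>" by (rule \<alpha>.tdom)
  interpret G: two_functor A B "tcod \<alpha>" by (rule \<alpha>.tcod)
  show ?thesis
    by (rule modification.intro) (auto simp: Lax_simps is_arr_def is_cell_def assms)
qed

lemma modification_vcomp:
  assumes "modification A B m" "modification A B n" and "mtgt m = msrc n"
  shows "modification A B (n \<bullet>\<^bsub>Lax A B\<^esub> m)"
proof -
  interpret m: modification A B m by fact
  interpret n: modification A B n by fact
  define \<alpha> where "\<alpha> = msrc m"
  define \<beta> where "\<beta> = msrc n"
  define \<gamma> where "\<gamma> = mtgt n"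
  have [simp]: "msrc m = \<alpha>" "mtgt m = \<beta>" "msrc n = \<beta>" "mtgt n = \<gamma>"
    by (simp_all add: \<alpha>_def \<beta>_def \<gamma>_def assms)
  define F where "F = tdom \<alpha>"
  define G where "G = tcod \<alpha>"
  have [simp]: "tdom \<alpha> = F" "tdom \<beta> = F" "tdom \<gamma> = F" "tcod \<alpha> = G" "tcod \<beta> = G" "tcod \<gamma> = G"
    using m.tdom_eq m.tcod_eq n.tdom_eq n.tcod_eq by (simp_all add: F_def G_def)
  interpret \<alpha>: lax_transformation A B \<alpha> using m.msrc by simp
  interpret \<beta>: lax_transformation A B \<beta> using m.mtgt by simp
  interpret \<gamma>: lax_transformation A B \<gamma> using n.mtgt by simp
  interpret F: two_functor A B F using \<alpha>.tdom by simp
  interpret G: two_functor A B G using \<alpha>.tcod by simp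
  show ?thesis
  proof (rule modification.intro)
    fix f X Y assume "is_arr A f X Y"
    then have fg [simp]: "f \<in> Arr A" "Dom A f = X" "Cod A f = Y" by (auto simp: is_arr_def)
    from fg(1) have [simp]: "X \<in> Obj A" "Y \<in> Obj A"
      using F.A.arr_closed fg(2-) by metis+
    note eq1 = m.mobj_natural'[of f, simplified]
    note eq2 = n.mobj_natural'[of f, simplified]
    show "(mobj (n \<bullet>\<^bsub>Lax A B\<^esub> m) Y \<rhd>\<^bsub>B\<^esub> farr (tdom (msrc (n \<bullet>\<^bsub>Lax A B\<^esub> m))) f) \<bullet>\<^bsub>B\<^esub> tarr (msrc (n \<bullet>\<^bsub>Lax A B\<^esub> m)) f =
       tarr (mtgt (n \<bullet>\<^bsub>Lax A B\<^esub> m)) f \<bullet>\<^bsub>B\<^esub> (farr (tcod (msrc (n \<bullet>\<^bsub>Lax A B\<^esub> m))) f \<lhd>\<^bsub>B\<^esub> mobj (n \<bullet>\<^bsub>Lax A B\<^esub> m) X)"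
      by (simp add: Lax_simps eq1 F.B.vcomp_swap[OF eq2])
  qed (auto simp: Lax_simps is_cell_def \<alpha>.lax_transformation_axioms \<gamma>.lax_transformation_axioms)
qed

lemma modification_hcomp:
  assumes "modification A B m" "modification A B n" and "tcod (msrc m) = tdom (msrc n)"
  shows "modification A B (n \<star>\<^bsub>Lax A B\<^esub> m)"
proof -
  interpret m: modification A B m by fact
  interpret n: modification A B n by fact
  define \<alpha> where "\<alpha> = msrc m"
  define \<alpha>' where "\<alpha>' = mtgt m"
  define \<beta> where "\<beta> = msrc n"
  define \<beta>' where "\<beta>' = mtgt n"
  have [simp]: "msrc m = \<alpha>" "mtgt m = \<alpha>'" "msrc n = \<beta>" "mtgt n = \<beta>'"
    by (simp_all add: \<alpha>_def \<beta>_def \<alpha>'_def \<beta>'_def)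
  define F where "F = tdom \<alpha>"
  define G where "G = tcod \<alpha>"
  define H where "H = tcod \<beta>"
  have [simp]: "tdom \<alpha> = F" "tdom \<alpha>' = F" "tdom \<beta> = G" "tdom \<beta>' = G"
    "tcod \<alpha> = G" "tcod \<alpha>' = G" "tcod \<beta> = H" "tcod \<beta>' = H"
    using m.tdom_eq m.tcod_eq n.tdom_eq n.tcod_eq assms by (simp_all add: F_def G_def H_def)
  interpret \<alpha>: lax_transformation A B \<alpha> using m.msrc by simp
  interpret \<alpha>': lax_transformation A B \<alpha>' using m.mtgt by simp
  interpret \<beta>: lax_transformation A B \<beta> using n.msrc by simp
  interpret \<beta>': lax_transformation A B \<beta>' using n.mtgt by simp
  interpret F: two_functor A B F using \<alpha>.tdom by simp
  interpret G: two_functor A B G using \<alpha>.tcod by simp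
  interpret H: two_functor A B H using \<beta>.tcod by simp
  show ?thesis
  proof (rule modification.intro)
    fix f X Y assume "is_arr A f X Y"
    then have fg [simp]: "f \<in> Arr A" "Dom A f = X" "Cod A f = Y" by (auto simp: is_arr_def)
    from fg(1) have [simp]: "X \<in> Obj A" "Y \<in> Obj A"
      using F.A.arr_closed fg(2-) by metis+
    \<comment> \<open>Each horizontal composite is cut so that m acts first and n second. Then m
      passes the 2-cell of \<alpha> (\<open>eq1\<close>) and that of \<beta> (\<open>s1\<close>), n
      passes that of \<alpha>' (\<open>s2\<close>) and that of \<beta> (\<open>eq2\<close>), and
      \<open>d2\<close> reassembles the two halves.\<close>
    note d1 = F.B.hcomp_decompose[of "mobj m Y \<rhd>\<^bsub>B\<^esub> farr F f" "mobj n Y", simplified]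
    note d2 = F.B.hcomp_decompose[of "mobj m X" "mobj n X", simplified]
    note eq1 = arg_cong[OF m.mobj_natural'[of f], where f = "\<lambda>x. tobj \<beta> Y \<lhd>\<^bsub>B\<^esub> x", simplified]
    note eq2 = arg_cong[OF n.mobj_natural'[of f], where f = "\<lambda>x. x \<rhd>\<^bsub>B\<^esub> tobj \<alpha>' X", simplified]
    note s1 = F.B.whisker_swap[of "mobj m X" "tarr \<beta> f", simplified]
    note s2 = F.B.whisker_swap[of "tarr \<alpha>' f" "mobj n Y", symmetric, simplified]
    show "(mobj (n \<star>\<^bsub>Lax A B\<^esub> m) Y \<rhd>\<^bsub>B\<^esub> farr (tdom (msrc (n \<star>\<^bsub>Lax A B\<^esub> m))) f) \<bullet>\<^bsub>B\<^esub> tarr (msrc (n \<star>\<^bsub>Lax A B\<^esub> m)) f =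
       tarr (mtgt (n \<star>\<^bsub>Lax A B\<^esub> m)) f \<bullet>\<^bsub>B\<^esub> (farr (tcod (msrc (n \<star>\<^bsub>Lax A B\<^esub> m))) f \<lhd>\<^bsub>B\<^esub> mobj (n \<star>\<^bsub>Lax A B\<^esub> m) X)"
      by (simp add: Lax_simps d1 d2 s1 F.B.vcomp_swap[OF eq1] F.B.vcomp_swap[OF s2] F.B.vcomp_swap[OF eq2])
  qed (auto simp: Lax_simps is_cell_def lax_transformation_comp_nat
      \<alpha>.lax_transformation_axioms \<beta>.lax_transformation_axioms
      \<alpha>'.lax_transformation_axioms \<beta>'.lax_transformation_axioms)
qed

text \<open>Components are evaluated while the operations stay folded as those of
  \<open>Lax A B\<close>, so these rules can be mixed with the rules of
  \<open>two_category\<close>.\<close>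

lemma Lax_component_simps [simp]:
  "X \<in> Obj A \<Longrightarrow> mobj (n \<bullet>\<^bsub>Lax A B\<^esub> m) X = mobj n X \<bullet>\<^bsub>B\<^esub> mobj m X"
  "X \<in> Obj A \<Longrightarrow> mobj (n \<star>\<^bsub>Lax A B\<^esub> m) X = mobj n X \<star>\<^bsub>B\<^esub> mobj m X"
  "X \<in> Obj A \<Longrightarrow> mobj (id_cell (Lax A B) \<alpha>) X = id_cell B (tobj \<alpha> X)"
  "X \<in> Obj A \<Longrightarrow> tobj (\<beta> \<odot>\<^bsub>Lax A B\<^esub> \<alpha>) X = tobj \<beta> X \<odot>\<^bsub>B\<^esub> tobj \<alpha> X"
  "X \<in> Obj A \<Longrightarrow> tobj (id_arr (Lax A B) F) X = id_arr B (fobj F X)"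
  "f \<in> Arr A \<Longrightarrow> tarr (\<beta> \<odot>\<^bsub>Lax A B\<^esub> \<alpha>) f =
    (tobj \<beta> (Cod A f) \<lhd>\<^bsub>B\<^esub> tarr \<alpha> f) \<bullet>\<^bsub>B\<^esub> (tarr \<beta> f \<rhd>\<^bsub>B\<^esub> tobj \<alpha> (Dom A f))"
  "f \<in> Arr A \<Longrightarrow> tarr (id_arr (Lax A B) F) f = id_cell B (farr F f)"
  by (simp_all add: Lax_simps)

lemma modification_data:
  assumes "modification A B m"
  shows "lax_transformation A B (msrc m)" "lax_transformation A B (mtgt m)"
    "tdom (mtgt m) = tdom (msrc m)" "tcod (mtgt m) = tcod (msrc m)"
    "mobj m \<in> extensional (Obj A)"
    "X \<in> Obj A \<Longrightarrow> mobj m X \<in> Cell B"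
    "X \<in> Obj A \<Longrightarrow> Src B (mobj m X) = tobj (msrc m) X"
    "X \<in> Obj A \<Longrightarrow> Tgt B (mobj m X) = tobj (mtgt m) X"
proof -
  interpret modification A B m by fact
  show "lax_transformation A B (msrc m)" "lax_transformation A B (mtgt m)"
    "tdom (mtgt m) = tdom (msrc m)" "tcod (mtgt m) = tcod (msrc m)"
    "mobj m \<in> extensional (Obj A)"
    "X \<in> Obj A \<Longrightarrow> mobj m X \<in> Cell B"
    "X \<in> Obj A \<Longrightarrow> Src B (mobj m X) = tobj (msrc m) X"
    "X \<in> Obj A \<Longrightarrow> Tgt B (mobj m X) = tobj (mtgt m) X"
    using msrc mtgt tdom_eq tcod_eq mobj_ext by simp_all
qed

lemma two_category_Lax:
  fixes A :: "('o, 'a, 'c) two_cat" and B :: "('p, 'q, 'r) two_cat"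
  assumes "two_category A" "two_category B"
  shows "two_category (Lax A B)"
proof -
  interpret A: two_category A by fact
  interpret B: two_category B by fact
  have arr: "tobj \<alpha> X \<in> Arr B" "Dom B (tobj \<alpha> X) = fobj (tdom \<alpha>) X" "Cod B (tobj \<alpha> X) = fobj (tcod \<alpha>) X"
    if "lax_transformation A B \<alpha>" "X \<in> Obj A" for \<alpha> X
    using lax_transformation.tobj_simps[OF that] by auto
  have eqI: "m = n" if "modification A B m" "modification A B n" "msrc m = msrc n" "mtgt m = mtgt n"
     "\<And>X. X \<in> Obj A \<Longrightarrow> mobj m X = mobj n X" for m n :: "('o, 'a, 'c, 'p, 'q, 'r) modif"
    using modif_eqI[OF that(3,4) _ _ that(5)] modification_data(5) that(1,2) by blast
  note closure = modification_id modification_vcomp modification_hcomp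
    lax_transformation_id_nat lax_transformation_comp_nat
  note typing = Lax_simps(1-8,10) is_arr_def is_cell_def modification_data[of A B] arr closure
  have [simp]: "msrc (n \<bullet>\<^bsub>Lax A B\<^esub> m) = msrc m" "mtgt (n \<bullet>\<^bsub>Lax A B\<^esub> m) = mtgt n"
    "msrc (n \<star>\<^bsub>Lax A B\<^esub> m) = comp_nat A B (msrc n) (msrc m)"
    "mtgt (n \<star>\<^bsub>Lax A B\<^esub> m) = comp_nat A B (mtgt n) (mtgt m)"
    "msrc (id_cell (Lax A B) \<alpha>) = \<alpha>" "mtgt (id_cell (Lax A B) \<alpha>) = \<alpha>"
    for m n :: "('o, 'a, 'c, 'p, 'q, 'r) modif" and \<alpha>
    by (simp_all add: Lax_simps)
  have funs: "two_functor A B (tdom \<alpha>)" "two_functor A B (tcod \<alpha>)"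
    if "lax_transformation A B \<alpha>" for \<alpha>
    using lax_transformation.tdom[OF that] lax_transformation.tcod[OF that] by auto
  have cellD: "modification A B m" "msrc m = \<alpha>" "mtgt m = \<beta>" "lax_transformation A B \<alpha>"
    "lax_transformation A B \<beta>" "tdom \<beta> = tdom \<alpha>" "tcod \<beta> = tcod \<alpha>"
    if "is_cell (Lax A B) m \<alpha> \<beta>" for m \<alpha> \<beta>
    using that modification_data[of A B m] by (auto simp: is_cell_def Lax_simps)
  show ?thesis
  \<comment> \<open>The cases spelled out are the equations between modifications: vertical units
    and associativity (14 to 16), horizontal units and associativity (18 to 20), identities (21) and
    interchange (22). Each is reduced to its counterpart in \<open>B\<close> at every
    object.\<close>
  proof (rule two_category.intro, goal_cases)
    case (14 \<sigma> f g)
    note [simp] = cellD[OF 14]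
    show ?case by (intro eqI; simp add: typing)
  next
    case (15 \<sigma> f g)
    note [simp] = cellD[OF 15]
    show ?case by (intro eqI; simp add: typing)
  next
    case (16 \<sigma> f g \<tau> h \<upsilon> k)
    note [simp] = cellD[OF 16(1)] cellD[OF 16(2)] cellD[OF 16(3)]
    show ?case by (intro eqI; simp add: typing)
  next
    case (18 \<alpha> f g)
    note [simp] = cellD[OF 18]
    \<comment> \<open>The sources and targets must agree too. The identity is placed at
      \<open>tcod f\<close>, so for the target g the unit law is needed with its codomain already
      rewritten.\<close>
    show ?case by (intro eqI; simp add: typing comp_nat_id comp_nat_id[of _ _ g, simplified] funs)
  next
    case (19 \<alpha> f g)
    note [simp] = cellD[OF 19]
    show ?case by (intro eqI; simp add: typing comp_nat_id comp_nat_id[of _ _ g, simplified] funs)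
  next
    case (20 \<alpha> f f' \<beta> g g' \<gamma> h h')
    note [simp] = cellD[OF 20(1)] cellD[OF 20(2)] cellD[OF 20(3)]
    have [simp]: "tcod f = tdom g" "tcod g = tdom h" using 20 by (auto simp: Lax_simps)
    show ?case by (intro eqI; simp add: typing comp_nat_assoc)
  next
    case (21 f X Y g Z)
    then show ?case by (intro eqI; force simp: typing)
  next
    case (22 \<sigma> f g \<tau> h \<sigma>' f' g' \<tau>' h')
    note [simp] = cellD[OF 22(1)] cellD[OF 22(2)] cellD[OF 22(3)] cellD[OF 22(4)]
    have [simp]: "tcod f = tdom f'" using 22 by (auto simp: Lax_simps)
    show ?case by (intro eqI; simp add: typing B.interchange')
  qed (auto simp: typing comp_nat_id comp_nat_assoc funs)
qed

section \<open>Pre- and postcomposition with 2-functors\<close>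

text \<open>Naming the end functors makes the boundaries of \<alpha> variables; the sublocales then
  supply both 2-functors and the calculus of \<open>Lax A B\<close> in one interpretation.\<close>

locale lax_arrow =
  fixes A :: "('o, 'a, 'c) two_cat" and B :: "('p, 'q, 'r) two_cat" and \<alpha> F G
  assumes lax_arrow: "is_arr (Lax A B) \<alpha> F G"
begin

lemma lax_arrow_simps [simp]:
  "\<alpha> \<in> Arr (Lax A B)" "Dom (Lax A B) \<alpha> = F" "Cod (Lax A B) \<alpha> = G" "tdom \<alpha> = F" "tcod \<alpha> = G"
  using lax_arrow by (auto simp: is_arr_def Lax_simps)

end

sublocale lax_arrow \<subseteq> lax_transformation A B \<alpha>
  using lax_arrow by (simp add: is_arr_def Lax_simps)

sublocale lax_arrow \<subseteq> dom: two_functor A B F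
  using tdom by simp

sublocale lax_arrow \<subseteq> cod: two_functor A B G
  using tcod by simp

sublocale lax_arrow \<subseteq> Lax: two_category "Lax A B"
  by (rule two_category_Lax) unfold_locales

context lax_arrow
begin

lemma lax_arrow_obj [simp]: "F \<in> Obj (Lax A B)" "G \<in> Obj (Lax A B)"
  using dom.two_functor_axioms cod.two_functor_axioms by (simp_all add: Lax_simps)

end

text \<open>Only the source arrow is typed by assumption; the target has the same type because the
  ends of a 2-cell are parallel.\<close>

locale lax_cell =
  fixes A :: "('o, 'a, 'c) two_cat" and B :: "('p, 'q, 'r) two_cat" and m \<alpha> \<beta> F G
  assumes lax_cell: "is_cell (Lax A B) m \<alpha> \<beta>" and src_arrow: "is_arr (Lax A B) \<alpha> F G"

sublocale lax_cell \<subseteq> modification A B m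
  using lax_cell by (simp add: is_cell_def Lax_simps)

sublocale lax_cell \<subseteq> src: lax_arrow A B \<alpha> F G
  by unfold_locales (rule src_arrow)

sublocale lax_cell \<subseteq> tgt: lax_arrow A B \<beta> F G
proof
  show "is_arr (Lax A B) \<beta> F G"
    using lax_cell src.Lax.cell_closed[of m] by (simp add: is_cell_def is_arr_def)
qed

context lax_cell
begin

lemma lax_cell_simps [simp]:
  "m \<in> Cell (Lax A B)" "Src (Lax A B) m = \<alpha>" "Tgt (Lax A B) m = \<beta>" "msrc m = \<alpha>" "mtgt m = \<beta>"
  using lax_cell by (auto simp: is_cell_def Lax_simps)

end

lemma lax_arrowI:
  assumes "\<alpha> \<in> Arr (Lax A B)" "Dom (Lax A B) \<alpha> = F" "Cod (Lax A B) \<alpha> = G"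
  shows "lax_arrow A B \<alpha> F G"
  using assms by (simp add: lax_arrow_def is_arr_def)

lemma lax_cellI:
  assumes "two_category A" "two_category B" "m \<in> Cell (Lax A B)" "Src (Lax A B) m = \<alpha>" "Tgt (Lax A B) m = \<beta>"
    "Dom (Lax A B) \<alpha> = F" "Cod (Lax A B) \<alpha> = G"
  shows "lax_cell A B m \<alpha> \<beta> F G"
proof -
  interpret two_category "Lax A B" by (rule two_category_Lax[OF assms(1,2)])
  show ?thesis using assms cell_closed(1)[of m] by (simp add: lax_cell_def is_arr_def is_cell_def)
qed

text \<open>The boundary premises use \<open>Dom\<close> and \<open>Cod\<close> of
  \<open>Lax A B\<close> instead of the record fields, so that they are discharged by the 2-category
  rules.\<close>

lemma Lax_arr_eqI:
  fixes \<alpha> \<beta> :: "('o, 'a, 'c, 'p, 'q, 'r) lax_nat"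
  assumes "\<alpha> \<in> Arr (Lax A B)" "\<beta> \<in> Arr (Lax A B)"
    and "Dom (Lax A B) \<alpha> = Dom (Lax A B) \<beta>" "Cod (Lax A B) \<alpha> = Cod (Lax A B) \<beta>"
    and "\<And>X. X \<in> Obj A \<Longrightarrow> tobj \<alpha> X = tobj \<beta> X"
    and "\<And>f. f \<in> Arr A \<Longrightarrow> tarr \<alpha> f = tarr \<beta> f"
  shows "\<alpha> = \<beta>"
  using assms by (intro lax_nat_eqI[of \<alpha> \<beta> A])
    (auto simp: Lax_simps lax_transformation.tobj_ext lax_transformation.tarr_ext)

lemma Lax_cell_eqI:
  fixes m n :: "('o, 'a, 'c, 'p, 'q, 'r) modif"
  assumes "m \<in> Cell (Lax A B)" "n \<in> Cell (Lax A B)"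
    and "Src (Lax A B) m = Src (Lax A B) n" "Tgt (Lax A B) m = Tgt (Lax A B) n"
    and "\<And>X. X \<in> Obj A \<Longrightarrow> mobj m X = mobj n X"
  shows "m = n"
  using assms by (intro modif_eqI[of m n A]) (auto simp: Lax_simps modification.mobj_ext)

text \<open>Raw whiskering, defined for every record \<beta>; \<open>precomp\<close> below restricts
  it to the arrows of \<open>Lax B C\<close>, as extensionality of 2-functors demands.\<close>

definition pre_nat :: "('o, 'a, 'c) two_cat \<Rightarrow> ('p, 'q, 'r, 's, 't, 'u) lax_nat
    \<Rightarrow> ('o, 'a, 'c, 'p, 'q, 'r) two_fun \<Rightarrow> ('o, 'a, 'c, 's, 't, 'u) lax_nat"
  where "pre_nat A \<beta> F = \<lparr>tdom = comp_fun A (tdom \<beta>) F, tcod = comp_fun A (tcod \<beta>) F,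
    tobj = (\<lambda>X\<in>Obj A. tobj \<beta> (fobj F X)), tarr = (\<lambda>f\<in>Arr A. tarr \<beta> (farr F f))\<rparr>"

definition post_nat :: "('o, 'a, 'c) two_cat \<Rightarrow> ('p, 'q, 'r, 's, 't, 'u) two_fun
    \<Rightarrow> ('o, 'a, 'c, 'p, 'q, 'r) lax_nat \<Rightarrow> ('o, 'a, 'c, 's, 't, 'u) lax_nat"
  where "post_nat A G \<alpha> = \<lparr>tdom = comp_fun A G (tdom \<alpha>), tcod = comp_fun A G (tcod \<alpha>),
    tobj = (\<lambda>X\<in>Obj A. farr G (tobj \<alpha> X)), tarr = (\<lambda>f\<in>Arr A. fcell G (tarr \<alpha> f))\<rparr>"

lemma pre_nat_simps:
  "tdom (pre_nat A \<beta> F) = comp_fun A (tdom \<beta>) F" "tcod (pre_nat A \<beta> F) = comp_fun A (tcod \<beta>) F"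
  "tobj (pre_nat A \<beta> F) \<in> extensional (Obj A)" "tarr (pre_nat A \<beta> F) \<in> extensional (Arr A)"
  "X \<in> Obj A \<Longrightarrow> tobj (pre_nat A \<beta> F) X = tobj \<beta> (fobj F X)"
  "f \<in> Arr A \<Longrightarrow> tarr (pre_nat A \<beta> F) f = tarr \<beta> (farr F f)"
  by (simp_all add: pre_nat_def)

lemma post_nat_simps:
  "tdom (post_nat A G \<alpha>) = comp_fun A G (tdom \<alpha>)" "tcod (post_nat A G \<alpha>) = comp_fun A G (tcod \<alpha>)"
  "tobj (post_nat A G \<alpha>) \<in> extensional (Obj A)" "tarr (post_nat A G \<alpha>) \<in> extensional (Arr A)"
  "X \<in> Obj A \<Longrightarrow> tobj (post_nat A G \<alpha>) X = farr G (tobj \<alpha> X)"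
  "f \<in> Arr A \<Longrightarrow> tarr (post_nat A G \<alpha>) f = fcell G (tarr \<alpha> f)"
  by (simp_all add: post_nat_def)

text \<open>Each condition is the one for \<beta> at the image under F, because F takes identities
  and composites of \<open>A\<close> strictly to those of \<open>B\<close>.\<close>

lemma lax_transformation_pre_nat:
  assumes "two_functor A B F" "lax_transformation B C \<beta>"
  shows "lax_transformation A C (pre_nat A \<beta> F)"
proof -
  interpret F: two_functor A B F by fact
  interpret \<beta>: lax_transformation B C \<beta> by fact
  interpret G: two_functor B C "tdom \<beta>" by (rule \<beta>.tdom)
  interpret H: two_functor B C "tcod \<beta>" by (rule \<beta>.tcod)
  show ?thesis
  proof (rule lax_transformation.intro)
    fix f g X Y \<theta> assume "is_arr A f X Y" "is_arr A g X Y" "is_cell A \<theta> f g"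
    then show "(tobj (pre_nat A \<beta> F) Y \<lhd>\<^bsub>C\<^esub> fcell (tdom (pre_nat A \<beta> F)) \<theta>) \<bullet>\<^bsub>C\<^esub> tarr (pre_nat A \<beta> F) f =
       tarr (pre_nat A \<beta> F) g \<bullet>\<^bsub>C\<^esub> (fcell (tcod (pre_nat A \<beta> F)) \<theta> \<rhd>\<^bsub>C\<^esub> tobj (pre_nat A \<beta> F) X)"
      using \<beta>.tarr_natural'[of "fcell F \<theta>"] by (auto simp: is_arr_def is_cell_def pre_nat_simps)
  qed (auto simp: is_arr_def is_cell_def pre_nat_simps \<beta>.tarr_comp' two_functor_comp_fun[OF assms(1)]
      G.two_functor_axioms H.two_functor_axioms)
qed

text \<open>Here strictness of G is essential: the image under G of a 2-cell between composites has
  the required boundary only because G preserves composites exactly.\<close>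

lemma lax_transformation_post_nat:
  assumes "lax_transformation A B \<alpha>" "two_functor B C G"
  shows "lax_transformation A C (post_nat A G \<alpha>)"
proof -
  interpret G: two_functor B C G by fact
  interpret \<alpha>: lax_transformation A B \<alpha> by fact
  interpret F: two_functor A B "tdom \<alpha>" by (rule \<alpha>.tdom)
  interpret H: two_functor A B "tcod \<alpha>" by (rule \<alpha>.tcod)
  show ?thesis
  proof (rule lax_transformation.intro)
    fix f g X Y \<theta> assume "is_arr A f X Y" "is_arr A g X Y" "is_cell A \<theta> f g"
    then show "(tobj (post_nat A G \<alpha>) Y \<lhd>\<^bsub>C\<^esub> fcell (tdom (post_nat A G \<alpha>)) \<theta>) \<bullet>\<^bsub>C\<^esub> tarr (post_nat A G \<alpha>) f =
       tarr (post_nat A G \<alpha>) g \<bullet>\<^bsub>C\<^esub> (fcell (tcod (post_nat A G \<alpha>)) \<theta> \<rhd>\<^bsub>C\<^esub> tobj (post_nat A G \<alpha>) X)"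
      using arg_cong[OF \<alpha>.tarr_natural'[of \<theta>], of "fcell G"] by (auto simp: is_arr_def is_cell_def post_nat_simps)
  qed (auto simp: is_arr_def is_cell_def post_nat_simps \<alpha>.tarr_comp' two_functor_comp_fun[OF _ assms(2)]
      F.two_functor_axioms H.two_functor_axioms)
qed

definition precomp :: "('o, 'a, 'c) two_cat \<Rightarrow> ('p, 'q, 'r) two_cat \<Rightarrow> ('s, 't, 'u) two_cat
    \<Rightarrow> ('o, 'a, 'c, 'p, 'q, 'r) two_fun
    \<Rightarrow> (('p, 'q, 'r, 's, 't, 'u) two_fun, ('p, 'q, 'r, 's, 't, 'u) lax_nat, ('p, 'q, 'r, 's, 't, 'u) modif,
        ('o, 'a, 'c, 's, 't, 'u) two_fun, ('o, 'a, 'c, 's, 't, 'u) lax_nat, ('o, 'a, 'c, 's, 't, 'u) modif) two_fun"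
  where "precomp A B C F = \<lparr>
    fobj = (\<lambda>G\<in>Obj (Lax B C). comp_fun A G F),
    farr = (\<lambda>\<beta>\<in>Arr (Lax B C). pre_nat A \<beta> F),
    fcell = (\<lambda>n\<in>Cell (Lax B C). \<lparr>msrc = pre_nat A (msrc n) F, mtgt = pre_nat A (mtgt n) F,
      mobj = (\<lambda>X\<in>Obj A. mobj n (fobj F X))\<rparr>)\<rparr>"

definition postcomp :: "('o, 'a, 'c) two_cat \<Rightarrow> ('p, 'q, 'r) two_cat
    \<Rightarrow> ('p, 'q, 'r, 's, 't, 'u) two_fun
    \<Rightarrow> (('o, 'a, 'c, 'p, 'q, 'r) two_fun, ('o, 'a, 'c, 'p, 'q, 'r) lax_nat, ('o, 'a, 'c, 'p, 'q, 'r) modif,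
        ('o, 'a, 'c, 's, 't, 'u) two_fun, ('o, 'a, 'c, 's, 't, 'u) lax_nat, ('o, 'a, 'c, 's, 't, 'u) modif) two_fun"
  where "postcomp A B G = \<lparr>
    fobj = (\<lambda>F\<in>Obj (Lax A B). comp_fun A G F),
    farr = (\<lambda>\<alpha>\<in>Arr (Lax A B). post_nat A G \<alpha>),
    fcell = (\<lambda>m\<in>Cell (Lax A B). \<lparr>msrc = post_nat A G (msrc m), mtgt = post_nat A G (mtgt m),
      mobj = (\<lambda>X\<in>Obj A. fcell G (mobj m X))\<rparr>)\<rparr>"

lemma precomp_simps [simp]:
  "G \<in> Obj (Lax B C) \<Longrightarrow> fobj (precomp A B C F) G = comp_fun A G F"
  "\<lbrakk>\<beta> \<in> Arr (Lax B C); X \<in> Obj A\<rbrakk> \<Longrightarrow> tobj (farr (precomp A B C F) \<beta>) X = tobj \<beta> (fobj F X)"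
  "\<lbrakk>\<beta> \<in> Arr (Lax B C); f \<in> Arr A\<rbrakk> \<Longrightarrow> tarr (farr (precomp A B C F) \<beta>) f = tarr \<beta> (farr F f)"
  "\<lbrakk>n \<in> Cell (Lax B C); X \<in> Obj A\<rbrakk> \<Longrightarrow> mobj (fcell (precomp A B C F) n) X = mobj n (fobj F X)"
  by (simp_all add: precomp_def pre_nat_simps)

lemma postcomp_simps [simp]:
  "F \<in> Obj (Lax A B) \<Longrightarrow> fobj (postcomp A B G) F = comp_fun A G F"
  "\<lbrakk>\<alpha> \<in> Arr (Lax A B); X \<in> Obj A\<rbrakk> \<Longrightarrow> tobj (farr (postcomp A B G) \<alpha>) X = farr G (tobj \<alpha> X)"
  "\<lbrakk>\<alpha> \<in> Arr (Lax A B); f \<in> Arr A\<rbrakk> \<Longrightarrow> tarr (farr (postcomp A B G) \<alpha>) f = fcell G (tarr \<alpha> f)"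
  "\<lbrakk>m \<in> Cell (Lax A B); X \<in> Obj A\<rbrakk> \<Longrightarrow> mobj (fcell (postcomp A B G) m) X = fcell G (mobj m X)"
  by (simp_all add: postcomp_def post_nat_simps)

text \<open>Precomposition is reindexing: the operations of \<open>Lax\<close> are computed from
  components, and evaluating at F X or F f commutes with them.\<close>

lemma two_functor_precomp:
  assumes "two_functor A B F" "two_category C"
  shows "two_functor (Lax B C) (Lax A C) (precomp A B C F)"
proof -
  interpret F: two_functor A B F by fact
  interpret C: two_category C by fact
  interpret BC: two_category "Lax B C" by (rule two_category_Lax) unfold_locales
  interpret AC: two_category "Lax A C" by (rule two_category_Lax) unfold_locales
  let ?P = "precomp A B C F"
  have arr: "farr ?P \<beta> \<in> Arr (Lax A C)" "Dom (Lax A C) (farr ?P \<beta>) = comp_fun A (Dom (Lax B C) \<beta>) F"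
    "Cod (Lax A C) (farr ?P \<beta>) = comp_fun A (Cod (Lax B C) \<beta>) F" if "\<beta> \<in> Arr (Lax B C)" for \<beta>
    using that lax_transformation_pre_nat[OF assms(1), of C \<beta>]
    by (simp_all add: Lax_simps precomp_def pre_nat_simps)
  have cell: "fcell ?P n \<in> Cell (Lax A C)" "Src (Lax A C) (fcell ?P n) = farr ?P (Src (Lax B C) n)"
    "Tgt (Lax A C) (fcell ?P n) = farr ?P (Tgt (Lax B C) n)" if n: "n \<in> Cell (Lax B C)" for n
  proof -
    obtain \<alpha> \<beta> G H where "lax_cell B C n \<alpha> \<beta> G H"
      using lax_cellI[OF F.B.two_category_axioms assms(2) n] by blast
    then interpret n: lax_cell B C n \<alpha> \<beta> G H .
    have n': "n \<in> Cell (Lax B C)" "\<alpha> \<in> Arr (Lax B C)" "\<beta> \<in> Arr (Lax B C)" by simp_all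
    have ms: "msrc (fcell ?P n) = farr ?P \<alpha>" "mtgt (fcell ?P n) = farr ?P \<beta>"
      by (simp_all add: precomp_def)
    then show "Src (Lax A C) (fcell ?P n) = farr ?P (Src (Lax B C) n)"
      "Tgt (Lax A C) (fcell ?P n) = farr ?P (Tgt (Lax B C) n)"
      unfolding n.lax_cell_simps by (simp_all only: Lax_simps(6,7))
    have td: "tdom (farr ?P \<alpha>) = comp_fun A G F" "tcod (farr ?P \<alpha>) = comp_fun A H F"
      "tdom (farr ?P \<beta>) = comp_fun A G F" "tcod (farr ?P \<beta>) = comp_fun A H F"
      by (simp_all add: precomp_def pre_nat_simps)
    have "modification A C (fcell ?P n)"
    proof (rule modification.intro, goal_cases)
      case 1 show ?case using arr(1)[OF n'(2)] by (simp only: ms Lax_simps(2) mem_Collect_eq)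
    next
      case 2 show ?case using arr(1)[OF n'(3)] by (simp only: ms Lax_simps(2) mem_Collect_eq)
    next
      case 5 show ?case by (simp add: precomp_def)
    next
      case (7 f X Y)
      then show ?case using n.mobj_natural'[of "farr F f"] by (auto simp: ms td is_arr_def)
    qed (auto simp: ms td is_cell_def)
    then show "fcell ?P n \<in> Cell (Lax A C)" by (simp only: Lax_simps(3) mem_Collect_eq)
  qed
  have arr_ext: "farr ?P \<in> extensional (Arr (Lax B C))" "fcell ?P \<in> extensional (Cell (Lax B C))"
    "fobj ?P \<in> extensional (Obj (Lax B C))"
    by (simp_all add: precomp_def)
  have obj: "comp_fun A G F \<in> Obj (Lax A C)" if "G \<in> Obj (Lax B C)" for G
    using that two_functor_comp_fun[OF assms(1)] by (simp add: Lax_simps)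
  have td [simp]: "tobj \<beta> X \<in> Arr C" "Dom C (tobj \<beta> X) = fobj (Dom (Lax B C) \<beta>) X" 
      "Cod C (tobj \<beta> X) = fobj (Cod (Lax B C) \<beta>) X" if "\<beta> \<in> Arr (Lax B C)" "X \<in> Obj B" for \<beta> X
    using that lax_transformation.tobj_simps[of B C \<beta> X] by (simp_all add: Lax_simps)
  show ?thesis
    apply (intro two_functor.intro two_map.intro two_map_axioms.intro two_functor_axioms.intro
       BC.two_category_axioms AC.two_category_axioms)
    subgoal using obj arr_ext by (auto simp: PiE_iff)
    subgoal using arr arr_ext by (auto simp: PiE_iff)
    subgoal using cell arr_ext by (auto simp: PiE_iff)
    subgoal by (simp add: arr)
    subgoal by (simp add: arr)
    subgoal by (simp add: cell)
    subgoal by (simp add: cell)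
    subgoal by (rule Lax_arr_eqI[of _ A C]) (auto simp: arr obj)
    subgoal by (rule Lax_cell_eqI[of _ A C]) (auto simp: arr cell)
    subgoal by (rule Lax_cell_eqI[of _ A C]) (auto simp: arr cell is_cell_def)
    subgoal by (rule Lax_arr_eqI[of _ A C]) (auto simp: arr is_arr_def)
    \<comment> \<open>The boundaries of a horizontal composite are composites of arrows, so
      preservation of composites is needed again as a rewrite rule before the components can be
      compared.\<close>
    subgoal premises p for \<alpha> f g \<beta> h k
    proof -
      have *: "farr ?P (g \<odot>\<^bsub>Lax B C\<^esub> f) = farr ?P g \<odot>\<^bsub>Lax A C\<^esub> farr ?P f" 
        if "f \<in> Arr (Lax B C)" "g \<in> Arr (Lax B C)" "Cod (Lax B C) f = Dom (Lax B C) g" for f g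
        using that by (intro Lax_arr_eqI[of _ A C]) (auto simp: arr)
      show ?thesis using p by (intro Lax_cell_eqI[of _ A C]) (auto simp: arr cell is_cell_def *)
    qed
    done
qed

text \<open>G is applied to the components themselves, so preservation of the operations of
  \<open>Lax A B\<close> is preservation by G of composites, whiskers and vertical composites in
  \<open>B\<close>. That requires the components to be typed in \<open>B\<close>.\<close>

lemma two_functor_postcomp:
  assumes "two_category A" "two_functor B C G"
  shows "two_functor (Lax A B) (Lax A C) (postcomp A B G)"
proof -
  interpret G: two_functor B C G by fact
  interpret A: two_category A by fact
  interpret AB: two_category "Lax A B" by (rule two_category_Lax) unfold_locales
  interpret AC: two_category "Lax A C" by (rule two_category_Lax) unfold_locales
  let ?P = "postcomp A B G"
  have arr: "farr ?P \<beta> \<in> Arr (Lax A C)" "Dom (Lax A C) (farr ?P \<beta>) = comp_fun A G (Dom (Lax A B) \<beta>)"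
    "Cod (Lax A C) (farr ?P \<beta>) = comp_fun A G (Cod (Lax A B) \<beta>)" if "\<beta> \<in> Arr (Lax A B)" for \<beta>
    using that lax_transformation_post_nat[OF _ assms(2), of A \<beta>]
    by (simp_all add: Lax_simps postcomp_def post_nat_simps)
  have cell: "fcell ?P n \<in> Cell (Lax A C)" "Src (Lax A C) (fcell ?P n) = farr ?P (Src (Lax A B) n)"
    "Tgt (Lax A C) (fcell ?P n) = farr ?P (Tgt (Lax A B) n)" if n: "n \<in> Cell (Lax A B)" for n
  proof -
    obtain \<alpha> \<beta> F H where "lax_cell A B n \<alpha> \<beta> F H"
      using lax_cellI[OF assms(1) G.A.two_category_axioms n] by blast
    then interpret n: lax_cell A B n \<alpha> \<beta> F H .
    have n': "n \<in> Cell (Lax A B)" "\<alpha> \<in> Arr (Lax A B)" "\<beta> \<in> Arr (Lax A B)" by simp_all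
    have ms: "msrc (fcell ?P n) = farr ?P \<alpha>" "mtgt (fcell ?P n) = farr ?P \<beta>"
      by (simp_all add: postcomp_def)
    then show "Src (Lax A C) (fcell ?P n) = farr ?P (Src (Lax A B) n)"
      "Tgt (Lax A C) (fcell ?P n) = farr ?P (Tgt (Lax A B) n)"
      unfolding n.lax_cell_simps by (simp_all only: Lax_simps(6,7))
    have td: "tdom (farr ?P \<alpha>) = comp_fun A G F" "tcod (farr ?P \<alpha>) = comp_fun A G H"
      "tdom (farr ?P \<beta>) = comp_fun A G F" "tcod (farr ?P \<beta>) = comp_fun A G H"
      by (simp_all add: postcomp_def post_nat_simps)
    have "modification A C (fcell ?P n)"
    proof (rule modification.intro, goal_cases)
      case 1 show ?case using arr(1)[OF n'(2)] by (simp only: ms Lax_simps(2) mem_Collect_eq)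
    next
      case 2 show ?case using arr(1)[OF n'(3)] by (simp only: ms Lax_simps(2) mem_Collect_eq)
    next
      case 5 show ?case by (simp add: postcomp_def)
    next
      case (7 f X Y)
      then show ?case using arg_cong[OF n.mobj_natural'[of f], of "fcell G"] by (auto simp: ms td is_arr_def)
    qed (auto simp: ms td is_cell_def)
    then show "fcell ?P n \<in> Cell (Lax A C)" by (simp only: Lax_simps(3) mem_Collect_eq)
  qed
  have arr_ext: "farr ?P \<in> extensional (Arr (Lax A B))" "fcell ?P \<in> extensional (Cell (Lax A B))"
    "fobj ?P \<in> extensional (Obj (Lax A B))"
    by (simp_all add: postcomp_def)
  have obj: "comp_fun A G F \<in> Obj (Lax A C)" if "F \<in> Obj (Lax A B)" for F
    using that two_functor_comp_fun[OF _ assms(2)] by (simp add: Lax_simps)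
  have td [simp]: "tobj \<beta> X \<in> Arr B" "Dom B (tobj \<beta> X) = fobj (Dom (Lax A B) \<beta>) X" 
      "Cod B (tobj \<beta> X) = fobj (Cod (Lax A B) \<beta>) X" if "\<beta> \<in> Arr (Lax A B)" "X \<in> Obj A" for \<beta> X
    using that lax_transformation.tobj_simps[of A B \<beta> X] by (simp_all add: Lax_simps)
  have comp: "farr ?P (g \<odot>\<^bsub>Lax A B\<^esub> f) = farr ?P g \<odot>\<^bsub>Lax A C\<^esub> farr ?P f" 
    if fg: "f \<in> Arr (Lax A B)" "g \<in> Arr (Lax A B)" "Cod (Lax A B) f = Dom (Lax A B) g" for f g
  proof -
    obtain F H L where "lax_arrow A B f F H" "lax_arrow A B g H L"
      using lax_arrowI fg by metis
    then interpret f: lax_arrow A B f F H + g: lax_arrow A B g H L .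
    show ?thesis using that by (intro Lax_arr_eqI[of _ A C]) (auto simp: arr)
  qed
  have mt [simp]: "mobj m X \<in> Cell B" "Src B (mobj m X) = tobj (Src (Lax A B) m) X" 
      "Tgt B (mobj m X) = tobj (Tgt (Lax A B) m) X" if "m \<in> Cell (Lax A B)" "X \<in> Obj A" for m X
    using that modification.mobj_simps[of A B m X] by (simp_all add: Lax_simps)
  show ?thesis
    apply (intro two_functor.intro two_map.intro two_map_axioms.intro two_functor_axioms.intro
       AB.two_category_axioms AC.two_category_axioms)
    subgoal using obj arr_ext by (auto simp: PiE_iff)
    subgoal using arr arr_ext by (auto simp: PiE_iff)
    subgoal using cell arr_ext by (auto simp: PiE_iff)
    subgoal by (simp add: arr)
    subgoal by (simp add: arr)
    subgoal by (simp add: cell)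
    subgoal by (simp add: cell)
    subgoal for F
    proof -
      assume F: "F \<in> Obj (Lax A B)"
      then interpret F: two_functor A B F by (simp add: Lax_simps)
      show ?thesis using F by (intro Lax_arr_eqI[of _ A C]) (auto simp: arr obj)
    qed
    subgoal by (rule Lax_cell_eqI[of _ A C]) (auto simp: arr cell)
    subgoal by (rule Lax_cell_eqI[of _ A C]) (auto simp: arr cell is_cell_def)
    subgoal by (auto simp: comp is_arr_def)
    subgoal by (rule Lax_cell_eqI[of _ A C]) (auto simp: arr cell is_cell_def comp)
    done
qed

section \<open>The interchanger\<close>

text \<open>The boundaries are given by raw whiskerings, so the middle 2-category is not a
  parameter; \<open>xchg_cell\<close> restates them with \<open>precomp\<close> and
  \<open>postcomp\<close>.\<close>

definition xchg :: "('o, 'a, 'c) two_cat \<Rightarrow> ('s, 't, 'u) two_cat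
    \<Rightarrow> ('p, 'q, 'r, 's, 't, 'u) lax_nat \<Rightarrow> ('o, 'a, 'c, 'p, 'q, 'r) lax_nat
    \<Rightarrow> ('o, 'a, 'c, 's, 't, 'u) modif"
  where "xchg A C \<beta> \<gamma> = \<lparr>
    msrc = comp_nat A C (post_nat A (tcod \<beta>) \<gamma>) (pre_nat A \<beta> (tdom \<gamma>)),
    mtgt = comp_nat A C (pre_nat A \<beta> (tcod \<gamma>)) (post_nat A (tdom \<beta>) \<gamma>),
    mobj = (\<lambda>X\<in>Obj A. tarr \<beta> (tobj \<gamma> X))\<rparr>"

lemma mobj_xchg [simp]: "X \<in> Obj A \<Longrightarrow> mobj (xchg A C \<beta> \<gamma>) X = tarr \<beta> (tobj \<gamma> X)"
  by (simp add: xchg_def)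

text \<open>The setting of one interchanger. The sublocales provide the four whiskering functors on
  its boundary: precomposition with both ends of \<gamma> and postcomposition with both ends of
  \<beta>.\<close>

locale lax_pair = \<beta>: lax_arrow B C \<beta> G K + \<gamma>: lax_arrow A B \<gamma> F L
  for A :: "('o, 'a, 'c) two_cat" and B :: "('p, 'q, 'r) two_cat" and C :: "('s, 't, 'u) two_cat"
    and \<beta> G K \<gamma> F L

sublocale lax_pair \<subseteq> PF: two_functor "Lax B C" "Lax A C" "precomp A B C F"
  by (intro two_functor_precomp \<gamma>.dom.two_functor_axioms \<beta>.dom.B.two_category_axioms)
sublocale lax_pair \<subseteq> PL: two_functor "Lax B C" "Lax A C" "precomp A B C L"
  by (intro two_functor_precomp \<gamma>.cod.two_functor_axioms \<beta>.dom.B.two_category_axioms)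
sublocale lax_pair \<subseteq> QG: two_functor "Lax A B" "Lax A C" "postcomp A B G"
  by (intro two_functor_postcomp \<beta>.dom.two_functor_axioms \<gamma>.dom.A.two_category_axioms)
sublocale lax_pair \<subseteq> QK: two_functor "Lax A B" "Lax A C" "postcomp A B K"
  by (intro two_functor_postcomp \<beta>.cod.two_functor_axioms \<gamma>.dom.A.two_category_axioms)

context lax_pair
begin

text \<open>The modification condition at f is naturality of \<beta> at the 2-cell of \<gamma> at f.
  Source and target of that 2-cell are composite arrows, and \<open>tarr_comp'\<close> expands
  \<beta> at both.\<close>

lemma xchg_cell [simp]:
  "xchg A C \<beta> \<gamma> \<in> Cell (Lax A C)"
  "Src (Lax A C) (xchg A C \<beta> \<gamma>) = farr (postcomp A B K) \<gamma> \<odot>\<^bsub>Lax A C\<^esub> farr (precomp A B C F) \<beta>"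
  "Tgt (Lax A C) (xchg A C \<beta> \<gamma>) = farr (precomp A B C L) \<beta> \<odot>\<^bsub>Lax A C\<^esub> farr (postcomp A B G) \<gamma>"
proof -
  let ?S = "farr (postcomp A B K) \<gamma> \<odot>\<^bsub>Lax A C\<^esub> farr (precomp A B C F) \<beta>"
  let ?T = "farr (precomp A B C L) \<beta> \<odot>\<^bsub>Lax A C\<^esub> farr (postcomp A B G) \<gamma>"
  \<comment> \<open>Two simplifier calls: the restrictions are removed while membership in
    \<open>Arr (Lax B C)\<close> and \<open>Arr (Lax A B)\<close> is still in the form that the
    locales supply, and only then is \<open>Lax\<close> unfolded.\<close>
  have S: "?S = comp_nat A C (post_nat A K \<gamma>) (pre_nat A \<beta> F)"
    by (simp add: precomp_def postcomp_def) (simp add: Lax_simps)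
  have T: "?T = comp_nat A C (pre_nat A \<beta> L) (post_nat A G \<gamma>)"
    by (simp add: precomp_def postcomp_def) (simp add: Lax_simps)
  have ms: "msrc (xchg A C \<beta> \<gamma>) = ?S" "mtgt (xchg A C \<beta> \<gamma>) = ?T"
    by (simp_all add: S T xchg_def)
  show "Src (Lax A C) (xchg A C \<beta> \<gamma>) = ?S" "Tgt (Lax A C) (xchg A C \<beta> \<gamma>) = ?T"
    using ms by (simp_all only: Lax_simps(6,7))
  have td: "tdom ?S = comp_fun A G F" "tcod ?S = comp_fun A K L" "tdom ?T = comp_fun A G F" "tcod ?T = comp_fun A K L"
    by (simp_all add: S T pre_nat_simps post_nat_simps)
  have "lax_arrow A C ?S (comp_fun A G F) (comp_fun A K L)"
    by (rule lax_arrowI) simp_all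
  then interpret S: lax_arrow A C ?S "comp_fun A G F" "comp_fun A K L" .
  have "lax_arrow A C ?T (comp_fun A G F) (comp_fun A K L)"
    by (rule lax_arrowI) simp_all
  then interpret T: lax_arrow A C ?T "comp_fun A G F" "comp_fun A K L" .
  have "modification A C (xchg A C \<beta> \<gamma>)"
  proof (rule modification.intro, unfold ms td)
    fix f X Y assume "is_arr A f X Y"
    then have fg [simp]: "f \<in> Arr A" "Dom A f = X" "Cod A f = Y" by (auto simp: is_arr_def)
    from fg(1) have [simp]: "X \<in> Obj A" "Y \<in> Obj A"
      using \<gamma>.dom.A.arr_closed fg(2-) by metis+
    show "(mobj (xchg A C \<beta> \<gamma>) Y \<rhd>\<^bsub>C\<^esub> farr (comp_fun A G F) f) \<bullet>\<^bsub>C\<^esub> tarr ?S f =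
       tarr ?T f \<bullet>\<^bsub>C\<^esub> (farr (comp_fun A K L) f \<lhd>\<^bsub>C\<^esub> mobj (xchg A C \<beta> \<gamma>) X)"
      using \<beta>.tarr_natural'[of "tarr \<gamma> f"] by (simp add: \<beta>.tarr_comp')
  qed (auto simp: is_cell_def S.lax_transformation_axioms T.lax_transformation_axioms xchg_def[of A C])
  then show "xchg A C \<beta> \<gamma> \<in> Cell (Lax A C)" by (simp only: Lax_simps(3) mem_Collect_eq)
qed

end

text \<open>Naturality in \<gamma> is naturality of \<beta>' at the 2-cell m at X; naturality in
  \<beta> is the modification condition of n at the arrow \<gamma> at X. The two are joined by one
  interchange in \<open>C\<close>.\<close>

lemma xchg_natural:
  assumes "lax_cell B C n \<beta> \<beta>' G K" "lax_cell A B m \<gamma> \<gamma>' F L"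
  shows "xchg A C \<beta>' \<gamma>' \<bullet>\<^bsub>Lax A C\<^esub> (fcell (postcomp A B K) m \<star>\<^bsub>Lax A C\<^esub> fcell (precomp A B C F) n) =
    (fcell (precomp A B C L) n \<star>\<^bsub>Lax A C\<^esub> fcell (postcomp A B G) m) \<bullet>\<^bsub>Lax A C\<^esub> xchg A C \<beta> \<gamma>"
proof -
  interpret n: lax_cell B C n \<beta> \<beta>' G K by fact
  interpret m: lax_cell A B m \<gamma> \<gamma>' F L by fact
  interpret p: lax_pair A B C \<beta> G K \<gamma> F L by unfold_locales
  interpret p': lax_pair A B C \<beta>' G K \<gamma>' F L by unfold_locales
  show ?thesis
  proof (rule Lax_cell_eqI[of _ A C])
    fix X assume [simp]: "X \<in> Obj A"
    note d1 = n.src.dom.B.hcomp_decompose[of "mobj n (fobj F X)" "fcell K (mobj m X)", simplified]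
    note d2 = n.src.dom.B.hcomp_decompose[of "fcell G (mobj m X)" "mobj n (fobj L X)", simplified]
    note eq1 = n.tgt.tarr_natural'[of "mobj m X", symmetric, simplified]
    note eq2 = n.mobj_natural'[of "tobj \<gamma> X", symmetric, simplified]
    note s = n.src.dom.B.whisker_swap[of "fcell G (mobj m X)" "mobj n (fobj L X)", simplified]
    show "mobj (xchg A C \<beta>' \<gamma>' \<bullet>\<^bsub>Lax A C\<^esub> (fcell (postcomp A B K) m \<star>\<^bsub>Lax A C\<^esub> fcell (precomp A B C F) n)) X =
      mobj ((fcell (precomp A B C L) n \<star>\<^bsub>Lax A C\<^esub> fcell (postcomp A B G) m) \<bullet>\<^bsub>Lax A C\<^esub> xchg A C \<beta> \<gamma>) X"
      by (simp add: d1 d2 eq2 n.src.dom.B.vcomp_swap[OF eq1] n.src.dom.B.vcomp_swap[OF s])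
  qed simp_all
qed

text \<open>At each object this is the composition law of \<beta> at the composite of the components
  of \<alpha> and \<gamma>.\<close>

lemma xchg_comp_right:
  assumes "lax_arrow B C \<beta> G K" "lax_arrow A B \<alpha> F H" "lax_arrow A B \<gamma> H L"
  shows "xchg A C \<beta> (\<gamma> \<odot>\<^bsub>Lax A B\<^esub> \<alpha>) =
    (xchg A C \<beta> \<gamma> \<rhd>\<^bsub>Lax A C\<^esub> farr (postcomp A B G) \<alpha>) \<bullet>\<^bsub>Lax A C\<^esub>
    (farr (postcomp A B K) \<gamma> \<lhd>\<^bsub>Lax A C\<^esub> xchg A C \<beta> \<alpha>)"
proof -
  interpret \<beta>: lax_arrow B C \<beta> G K by fact
  interpret \<alpha>: lax_arrow A B \<alpha> F H by fact
  interpret \<gamma>: lax_arrow A B \<gamma> H L by fact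
  interpret p: lax_pair A B C \<beta> G K \<alpha> F H by unfold_locales
  interpret q: lax_pair A B C \<beta> G K \<gamma> H L by unfold_locales
  have "lax_arrow A B (\<gamma> \<odot>\<^bsub>Lax A B\<^esub> \<alpha>) F L" by (rule lax_arrowI) simp_all
  then interpret \<gamma>\<alpha>: lax_arrow A B "\<gamma> \<odot>\<^bsub>Lax A B\<^esub> \<alpha>" F L .
  interpret r: lax_pair A B C \<beta> G K "\<gamma> \<odot>\<^bsub>Lax A B\<^esub> \<alpha>" F L by unfold_locales
  show ?thesis
    by (rule Lax_cell_eqI[of _ A C]) (simp_all add: \<beta>.tarr_comp')
qed

text \<open>At each object this is how the 2-cell of a composite transformation is defined,
  evaluated at the component of \<gamma>.\<close>

lemma xchg_comp_left:
  assumes "lax_arrow B C \<beta> G K" "lax_arrow B C \<delta> K M" "lax_arrow A B \<gamma> H L"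
  shows "xchg A C (\<delta> \<odot>\<^bsub>Lax B C\<^esub> \<beta>) \<gamma> =
    (farr (precomp A B C L) \<delta> \<lhd>\<^bsub>Lax A C\<^esub> xchg A C \<beta> \<gamma>) \<bullet>\<^bsub>Lax A C\<^esub>
    (xchg A C \<delta> \<gamma> \<rhd>\<^bsub>Lax A C\<^esub> farr (precomp A B C H) \<beta>)"
proof -
  interpret \<beta>: lax_arrow B C \<beta> G K by fact
  interpret \<delta>: lax_arrow B C \<delta> K M by fact
  interpret \<gamma>: lax_arrow A B \<gamma> H L by fact
  interpret p: lax_pair A B C \<beta> G K \<gamma> H L by unfold_locales
  interpret q: lax_pair A B C \<delta> K M \<gamma> H L by unfold_locales
  have "lax_arrow B C (\<delta> \<odot>\<^bsub>Lax B C\<^esub> \<beta>) G M" by (rule lax_arrowI) simp_all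
  then interpret \<delta>\<beta>: lax_arrow B C "\<delta> \<odot>\<^bsub>Lax B C\<^esub> \<beta>" G M .
  interpret r: lax_pair A B C "\<delta> \<odot>\<^bsub>Lax B C\<^esub> \<beta>" G M \<gamma> H L by unfold_locales
  show ?thesis
    by (rule Lax_cell_eqI[of _ A C]) simp_all
qed

lemma lax_arrow_id:
  assumes "two_functor A B F"
  shows "lax_arrow A B (id_arr (Lax A B) F) F F"
proof -
  interpret F: two_functor A B F by fact
  interpret Lax: two_category "Lax A B" by (rule two_category_Lax) unfold_locales
  have "F \<in> Obj (Lax A B)" using assms by (simp add: Lax_simps)
  then show ?thesis by (intro lax_arrowI) simp_all
qed

text \<open>Identity transformations have identity 2-cells at every arrow.\<close>

lemma xchg_id_left:
  assumes "two_functor B C G" "lax_arrow A B \<gamma> H L"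
  shows "xchg A C (id_arr (Lax B C) G) \<gamma> = id_cell (Lax A C) (farr (postcomp A B G) \<gamma>)"
proof -
  interpret \<gamma>: lax_arrow A B \<gamma> H L by fact
  interpret \<beta>: lax_arrow B C "id_arr (Lax B C) G" G G by (rule lax_arrow_id) fact
  interpret p: lax_pair A B C "id_arr (Lax B C) G" G G \<gamma> H L by unfold_locales
  show ?thesis
    by (rule Lax_cell_eqI[of _ A C]) simp_all
qed

text \<open>The components are 2-cells of \<beta> at identity arrows, so this is the unit condition
  \<open>tarr_id\<close>; normality of lax transformations enters the right unit law here.\<close>

lemma xchg_id_right:
  assumes "lax_arrow B C \<beta> G K" "two_functor A B F"
  shows "xchg A C \<beta> (id_arr (Lax A B) F) = id_cell (Lax A C) (farr (precomp A B C F) \<beta>)"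
proof -
  interpret \<beta>: lax_arrow B C \<beta> G K by fact
  interpret \<gamma>: lax_arrow A B "id_arr (Lax A B) F" F F by (rule lax_arrow_id) fact
  interpret p: lax_pair A B C \<beta> G K "id_arr (Lax A B) F" F F by unfold_locales
  show ?thesis
    by (rule Lax_cell_eqI[of _ A C]) simp_all
qed

section \<open>Whiskering along composites and identities, on arrows and 2-cells\<close>

lemma precomp_precomp:
  assumes F: "two_functor A B F" and G: "two_functor B C G" and "two_category D"
  shows "\<gamma> \<in> Arr (Lax C D) \<Longrightarrow> farr (precomp A B D F) (farr (precomp B C D G) \<gamma>) = farr (precomp A C D (comp_fun A G F)) \<gamma>"
    and "n \<in> Cell (Lax C D) \<Longrightarrow> fcell (precomp A B D F) (fcell (precomp B C D G) n) = fcell (precomp A C D (comp_fun A G F)) n"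
proof -
  interpret F: two_functor A B F by fact
  interpret G: two_functor B C G by fact
  interpret PF: two_functor "Lax B D" "Lax A D" "precomp A B D F" by (intro two_functor_precomp F assms)
  interpret PG: two_functor "Lax C D" "Lax B D" "precomp B C D G" by (intro two_functor_precomp G assms)
  interpret P: two_functor "Lax C D" "Lax A D" "precomp A C D (comp_fun A G F)"
    by (intro two_functor_precomp two_functor_comp_fun[OF F G] assms)
  have obj [simp]: "comp_fun B H G \<in> Obj (Lax B D)" if "H \<in> Obj (Lax C D)" for H
    using PG.map_obj_closed[OF that] that by simp
  show *: "farr (precomp A B D F) (farr (precomp B C D G) \<gamma>) = farr (precomp A C D (comp_fun A G F)) \<gamma>"
    if "\<gamma> \<in> Arr (Lax C D)" for \<gamma>
    using that by (intro Lax_arr_eqI[of _ A D]) (simp_all add: comp_fun_assoc[OF F])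
  show "fcell (precomp A B D F) (fcell (precomp B C D G) n) = fcell (precomp A C D (comp_fun A G F)) n"
    if "n \<in> Cell (Lax C D)"
    using that by (intro Lax_cell_eqI[of _ A D]) (simp_all add: *)
qed

lemma postcomp_postcomp:
  assumes A: "two_category A" and G: "two_functor B C G" and H: "two_functor C D H"
  shows "\<alpha> \<in> Arr (Lax A B) \<Longrightarrow> farr (postcomp A C H) (farr (postcomp A B G) \<alpha>) = farr (postcomp A B (comp_fun B H G)) \<alpha>"
    and "m \<in> Cell (Lax A B) \<Longrightarrow> fcell (postcomp A C H) (fcell (postcomp A B G) m) = fcell (postcomp A B (comp_fun B H G)) m"
proof -
  interpret A: two_category A by fact
  interpret G: two_functor B C G by fact
  interpret H: two_functor C D H by fact
  interpret QG: two_functor "Lax A B" "Lax A C" "postcomp A B G" by (intro two_functor_postcomp G assms)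
  interpret QH: two_functor "Lax A C" "Lax A D" "postcomp A C H" by (intro two_functor_postcomp H assms)
  interpret Q: two_functor "Lax A B" "Lax A D" "postcomp A B (comp_fun B H G)"
    by (intro two_functor_postcomp two_functor_comp_fun[OF G H] A)
  have obj [simp]: "comp_fun A G F \<in> Obj (Lax A C)" if "F \<in> Obj (Lax A B)" for F
    using QG.map_obj_closed[OF that] that by simp
  have as [simp]: "comp_fun A (comp_fun B H G) F = comp_fun A H (comp_fun A G F)" if "F \<in> Obj (Lax A B)" for F
    using that comp_fun_assoc[of A B F] by (simp add: Lax_simps)
  show *: "farr (postcomp A C H) (farr (postcomp A B G) \<alpha>) = farr (postcomp A B (comp_fun B H G)) \<alpha>"
    if \<alpha>: "\<alpha> \<in> Arr (Lax A B)" for \<alpha>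
  proof -
    \<comment> \<open>Composite functors evaluate only on their carriers, so the components of
      \<alpha> must be known to lie in \<open>B\<close>.\<close>
    obtain F F' where "lax_arrow A B \<alpha> F F'" using lax_arrowI[OF \<alpha>] by blast
    then interpret \<alpha>: lax_arrow A B \<alpha> F F' .
    show ?thesis by (intro Lax_arr_eqI[of _ A D]) simp_all
  qed
  show "fcell (postcomp A C H) (fcell (postcomp A B G) m) = fcell (postcomp A B (comp_fun B H G)) m"
    if m: "m \<in> Cell (Lax A B)"
  proof -
    obtain F F' \<alpha> \<alpha>' where "lax_cell A B m \<alpha> \<alpha>' F F'"
      using lax_cellI[OF A G.A.two_category_axioms m] by blast
    then interpret m: lax_cell A B m \<alpha> \<alpha>' F F' .
    show ?thesis by (intro Lax_cell_eqI[of _ A D]) (simp_all add: *)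
  qed
qed

text \<open>Both sides apply H to the component of \<beta> at F X. The boundaries agree by
  associativity of composition of 2-functors.\<close>

lemma precomp_postcomp:
  assumes F: "two_functor A B F" and H: "two_functor C D H"
  shows "\<beta> \<in> Arr (Lax B C) \<Longrightarrow> farr (precomp A B D F) (farr (postcomp B C H) \<beta>) = farr (postcomp A C H) (farr (precomp A B C F) \<beta>)"
    and "n \<in> Cell (Lax B C) \<Longrightarrow> fcell (precomp A B D F) (fcell (postcomp B C H) n) = fcell (postcomp A C H) (fcell (precomp A B C F) n)"
proof -
  interpret F: two_functor A B F by fact
  interpret H: two_functor C D H by fact
  interpret PF: two_functor "Lax B D" "Lax A D" "precomp A B D F"
    by (intro two_functor_precomp F H.B.two_category_axioms)
  interpret QH: two_functor "Lax B C" "Lax B D" "postcomp B C H"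
    by (intro two_functor_postcomp H F.B.two_category_axioms)
  interpret PF': two_functor "Lax B C" "Lax A C" "precomp A B C F"
    by (intro two_functor_precomp F H.A.two_category_axioms)
  interpret QH': two_functor "Lax A C" "Lax A D" "postcomp A C H"
    by (intro two_functor_postcomp H F.A.two_category_axioms)
  have obj [simp]: "comp_fun A G F \<in> Obj (Lax A C)" "comp_fun B H G \<in> Obj (Lax B D)" if "G \<in> Obj (Lax B C)" for G
    using PF'.map_obj_closed[OF that] QH.map_obj_closed[OF that] that by simp_all
  show *: "farr (precomp A B D F) (farr (postcomp B C H) \<beta>) = farr (postcomp A C H) (farr (precomp A B C F) \<beta>)"
    if "\<beta> \<in> Arr (Lax B C)" for \<beta>
    using that by (intro Lax_arr_eqI[of _ A D]) (simp_all add: comp_fun_assoc[OF F])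
  show "fcell (precomp A B D F) (fcell (postcomp B C H) n) = fcell (postcomp A C H) (fcell (precomp A B C F) n)"
    if "n \<in> Cell (Lax B C)"
    using that by (intro Lax_cell_eqI[of _ A D]) (simp_all add: *)
qed

lemma precomp_id:
  assumes "two_category A" "two_category B"
  shows "\<beta> \<in> Arr (Lax A B) \<Longrightarrow> farr (precomp A A B (id_fun A)) \<beta> = \<beta>"
    and "n \<in> Cell (Lax A B) \<Longrightarrow> fcell (precomp A A B (id_fun A)) n = n"
proof -
  interpret A: two_category A by fact
  interpret P: two_functor "Lax A B" "Lax A B" "precomp A A B (id_fun A)"
    by (intro two_functor_precomp two_functor_id_fun assms)
  have [simp]: "comp_fun A F (id_fun A) = F" if "F \<in> Obj (Lax A B)" for F
    using that comp_fun_id(1) by (simp add: Lax_simps)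
  show *: "farr (precomp A A B (id_fun A)) \<beta> = \<beta>" if "\<beta> \<in> Arr (Lax A B)" for \<beta>
    using that by (intro Lax_arr_eqI[of _ A B]) simp_all
  show "fcell (precomp A A B (id_fun A)) n = n" if "n \<in> Cell (Lax A B)"
    using that by (intro Lax_cell_eqI[of _ A B]) (simp_all add: *)
qed

lemma postcomp_id:
  assumes "two_category A" "two_category B"
  shows "\<beta> \<in> Arr (Lax A B) \<Longrightarrow> farr (postcomp A B (id_fun B)) \<beta> = \<beta>"
    and "n \<in> Cell (Lax A B) \<Longrightarrow> fcell (postcomp A B (id_fun B)) n = n"
proof -
  interpret A: two_category A by fact
  interpret Q: two_functor "Lax A B" "Lax A B" "postcomp A B (id_fun B)"
    by (intro two_functor_postcomp two_functor_id_fun assms)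
  have [simp]: "comp_fun A (id_fun B) F = F" if "F \<in> Obj (Lax A B)" for F
    using that comp_fun_id(2) by (simp add: Lax_simps)
  show *: "farr (postcomp A B (id_fun B)) \<beta> = \<beta>" if \<beta>: "\<beta> \<in> Arr (Lax A B)" for \<beta>
  proof -
    obtain F F' where "lax_arrow A B \<beta> F F'" using lax_arrowI[OF \<beta>] by blast
    then interpret \<beta>: lax_arrow A B \<beta> F F' .
    show ?thesis by (intro Lax_arr_eqI[of _ A B]) simp_all
  qed
  show "fcell (postcomp A B (id_fun B)) n = n" if n: "n \<in> Cell (Lax A B)"
  proof -
    obtain F F' \<alpha> \<alpha>' where "lax_cell A B n \<alpha> \<alpha>' F F'"
      using lax_cellI[OF assms n] by blast
    then interpret n: lax_cell A B n \<alpha> \<alpha>' F F' .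
    show ?thesis by (intro Lax_cell_eqI[of _ A B]) (simp_all add: *)
  qed
qed

lemma lax_arrow_precomp:
  assumes "lax_arrow B C \<beta> G K" "two_functor A B F"
  shows "lax_arrow A C (farr (precomp A B C F) \<beta>) (comp_fun A G F) (comp_fun A K F)"
proof -
  interpret \<beta>: lax_arrow B C \<beta> G K by fact
  interpret P: two_functor "Lax B C" "Lax A C" "precomp A B C F"
    by (intro two_functor_precomp assms \<beta>.dom.B.two_category_axioms)
  show ?thesis by (rule lax_arrowI) simp_all
qed

lemma lax_arrow_postcomp:
  assumes "lax_arrow A B \<alpha> F H" "two_functor B C G"
  shows "lax_arrow A C (farr (postcomp A B G) \<alpha>) (comp_fun A G F) (comp_fun A G H)"
proof -
  interpret \<alpha>: lax_arrow A B \<alpha> F H by fact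
  interpret Q: two_functor "Lax A B" "Lax A C" "postcomp A B G"
    by (intro two_functor_postcomp assms \<alpha>.dom.A.two_category_axioms)
  show ?thesis by (rule lax_arrowI) simp_all
qed

text \<open>Both cells have as components the images under H of the 2-cells of \<beta> at \<gamma>.
  The work lies in the boundaries, which agree by the whiskering laws above.\<close>

lemma xchg_postcomp:
  assumes \<beta>: "lax_arrow B C \<beta> G K" and \<gamma>: "lax_arrow A B \<gamma> F L" and H: "two_functor C D H"
  shows "xchg A D (farr (postcomp B C H) \<beta>) \<gamma> = fcell (postcomp A C H) (xchg A C \<beta> \<gamma>)"
proof -
  interpret \<beta>: lax_arrow B C \<beta> G K by fact
  interpret \<gamma>: lax_arrow A B \<gamma> F L by fact
  interpret p: lax_pair A B C \<beta> G K \<gamma> F L by unfold_locales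
  interpret H\<beta>: lax_arrow B D "farr (postcomp B C H) \<beta>" "comp_fun B H G" "comp_fun B H K"
    by (rule lax_arrow_postcomp[OF \<beta> H])
  interpret q: lax_pair A B D "farr (postcomp B C H) \<beta>" "comp_fun B H G" "comp_fun B H K" \<gamma> F L
    by unfold_locales
  interpret Q: two_functor "Lax A C" "Lax A D" "postcomp A C H"
    by (intro two_functor_postcomp H \<gamma>.dom.A.two_category_axioms)
  have [simp]: "farr (postcomp A B (comp_fun B H G')) \<gamma> = farr (postcomp A C H) (farr (postcomp A B G') \<gamma>)"
    if "two_functor B C G'" for G'
    using postcomp_postcomp(1)[OF \<gamma>.dom.A.two_category_axioms that H, of \<gamma>] by simp
  show ?thesis
    by (rule Lax_cell_eqI[of _ A D])
      (simp_all add: precomp_postcomp[OF _ H] \<gamma>.dom.two_functor_axioms \<gamma>.cod.two_functor_axioms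
        \<beta>.dom.two_functor_axioms \<beta>.cod.two_functor_axioms)
qed

text \<open>Moves a middle functor across the interchanger: both components are the 2-cell of
  \<gamma> at the arrow G(\<alpha> at X).\<close>

lemma xchg_precomp_postcomp:
  assumes \<gamma>: "lax_arrow C D \<gamma> H K" and \<alpha>: "lax_arrow A B \<alpha> F L" and G: "two_functor B C G"
  shows "xchg A D (farr (precomp B C D G) \<gamma>) \<alpha> = xchg A D \<gamma> (farr (postcomp A B G) \<alpha>)"
proof -
  interpret \<gamma>: lax_arrow C D \<gamma> H K by fact
  interpret \<alpha>: lax_arrow A B \<alpha> F L by fact
  interpret G: two_functor B C G by fact
  interpret \<gamma>G: lax_arrow B D "farr (precomp B C D G) \<gamma>" "comp_fun B H G" "comp_fun B K G"
    by (rule lax_arrow_precomp[OF \<gamma> G])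
  interpret G\<alpha>: lax_arrow A C "farr (postcomp A B G) \<alpha>" "comp_fun A G F" "comp_fun A G L"
    by (rule lax_arrow_postcomp[OF \<alpha> G])
  interpret p: lax_pair A B D "farr (precomp B C D G) \<gamma>" "comp_fun B H G" "comp_fun B K G" \<alpha> F L
    by unfold_locales
  interpret q: lax_pair A C D \<gamma> H K "farr (postcomp A B G) \<alpha>" "comp_fun A G F" "comp_fun A G L"
    by unfold_locales
  show ?thesis
    by (rule Lax_cell_eqI[of _ A D])
      (simp_all add: precomp_precomp[OF _ G \<gamma>.dom.B.two_category_axioms]
        postcomp_postcomp[OF \<alpha>.dom.A.two_category_axioms G, where D = D] \<gamma>.dom.two_functor_axioms \<gamma>.cod.two_functor_axioms
        \<alpha>.dom.two_functor_axioms \<alpha>.cod.two_functor_axioms)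
qed

text \<open>Both components are the 2-cell of \<gamma> at the component of \<beta> at F X.\<close>

lemma xchg_precomp:
  assumes \<gamma>: "lax_arrow C D \<gamma> H K" and \<beta>: "lax_arrow B C \<beta> G L" and F: "two_functor A B F"
  shows "xchg A D \<gamma> (farr (precomp A B C F) \<beta>) = fcell (precomp A B D F) (xchg B D \<gamma> \<beta>)"
proof -
  interpret \<gamma>: lax_arrow C D \<gamma> H K by fact
  interpret \<beta>: lax_arrow B C \<beta> G L by fact
  interpret F: two_functor A B F by fact
  interpret \<beta>F: lax_arrow A C "farr (precomp A B C F) \<beta>" "comp_fun A G F" "comp_fun A L F"
    by (rule lax_arrow_precomp[OF \<beta> F])
  interpret p: lax_pair A C D \<gamma> H K "farr (precomp A B C F) \<beta>" "comp_fun A G F" "comp_fun A L F"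
    by unfold_locales
  interpret q: lax_pair B C D \<gamma> H K \<beta> G L by unfold_locales
  interpret P: two_functor "Lax B D" "Lax A D" "precomp A B D F"
    by (intro two_functor_precomp F \<gamma>.dom.B.two_category_axioms)
  show ?thesis
    by (rule Lax_cell_eqI[of _ A D])
      (simp_all add: precomp_postcomp[OF F] precomp_precomp[OF F _ \<gamma>.dom.B.two_category_axioms]
        \<gamma>.dom.two_functor_axioms \<gamma>.cod.two_functor_axioms \<beta>.dom.two_functor_axioms \<beta>.cod.two_functor_axioms)
qed

section \<open>The composition as a lax functor\<close>

lemma prod_cat_simps [simp]:
  "Obj (K \<times>\<^sub>2 L) = Obj K \<times> Obj L" "Arr (K \<times>\<^sub>2 L) = Arr K \<times> Arr L" "Cell (K \<times>\<^sub>2 L) = Cell K \<times> Cell L"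
  "Dom (K \<times>\<^sub>2 L) (f, g) = (Dom K f, Dom L g)" "Cod (K \<times>\<^sub>2 L) (f, g) = (Cod K f, Cod L g)"
  "Src (K \<times>\<^sub>2 L) (\<sigma>, \<tau>) = (Src K \<sigma>, Src L \<tau>)" "Tgt (K \<times>\<^sub>2 L) (\<sigma>, \<tau>) = (Tgt K \<sigma>, Tgt L \<tau>)"
  "id_arr (K \<times>\<^sub>2 L) (X, Y) = (id_arr K X, id_arr L Y)"
  "id_cell (K \<times>\<^sub>2 L) (f, g) = (id_cell K f, id_cell L g)"
  "comp (K \<times>\<^sub>2 L) (f', g') (f, g) = (comp K f' f, comp L g' g)"
  "vcomp (K \<times>\<^sub>2 L) (\<sigma>', \<tau>') (\<sigma>, \<tau>) = (vcomp K \<sigma>' \<sigma>, vcomp L \<tau>' \<tau>)"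
  "hcomp (K \<times>\<^sub>2 L) (\<sigma>', \<tau>') (\<sigma>, \<tau>) = (hcomp K \<sigma>' \<sigma>, hcomp L \<tau>' \<tau>)"
  by (simp_all add: prod_cat_def)

lemma two_category_prod:
  assumes "two_category K" "two_category L"
  shows "two_category (K \<times>\<^sub>2 L)"
proof -
  interpret K: two_category K by fact
  interpret L: two_category L by fact
  show ?thesis
    by (rule two_category.intro)
      (clarsimp simp: is_arr_def is_cell_def K.interchange' L.interchange')+
qed

lemma two_category_unit: "two_category unit_cat"
  by (rule two_category.intro) (auto simp: unit_cat_def is_arr_def is_cell_def)

context lax_pair
begin

lemma tensor_nat_eq:
  "tensor_nat A C \<beta> \<gamma> = farr (precomp A B C L) \<beta> \<odot>\<^bsub>Lax A C\<^esub> farr (postcomp A B G) \<gamma>"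
proof -
  have "tensor_nat A C \<beta> \<gamma> = comp_nat A C (pre_nat A \<beta> L) (post_nat A G \<gamma>)"
    by (auto simp: tensor_nat_def comp_nat_def pre_nat_def post_nat_def intro!: restrict_ext)
  also have "\<dots> = farr (precomp A B C L) \<beta> \<odot>\<^bsub>Lax A C\<^esub> farr (postcomp A B G) \<gamma>"
    by (simp add: precomp_def postcomp_def) (simp add: Lax_simps)
  finally show ?thesis .
qed

end

lemma tensor_modif_eq:
  assumes "lax_cell B C n \<beta> \<beta>' G K" "lax_cell A B m \<gamma> \<gamma>' F L"
  shows "tensor_modif A C n m = fcell (precomp A B C L) n \<star>\<^bsub>Lax A C\<^esub> fcell (postcomp A B G) m"
proof -
  interpret n: lax_cell B C n \<beta> \<beta>' G K by fact
  interpret m: lax_cell A B m \<gamma> \<gamma>' F L by fact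
  interpret p: lax_pair A B C \<beta> G K \<gamma> F L by unfold_locales
  interpret p': lax_pair A B C \<beta>' G K \<gamma>' F L by unfold_locales
  let ?R = "fcell (precomp A B C L) n \<star>\<^bsub>Lax A C\<^esub> fcell (postcomp A B G) m"
  have R: "?R \<in> Cell (Lax A C)" by simp
  have src: "msrc ?R = farr (precomp A B C L) \<beta> \<odot>\<^bsub>Lax A C\<^esub> farr (postcomp A B G) \<gamma>"
    "mtgt ?R = farr (precomp A B C L) \<beta>' \<odot>\<^bsub>Lax A C\<^esub> farr (postcomp A B G) \<gamma>'"
  proof -
    have "Src (Lax A C) ?R = farr (precomp A B C L) \<beta> \<odot>\<^bsub>Lax A C\<^esub> farr (postcomp A B G) \<gamma>"
      "Tgt (Lax A C) ?R = farr (precomp A B C L) \<beta>' \<odot>\<^bsub>Lax A C\<^esub> farr (postcomp A B G) \<gamma>'"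
      by simp_all
    then show "msrc ?R = farr (precomp A B C L) \<beta> \<odot>\<^bsub>Lax A C\<^esub> farr (postcomp A B G) \<gamma>"
      "mtgt ?R = farr (precomp A B C L) \<beta>' \<odot>\<^bsub>Lax A C\<^esub> farr (postcomp A B G) \<gamma>'"
      by (simp_all only: Lax_simps(6,7))
  qed
  show ?thesis
  proof (rule modif_eqI[of _ _ A])
    show "mobj ?R \<in> extensional (Obj A)"
      using R modification.mobj_ext by (auto simp: Lax_simps(3))
  qed (simp_all add: src tensor_modif_def p.tensor_nat_eq p'.tensor_nat_eq Let_def)
qed

lemma lax_arrow_comp:
  assumes "lax_arrow A B \<alpha> F G" "lax_arrow A B \<beta> G H"
  shows "lax_arrow A B (\<beta> \<odot>\<^bsub>Lax A B\<^esub> \<alpha>) F H"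
proof -
  interpret \<alpha>: lax_arrow A B \<alpha> F G by fact
  interpret \<beta>: lax_arrow A B \<beta> G H by fact
  show ?thesis by (rule lax_arrowI) simp_all
qed

text \<open>The definition brackets the component to the left; the right-nested form is the normal
  form of the calculus and the shape \<open>vcomp_hcomp3\<close> works on.\<close>

lemma tensor_coh_eq:
  assumes \<alpha>: "lax_arrow A B \<alpha> F H" and \<gamma>: "lax_arrow A B \<gamma> H L"
    and \<beta>: "lax_arrow B C \<beta> G K" and \<delta>: "lax_arrow B C \<delta> K M"
  shows "tensor_coh A B C \<delta> \<gamma> \<beta> \<alpha> = id_cell (Lax A C) (farr (precomp A B C L) \<delta>) \<star>\<^bsub>Lax A C\<^esub>
    (xchg A C \<beta> \<gamma> \<star>\<^bsub>Lax A C\<^esub> id_cell (Lax A C) (farr (postcomp A B G) \<alpha>))"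
proof -
  interpret \<alpha>: lax_arrow A B \<alpha> F H by fact
  interpret \<beta>: lax_arrow B C \<beta> G K by fact
  interpret \<gamma>: lax_arrow A B \<gamma> H L by fact
  interpret \<delta>: lax_arrow B C \<delta> K M by fact
  interpret p: lax_pair A B C \<beta> G K \<gamma> H L by unfold_locales
  interpret q: lax_pair A B C \<beta> G K \<alpha> F H by unfold_locales
  interpret r: lax_pair A B C \<delta> K M \<gamma> H L by unfold_locales
  interpret \<gamma>\<alpha>: lax_arrow A B "\<gamma> \<odot>\<^bsub>Lax A B\<^esub> \<alpha>" F L by (rule lax_arrow_comp[OF \<alpha> \<gamma>])
  interpret \<delta>\<beta>: lax_arrow B C "\<delta> \<odot>\<^bsub>Lax B C\<^esub> \<beta>" G M by (rule lax_arrow_comp[OF \<beta> \<delta>])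
  interpret t: lax_pair A B C "\<delta> \<odot>\<^bsub>Lax B C\<^esub> \<beta>" G M "\<gamma> \<odot>\<^bsub>Lax A B\<^esub> \<alpha>" F L by unfold_locales
  let ?R = "id_cell (Lax A C) (farr (precomp A B C L) \<delta>) \<star>\<^bsub>Lax A C\<^esub>
    (xchg A C \<beta> \<gamma> \<star>\<^bsub>Lax A C\<^esub> id_cell (Lax A C) (farr (postcomp A B G) \<alpha>))"
  have R: "?R \<in> Cell (Lax A C)" by simp
  have src: "msrc ?R = tensor_nat A C \<delta> \<gamma> \<odot>\<^bsub>Lax A C\<^esub> tensor_nat A C \<beta> \<alpha>"
    "mtgt ?R = tensor_nat A C (\<delta> \<odot>\<^bsub>Lax B C\<^esub> \<beta>) (\<gamma> \<odot>\<^bsub>Lax A B\<^esub> \<alpha>)"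
  proof -
    have "Src (Lax A C) ?R = tensor_nat A C \<delta> \<gamma> \<odot>\<^bsub>Lax A C\<^esub> tensor_nat A C \<beta> \<alpha>"
      by (simp add: r.tensor_nat_eq q.tensor_nat_eq)
    moreover have "Tgt (Lax A C) ?R = tensor_nat A C (\<delta> \<odot>\<^bsub>Lax B C\<^esub> \<beta>) (\<gamma> \<odot>\<^bsub>Lax A B\<^esub> \<alpha>)"
      by (simp add: t.tensor_nat_eq)
    ultimately show "msrc ?R = tensor_nat A C \<delta> \<gamma> \<odot>\<^bsub>Lax A C\<^esub> tensor_nat A C \<beta> \<alpha>"
      "mtgt ?R = tensor_nat A C (\<delta> \<odot>\<^bsub>Lax B C\<^esub> \<beta>) (\<gamma> \<odot>\<^bsub>Lax A B\<^esub> \<alpha>)"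
      by (simp_all only: Lax_simps(6,7))
  qed
  show ?thesis
  proof (rule modif_eqI[of _ _ A])
    show "mobj ?R \<in> extensional (Obj A)"
      using R modification.mobj_ext by (auto simp: Lax_simps(3))
  qed (simp_all add: src, simp_all add: tensor_coh_def Let_def Lax_simps(10))
qed

text \<open>Regroup the source as n'L \<star> ((Km' \<star> nH) \<star> Gm). The coherence cell acts
  only on the middle factor, since its outer whiskers are identities, so the claim is
  \<open>xchg_natural\<close> between n'L and Gm.\<close>

lemma tensor_coh_natural:
  assumes m: "lax_cell A B m \<alpha> \<alpha>' F H" and m': "lax_cell A B m' \<gamma> \<gamma>' H L"
    and n: "lax_cell B C n \<beta> \<beta>' G K" and n': "lax_cell B C n' \<delta> \<delta>' K M"
  shows "tensor_coh A B C \<delta>' \<gamma>' \<beta>' \<alpha>' \<bullet>\<^bsub>Lax A C\<^esub> (tensor_modif A C n' m' \<star>\<^bsub>Lax A C\<^esub> tensor_modif A C n m) =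
    tensor_modif A C (n' \<star>\<^bsub>Lax B C\<^esub> n) (m' \<star>\<^bsub>Lax A B\<^esub> m) \<bullet>\<^bsub>Lax A C\<^esub> tensor_coh A B C \<delta> \<gamma> \<beta> \<alpha>"
proof -
  interpret n: lax_cell B C n \<beta> \<beta>' G K by fact
  interpret m: lax_cell A B m \<alpha> \<alpha>' F H by fact
  interpret n': lax_cell B C n' \<delta> \<delta>' K M by fact
  interpret m': lax_cell A B m' \<gamma> \<gamma>' H L by fact
  interpret p: lax_pair A B C \<beta> G K \<gamma> H L by unfold_locales
  interpret p': lax_pair A B C \<beta>' G K \<gamma>' H L by unfold_locales
  interpret q: lax_pair A B C \<beta> G K \<alpha> F H by unfold_locales
  interpret q': lax_pair A B C \<beta>' G K \<alpha>' F H by unfold_locales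
  interpret r: lax_pair A B C \<delta> K M \<gamma> H L by unfold_locales
  interpret r': lax_pair A B C \<delta>' K M \<gamma>' H L by unfold_locales
  have nn: "lax_cell B C (n' \<star>\<^bsub>Lax B C\<^esub> n) (\<delta> \<odot>\<^bsub>Lax B C\<^esub> \<beta>) (\<delta>' \<odot>\<^bsub>Lax B C\<^esub> \<beta>') G M"
    by (rule lax_cellI) (simp_all add: n.src.dom.A.two_category_axioms n.src.dom.B.two_category_axioms)
  have mm: "lax_cell A B (m' \<star>\<^bsub>Lax A B\<^esub> m) (\<gamma> \<odot>\<^bsub>Lax A B\<^esub> \<alpha>) (\<gamma>' \<odot>\<^bsub>Lax A B\<^esub> \<alpha>') F L"
    by (rule lax_cellI) (simp_all add: m.src.dom.A.two_category_axioms n.src.dom.A.two_category_axioms)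
  note eqs = tensor_modif_eq[OF n m] tensor_modif_eq[OF n' m'] tensor_modif_eq[OF nn mm]
    tensor_coh_eq[OF m.src.lax_arrow_axioms m'.src.lax_arrow_axioms n.src.lax_arrow_axioms n'.src.lax_arrow_axioms]
    tensor_coh_eq[OF m.tgt.lax_arrow_axioms m'.tgt.lax_arrow_axioms n.tgt.lax_arrow_axioms n'.tgt.lax_arrow_axioms]
  let ?P = "fcell (precomp A B C L)" and ?Q = "fcell (postcomp A B G)"
  let ?X = "fcell (postcomp A B K) m' \<star>\<^bsub>Lax A C\<^esub> fcell (precomp A B C H) n"
  let ?Y = "fcell (precomp A B C L) n \<star>\<^bsub>Lax A C\<^esub> fcell (postcomp A B G) m'"
  have "tensor_coh A B C \<delta>' \<gamma>' \<beta>' \<alpha>' \<bullet>\<^bsub>Lax A C\<^esub> (tensor_modif A C n' m' \<star>\<^bsub>Lax A C\<^esub> tensor_modif A C n m) =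
    tensor_coh A B C \<delta>' \<gamma>' \<beta>' \<alpha>' \<bullet>\<^bsub>Lax A C\<^esub> (?P n' \<star>\<^bsub>Lax A C\<^esub> (?X \<star>\<^bsub>Lax A C\<^esub> ?Q m))"
    by (simp add: eqs)
  also have "\<dots> = ?P n' \<star>\<^bsub>Lax A C\<^esub> ((xchg A C \<beta>' \<gamma>' \<bullet>\<^bsub>Lax A C\<^esub> ?X) \<star>\<^bsub>Lax A C\<^esub> ?Q m)"
    unfolding eqs by (subst p.PF.B.vcomp_hcomp3) simp_all
  also have "\<dots> = ?P n' \<star>\<^bsub>Lax A C\<^esub> ((?Y \<bullet>\<^bsub>Lax A C\<^esub> xchg A C \<beta> \<gamma>) \<star>\<^bsub>Lax A C\<^esub> ?Q m)"
    by (simp only: xchg_natural[OF n m'])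
  also have "\<dots> = (?P n' \<star>\<^bsub>Lax A C\<^esub> (?Y \<star>\<^bsub>Lax A C\<^esub> ?Q m)) \<bullet>\<^bsub>Lax A C\<^esub> tensor_coh A B C \<delta> \<gamma> \<beta> \<alpha>"
    unfolding eqs by (subst p.PF.B.vcomp_hcomp3) simp_all
  also have "\<dots> = tensor_modif A C (n' \<star>\<^bsub>Lax B C\<^esub> n) (m' \<star>\<^bsub>Lax A B\<^esub> m) \<bullet>\<^bsub>Lax A C\<^esub> tensor_coh A B C \<delta> \<gamma> \<beta> \<alpha>"
    by (simp add: eqs)
  finally show ?thesis .
qed

text \<open>After expanding the interchangers of composites, both sides end with a whiskered \<chi>
  of \<open>\<beta>\<^sub>1\<close> and \<open>\<alpha>\<^sub>3\<close>. Before it they apply \<chi>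
  of \<open>\<beta>\<^sub>1\<close>, \<open>\<alpha>\<^sub>2\<close> and \<chi> of
  \<open>\<beta>\<^sub>2\<close>, \<open>\<alpha>\<^sub>3\<close> in opposite orders, at disjoint
  places.\<close>

lemma tensor_coh_assoc:
  assumes a: "lax_arrow A B \<alpha>\<^sub>1 F\<^sub>0 F\<^sub>1" "lax_arrow A B \<alpha>\<^sub>2 F\<^sub>1 F\<^sub>2" "lax_arrow A B \<alpha>\<^sub>3 F\<^sub>2 F\<^sub>3"
    and b: "lax_arrow B C \<beta>\<^sub>1 G\<^sub>0 G\<^sub>1" "lax_arrow B C \<beta>\<^sub>2 G\<^sub>1 G\<^sub>2" "lax_arrow B C \<beta>\<^sub>3 G\<^sub>2 G\<^sub>3"
  shows "tensor_coh A B C \<beta>\<^sub>3 \<alpha>\<^sub>3 (\<beta>\<^sub>2 \<odot>\<^bsub>Lax B C\<^esub> \<beta>\<^sub>1) (\<alpha>\<^sub>2 \<odot>\<^bsub>Lax A B\<^esub> \<alpha>\<^sub>1) \<bullet>\<^bsub>Lax A C\<^esub>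
      (tensor_nat A C \<beta>\<^sub>3 \<alpha>\<^sub>3 \<lhd>\<^bsub>Lax A C\<^esub> tensor_coh A B C \<beta>\<^sub>2 \<alpha>\<^sub>2 \<beta>\<^sub>1 \<alpha>\<^sub>1) =
    tensor_coh A B C (\<beta>\<^sub>3 \<odot>\<^bsub>Lax B C\<^esub> \<beta>\<^sub>2) (\<alpha>\<^sub>3 \<odot>\<^bsub>Lax A B\<^esub> \<alpha>\<^sub>2) \<beta>\<^sub>1 \<alpha>\<^sub>1 \<bullet>\<^bsub>Lax A C\<^esub>
      (tensor_coh A B C \<beta>\<^sub>3 \<alpha>\<^sub>3 \<beta>\<^sub>2 \<alpha>\<^sub>2 \<rhd>\<^bsub>Lax A C\<^esub> tensor_nat A C \<beta>\<^sub>1 \<alpha>\<^sub>1)"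
proof -
  interpret a1: lax_arrow A B \<alpha>\<^sub>1 F\<^sub>0 F\<^sub>1 by fact
  interpret a2: lax_arrow A B \<alpha>\<^sub>2 F\<^sub>1 F\<^sub>2 by fact
  interpret a3: lax_arrow A B \<alpha>\<^sub>3 F\<^sub>2 F\<^sub>3 by fact
  interpret b1: lax_arrow B C \<beta>\<^sub>1 G\<^sub>0 G\<^sub>1 by fact
  interpret b2: lax_arrow B C \<beta>\<^sub>2 G\<^sub>1 G\<^sub>2 by fact
  interpret b3: lax_arrow B C \<beta>\<^sub>3 G\<^sub>2 G\<^sub>3 by fact
  interpret p11: lax_pair A B C \<beta>\<^sub>1 G\<^sub>0 G\<^sub>1 \<alpha>\<^sub>1 F\<^sub>0 F\<^sub>1 by unfold_locales
  interpret p12: lax_pair A B C \<beta>\<^sub>1 G\<^sub>0 G\<^sub>1 \<alpha>\<^sub>2 F\<^sub>1 F\<^sub>2 by unfold_locales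
  interpret p13: lax_pair A B C \<beta>\<^sub>1 G\<^sub>0 G\<^sub>1 \<alpha>\<^sub>3 F\<^sub>2 F\<^sub>3 by unfold_locales
  interpret p23: lax_pair A B C \<beta>\<^sub>2 G\<^sub>1 G\<^sub>2 \<alpha>\<^sub>3 F\<^sub>2 F\<^sub>3 by unfold_locales
  interpret p33: lax_pair A B C \<beta>\<^sub>3 G\<^sub>2 G\<^sub>3 \<alpha>\<^sub>3 F\<^sub>2 F\<^sub>3 by unfold_locales
  note ac = lax_arrow_comp[OF a(1,2)] lax_arrow_comp[OF a(2,3)] lax_arrow_comp[OF b(1,2)] lax_arrow_comp[OF b(2,3)]
  note eqs = tensor_coh_eq[OF ac(1) a(3) ac(3) b(3)] tensor_coh_eq[OF a(1,2) b(1,2)]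
    tensor_coh_eq[OF a(1) ac(2) b(1) ac(4)] tensor_coh_eq[OF a(2,3) b(2,3)]
    p11.tensor_nat_eq p33.tensor_nat_eq xchg_comp_left[OF b(1,2) a(3)] xchg_comp_right[OF b(1) a(2,3)]
  note swap = p11.PF.B.whisker_swap[of "xchg A C \<beta>\<^sub>1 \<alpha>\<^sub>2" "xchg A C \<beta>\<^sub>2 \<alpha>\<^sub>3", simplified]
  \<comment> \<open>Whiskering by the factors common to both sides, \<open>\<beta>\<^sub>3\<close>
    at \<open>F\<^sub>3\<close> on the left and the image of \<open>\<alpha>\<^sub>1\<close> under
    \<open>G\<^sub>0\<close> on the right, gives the swap in the form occurring in the goal.\<close>
  note swap' = arg_cong[OF swap, where f = "\<lambda>x. id_cell (Lax A C) (farr (precomp A B C F\<^sub>3) \<beta>\<^sub>3) \<star>\<^bsub>Lax A C\<^esub>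
     (x \<star>\<^bsub>Lax A C\<^esub> id_cell (Lax A C) (farr (postcomp A B G\<^sub>0) \<alpha>\<^sub>1))", simplified]
  show ?thesis by (simp add: eqs swap')
qed

lemma tensor_simps:
  "\<lbrakk>G \<in> Obj (Lax B C); F \<in> Obj (Lax A B)\<rbrakk> \<Longrightarrow> fobj (tensor A B C) (G, F) = comp_fun A G F"
  "\<lbrakk>\<beta> \<in> Arr (Lax B C); \<alpha> \<in> Arr (Lax A B)\<rbrakk> \<Longrightarrow> farr (tensor A B C) (\<beta>, \<alpha>) = tensor_nat A C \<beta> \<alpha>"
  "\<lbrakk>n \<in> Cell (Lax B C); m \<in> Cell (Lax A B)\<rbrakk> \<Longrightarrow> fcell (tensor A B C) (n, m) = tensor_modif A C n m"
  "\<lbrakk>\<beta> \<in> Arr (Lax B C); \<alpha> \<in> Arr (Lax A B); \<delta> \<in> Arr (Lax B C); \<gamma> \<in> Arr (Lax A B);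
    Cod (Lax B C) \<beta> = Dom (Lax B C) \<delta>; Cod (Lax A B) \<alpha> = Dom (Lax A B) \<gamma>\<rbrakk>
    \<Longrightarrow> coh (tensor A B C) ((\<beta>, \<alpha>), (\<delta>, \<gamma>)) = tensor_coh A B C \<delta> \<gamma> \<beta> \<alpha>"
  by (simp_all add: tensor_def composable_def)

lemma lax_functor_tensor:
  assumes A: "two_category A" and B: "two_category B" and C: "two_category C"
  shows "lax_functor (Lax B C \<times>\<^sub>2 Lax A B) (Lax A C) (tensor A B C)"
proof -
  interpret AB: two_category "Lax A B" by (rule two_category_Lax[OF A B])
  interpret BC: two_category "Lax B C" by (rule two_category_Lax[OF B C])
  interpret AC: two_category "Lax A C" by (rule two_category_Lax[OF A C])
  interpret BCAB: two_category "Lax B C \<times>\<^sub>2 Lax A B"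
    by (rule two_category_prod[OF BC.two_category_axioms AB.two_category_axioms])
  let ?T = "tensor A B C"
  have ext: "fobj ?T \<in> extensional (Obj (Lax B C) \<times> Obj (Lax A B))"
    "farr ?T \<in> extensional (Arr (Lax B C) \<times> Arr (Lax A B))"
    "fcell ?T \<in> extensional (Cell (Lax B C) \<times> Cell (Lax A B))"
    "coh ?T \<in> extensional (composable (Lax B C \<times>\<^sub>2 Lax A B))"
    by (simp_all add: tensor_def)
  have obj: "comp_fun A G F \<in> Obj (Lax A C)" if "G \<in> Obj (Lax B C)" "F \<in> Obj (Lax A B)" for G F
    using that two_functor_comp_fun by (auto simp: Lax_simps)
  have arr: "tensor_nat A C \<beta> \<alpha> \<in> Arr (Lax A C)"
    "Dom (Lax A C) (tensor_nat A C \<beta> \<alpha>) = comp_fun A (Dom (Lax B C) \<beta>) (Dom (Lax A B) \<alpha>)"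
    "Cod (Lax A C) (tensor_nat A C \<beta> \<alpha>) = comp_fun A (Cod (Lax B C) \<beta>) (Cod (Lax A B) \<alpha>)"
    if ba: "\<beta> \<in> Arr (Lax B C)" "\<alpha> \<in> Arr (Lax A B)" for \<beta> \<alpha>
  proof -
    obtain F H G K where "lax_arrow A B \<alpha> F H" "lax_arrow B C \<beta> G K" using lax_arrowI ba by metis
    then interpret \<alpha>: lax_arrow A B \<alpha> F H + \<beta>: lax_arrow B C \<beta> G K .
    interpret p: lax_pair A B C \<beta> G K \<alpha> F H by unfold_locales
    show "tensor_nat A C \<beta> \<alpha> \<in> Arr (Lax A C)"
    "Dom (Lax A C) (tensor_nat A C \<beta> \<alpha>) = comp_fun A (Dom (Lax B C) \<beta>) (Dom (Lax A B) \<alpha>)"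
    "Cod (Lax A C) (tensor_nat A C \<beta> \<alpha>) = comp_fun A (Cod (Lax B C) \<beta>) (Cod (Lax A B) \<alpha>)"
      by (simp_all add: p.tensor_nat_eq)
  qed
  have cell: "tensor_modif A C n m \<in> Cell (Lax A C)"
    "Src (Lax A C) (tensor_modif A C n m) = tensor_nat A C (Src (Lax B C) n) (Src (Lax A B) m)"
    "Tgt (Lax A C) (tensor_modif A C n m) = tensor_nat A C (Tgt (Lax B C) n) (Tgt (Lax A B) m)"
    if nm: "n \<in> Cell (Lax B C)" "m \<in> Cell (Lax A B)" for n m
  proof -
    obtain \<alpha> \<alpha>' F H \<beta> \<beta>' G K where m: "lax_cell A B m \<alpha> \<alpha>' F H" and n: "lax_cell B C n \<beta> \<beta>' G K"
      using lax_cellI A B C nm by metis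
    then interpret m: lax_cell A B m \<alpha> \<alpha>' F H + n: lax_cell B C n \<beta> \<beta>' G K by -
    interpret p: lax_pair A B C \<beta> G K \<alpha> F H by unfold_locales
    interpret p': lax_pair A B C \<beta>' G K \<alpha>' F H by unfold_locales
    show "tensor_modif A C n m \<in> Cell (Lax A C)"
    "Src (Lax A C) (tensor_modif A C n m) = tensor_nat A C (Src (Lax B C) n) (Src (Lax A B) m)"
    "Tgt (Lax A C) (tensor_modif A C n m) = tensor_nat A C (Tgt (Lax B C) n) (Tgt (Lax A B) m)"
      by (simp_all add: tensor_modif_eq[OF n m] p.tensor_nat_eq p'.tensor_nat_eq)
  qed
  show ?thesis
  \<comment> \<open>Cases 1 to 7 are typing, 8 to 10 strict preservation of identities and vertical
    composites, 11 extensionality, and 12 to 14 the coherence cells with associativity and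
    naturality.\<close>
  proof (intro lax_functor.intro two_map.intro two_map_axioms.intro lax_functor_axioms.intro
      BCAB.two_category_axioms AC.two_category_axioms, goal_cases)
    case 1 show ?case using ext obj by (auto simp: PiE_iff tensor_simps)
  next
    case 2 show ?case using ext arr by (auto simp: PiE_iff tensor_simps)
  next
    case 3 show ?case using ext cell by (auto simp: PiE_iff tensor_simps)
  next
    case (4 f) then show ?case by (cases f) (simp add: tensor_simps arr)
  next
    case (5 f) then show ?case by (cases f) (simp add: tensor_simps arr)
  next
    case (6 \<theta>) then show ?case by (cases \<theta>) (simp add: tensor_simps cell)
  next
    case (7 \<theta>) then show ?case by (cases \<theta>) (simp add: tensor_simps cell)
  next
    case (8 X)
    then obtain G F where X: "X = (G, F)" "two_functor B C G" "two_functor A B F" by (auto simp: Lax_simps)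
    interpret \<alpha>: lax_arrow A B "id_arr (Lax A B) F" F F by (rule lax_arrow_id) fact
    interpret \<beta>: lax_arrow B C "id_arr (Lax B C) G" G G by (rule lax_arrow_id) fact
    interpret p: lax_pair A B C "id_arr (Lax B C) G" G G "id_arr (Lax A B) F" F F by unfold_locales
    \<comment> \<open>Both whiskerings preserve identities, so the tensor of two identities is a
      composite of two identities.\<close>
    show ?case by (simp add: X(1) tensor_simps p.tensor_nat_eq obj)
  next
    case (9 f)
    then obtain \<beta> \<alpha> F H G K where f: "f = (\<beta>, \<alpha>)" and l: "lax_arrow A B \<alpha> F H" "lax_arrow B C \<beta> G K"
      using lax_arrowI by (metis mem_Sigma_iff prod.collapse prod_cat_simps(2))
    interpret \<alpha>: lax_arrow A B \<alpha> F H by (rule l)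
    interpret \<beta>: lax_arrow B C \<beta> G K by (rule l)
    interpret p: lax_pair A B C \<beta> G K \<alpha> F H by unfold_locales
    have c: "lax_cell A B (id_cell (Lax A B) \<alpha>) \<alpha> \<alpha> F H" "lax_cell B C (id_cell (Lax B C) \<beta>) \<beta> \<beta> G K"
      by (rule lax_cellI; simp add: A B C)+
    show ?case by (simp add: f tensor_simps p.tensor_nat_eq tensor_modif_eq[OF c(2,1)])
  next
    case (10 \<sigma> f g \<tau> h)
    obtain n m n' m' where st: "\<sigma> = (n, m)" "\<tau> = (n', m')" by (metis prod.exhaust)
    have c: "n \<in> Cell (Lax B C)" "n' \<in> Cell (Lax B C)" "m \<in> Cell (Lax A B)" "m' \<in> Cell (Lax A B)"
      "Tgt (Lax B C) n = Src (Lax B C) n'" "Tgt (Lax A B) m = Src (Lax A B) m'"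
      using 10 by (auto simp: st is_cell_def)
    obtain \<alpha> \<alpha>' \<alpha>'' F H \<beta> \<beta>' \<beta>'' G K where l: "lax_cell A B m \<alpha> \<alpha>' F H" "lax_cell B C n \<beta> \<beta>' G K"
      "lax_cell A B m' \<alpha>' \<alpha>'' F H" "lax_cell B C n' \<beta>' \<beta>'' G K"
      using lax_cellI[OF A B c(3)] lax_cellI[OF A B c(4)] lax_cellI[OF B C c(1)] lax_cellI[OF B C c(2)] c
        AB.cell_closed[OF c(3)] BC.cell_closed[OF c(1)] by metis
    interpret m: lax_cell A B m \<alpha> \<alpha>' F H by (rule l)
    interpret n: lax_cell B C n \<beta> \<beta>' G K by (rule l)
    interpret m': lax_cell A B m' \<alpha>' \<alpha>'' F H by (rule l)
    interpret n': lax_cell B C n' \<beta>' \<beta>'' G K by (rule l)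
    interpret p: lax_pair A B C \<beta> G K \<alpha> F H by unfold_locales
    have c: "lax_cell A B (m' \<bullet>\<^bsub>Lax A B\<^esub> m) \<alpha> \<alpha>'' F H" "lax_cell B C (n' \<bullet>\<^bsub>Lax B C\<^esub> n) \<beta> \<beta>'' G K"
      by (rule lax_cellI; simp add: A B C)+
    \<comment> \<open>Since both whiskerings preserve vertical composition, what remains is
      interchange in \<open>Lax A C\<close>.\<close>
    show ?case
      by (simp add: st tensor_simps tensor_modif_eq[OF c(2,1)] tensor_modif_eq[OF l(2,1)]
          tensor_modif_eq[OF l(4,3)] AC.interchange')
  next
    case 11 show ?case by (rule ext)
  next
    case (12 f X Y g Z)
    obtain \<beta> \<alpha> \<delta> \<gamma> where st: "f = (\<beta>, \<alpha>)" "g = (\<delta>, \<gamma>)" by (metis prod.exhaust)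
    obtain F H L G K M where l: "lax_arrow A B \<alpha> F H" "lax_arrow A B \<gamma> H L" "lax_arrow B C \<beta> G K" "lax_arrow B C \<delta> K M"
      using 12 by (auto simp: st is_arr_def lax_arrow_def)
    interpret \<alpha>: lax_arrow A B \<alpha> F H by (rule l)
    interpret \<gamma>: lax_arrow A B \<gamma> H L by (rule l)
    interpret \<beta>: lax_arrow B C \<beta> G K by (rule l)
    interpret \<delta>: lax_arrow B C \<delta> K M by (rule l)
    interpret p: lax_pair A B C \<beta> G K \<gamma> H L by unfold_locales
    interpret q: lax_pair A B C \<beta> G K \<alpha> F H by unfold_locales
    interpret r: lax_pair A B C \<delta> K M \<gamma> H L by unfold_locales
    interpret \<gamma>\<alpha>: lax_arrow A B "\<gamma> \<odot>\<^bsub>Lax A B\<^esub> \<alpha>" F L by (rule lax_arrow_comp[OF l(1,2)])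
    interpret \<delta>\<beta>: lax_arrow B C "\<delta> \<odot>\<^bsub>Lax B C\<^esub> \<beta>" G M by (rule lax_arrow_comp[OF l(3,4)])
    interpret t: lax_pair A B C "\<delta> \<odot>\<^bsub>Lax B C\<^esub> \<beta>" G M "\<gamma> \<odot>\<^bsub>Lax A B\<^esub> \<alpha>" F L by unfold_locales
    show ?case
      by (simp add: st tensor_simps is_cell_def tensor_coh_eq[OF l] r.tensor_nat_eq q.tensor_nat_eq t.tensor_nat_eq)
  next
    case (13 f W X g Y h Z)
    obtain \<beta>\<^sub>1 \<beta>\<^sub>2 \<beta>\<^sub>3 \<alpha>\<^sub>1 \<alpha>\<^sub>2 \<alpha>\<^sub>3 where st: "f = (\<beta>\<^sub>1, \<alpha>\<^sub>1)" "g = (\<beta>\<^sub>2, \<alpha>\<^sub>2)" "h = (\<beta>\<^sub>3, \<alpha>\<^sub>3)" by (metis prod.exhaust)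
    obtain F\<^sub>0 F\<^sub>1 F\<^sub>2 F\<^sub>3 G\<^sub>0 G\<^sub>1 G\<^sub>2 G\<^sub>3 where
      a: "lax_arrow A B \<alpha>\<^sub>1 F\<^sub>0 F\<^sub>1" "lax_arrow A B \<alpha>\<^sub>2 F\<^sub>1 F\<^sub>2" "lax_arrow A B \<alpha>\<^sub>3 F\<^sub>2 F\<^sub>3"
      and b: "lax_arrow B C \<beta>\<^sub>1 G\<^sub>0 G\<^sub>1" "lax_arrow B C \<beta>\<^sub>2 G\<^sub>1 G\<^sub>2" "lax_arrow B C \<beta>\<^sub>3 G\<^sub>2 G\<^sub>3"
      using 13 by (auto simp: st is_arr_def lax_arrow_def)
    interpret a1: lax_arrow A B \<alpha>\<^sub>1 F\<^sub>0 F\<^sub>1 by (rule a)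
    interpret a2: lax_arrow A B \<alpha>\<^sub>2 F\<^sub>1 F\<^sub>2 by (rule a)
    interpret a3: lax_arrow A B \<alpha>\<^sub>3 F\<^sub>2 F\<^sub>3 by (rule a)
    interpret b1: lax_arrow B C \<beta>\<^sub>1 G\<^sub>0 G\<^sub>1 by (rule b)
    interpret b2: lax_arrow B C \<beta>\<^sub>2 G\<^sub>1 G\<^sub>2 by (rule b)
    interpret b3: lax_arrow B C \<beta>\<^sub>3 G\<^sub>2 G\<^sub>3 by (rule b)
    show ?case by (simp add: st tensor_simps tensor_coh_assoc[OF a b])
  next
    case (14 f X Y g h Z k \<sigma> \<tau>)
    obtain \<beta> \<alpha> \<beta>' \<alpha>' \<delta> \<gamma> \<delta>' \<gamma>' n m n' m' where
      st: "f = (\<beta>, \<alpha>)" "g = (\<beta>', \<alpha>')" "h = (\<delta>, \<gamma>)" "k = (\<delta>', \<gamma>')" "\<sigma> = (n, m)" "\<tau> = (n', m')"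
      by (metis prod.exhaust)
    obtain F H L G K M where m: "lax_cell A B m \<alpha> \<alpha>' F H" and m': "lax_cell A B m' \<gamma> \<gamma>' H L"
      and n: "lax_cell B C n \<beta> \<beta>' G K" and n': "lax_cell B C n' \<delta> \<delta>' K M"
      using 14 by (auto simp: st is_arr_def is_cell_def lax_cell_def)
    interpret n: lax_cell B C n \<beta> \<beta>' G K by fact
    interpret m: lax_cell A B m \<alpha> \<alpha>' F H by fact
    interpret n': lax_cell B C n' \<delta> \<delta>' K M by fact
    interpret m': lax_cell A B m' \<gamma> \<gamma>' H L by fact
    show ?case by (simp add: st tensor_simps tensor_coh_natural[OF m m' n n'])
  qed
qed

section \<open>Associativity and units\<close>

lemma lax_arrow_tensor:
  assumes "lax_arrow B C \<beta> G K" "lax_arrow A B \<alpha> F H"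
  shows "lax_arrow A C (tensor_nat A C \<beta> \<alpha>) (comp_fun A G F) (comp_fun A K H)"
proof -
  interpret \<alpha>: lax_arrow A B \<alpha> F H by fact
  interpret \<beta>: lax_arrow B C \<beta> G K by fact
  interpret p: lax_pair A B C \<beta> G K \<alpha> F H by unfold_locales
  show ?thesis by (rule lax_arrowI) (simp_all add: p.tensor_nat_eq)
qed

lemma lax_cell_tensor:
  assumes "lax_cell B C n \<beta> \<beta>' G K" "lax_cell A B m \<alpha> \<alpha>' F H"
  shows "lax_cell A C (tensor_modif A C n m) (tensor_nat A C \<beta> \<alpha>) (tensor_nat A C \<beta>' \<alpha>') (comp_fun A G F) (comp_fun A K H)"
proof -
  interpret m: lax_cell A B m \<alpha> \<alpha>' F H by fact
  interpret n: lax_cell B C n \<beta> \<beta>' G K by fact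
  interpret p: lax_pair A B C \<beta> G K \<alpha> F H by unfold_locales
  interpret p': lax_pair A B C \<beta>' G K \<alpha>' F H by unfold_locales
  show ?thesis
    by (rule lax_cellI) (simp_all add: tensor_modif_eq[OF assms] p.tensor_nat_eq p'.tensor_nat_eq
        m.src.dom.A.two_category_axioms n.src.dom.B.two_category_axioms)
qed

lemma lax_cell_id:
  assumes "lax_arrow A B \<alpha> F G"
  shows "lax_cell A B (id_cell (Lax A B) \<alpha>) \<alpha> \<alpha> F G"
proof -
  interpret \<alpha>: lax_arrow A B \<alpha> F G by fact
  show ?thesis
    by (rule lax_cellI) (simp_all add: \<alpha>.dom.A.two_category_axioms \<alpha>.dom.B.two_category_axioms)
qed

text \<open>Used in the associativity law to remove the identity coherence cells of
  \<open>assoc_lax\<close> after the tensor has been applied to them.\<close>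

lemma tensor_modif_id:
  assumes "lax_arrow B C \<beta> G K" "lax_arrow A B \<alpha> F H"
  shows "tensor_modif A C (id_cell (Lax B C) \<beta>) (id_cell (Lax A B) \<alpha>) = id_cell (Lax A C) (tensor_nat A C \<beta> \<alpha>)"
proof -
  interpret \<alpha>: lax_arrow A B \<alpha> F H by fact
  interpret \<beta>: lax_arrow B C \<beta> G K by fact
  interpret p: lax_pair A B C \<beta> G K \<alpha> F H by unfold_locales
  show ?thesis
    by (simp add: tensor_modif_eq[OF lax_cell_id[OF assms(1)] lax_cell_id[OF assms(2)]] p.tensor_nat_eq)
qed

lemma lax_cell_tensor_coh:
  assumes \<alpha>: "lax_arrow A B \<alpha> F H" and \<gamma>: "lax_arrow A B \<gamma> H L"
    and \<beta>: "lax_arrow B C \<beta> G K" and \<delta>: "lax_arrow B C \<delta> K M"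
  shows "lax_cell A C (tensor_coh A B C \<delta> \<gamma> \<beta> \<alpha>) (tensor_nat A C \<delta> \<gamma> \<odot>\<^bsub>Lax A C\<^esub> tensor_nat A C \<beta> \<alpha>)
    (tensor_nat A C (\<delta> \<odot>\<^bsub>Lax B C\<^esub> \<beta>) (\<gamma> \<odot>\<^bsub>Lax A B\<^esub> \<alpha>)) (comp_fun A G F) (comp_fun A M L)"
proof -
  interpret \<alpha>: lax_arrow A B \<alpha> F H by fact
  interpret \<beta>: lax_arrow B C \<beta> G K by fact
  interpret \<gamma>: lax_arrow A B \<gamma> H L by fact
  interpret \<delta>: lax_arrow B C \<delta> K M by fact
  interpret p: lax_pair A B C \<beta> G K \<gamma> H L by unfold_locales
  interpret q: lax_pair A B C \<beta> G K \<alpha> F H by unfold_locales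
  interpret r: lax_pair A B C \<delta> K M \<gamma> H L by unfold_locales
  interpret \<gamma>\<alpha>: lax_arrow A B "\<gamma> \<odot>\<^bsub>Lax A B\<^esub> \<alpha>" F L by (rule lax_arrow_comp[OF \<alpha> \<gamma>])
  interpret \<delta>\<beta>: lax_arrow B C "\<delta> \<odot>\<^bsub>Lax B C\<^esub> \<beta>" G M by (rule lax_arrow_comp[OF \<beta> \<delta>])
  interpret t: lax_pair A B C "\<delta> \<odot>\<^bsub>Lax B C\<^esub> \<beta>" G M "\<gamma> \<odot>\<^bsub>Lax A B\<^esub> \<alpha>" F L by unfold_locales
  show ?thesis
    by (rule lax_cellI) (simp_all add: tensor_coh_eq[OF assms] p.tensor_nat_eq q.tensor_nat_eq r.tensor_nat_eq
        t.tensor_nat_eq \<alpha>.dom.A.two_category_axioms \<beta>.dom.B.two_category_axioms)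
qed

text \<open>Both sides expand to the threefold composite of \<gamma> whiskered by G'F', \<beta>
  whiskered by H and F', and \<alpha> whiskered by HG; the middle factor can be read in either way
  by \<open>precomp_postcomp\<close>.\<close>

lemma tensor_nat_assoc:
  assumes \<gamma>: "lax_arrow C D \<gamma> H H'" and \<beta>: "lax_arrow B C \<beta> G G'" and \<alpha>: "lax_arrow A B \<alpha> F F'"
  shows "tensor_nat A D (tensor_nat B D \<gamma> \<beta>) \<alpha> = tensor_nat A D \<gamma> (tensor_nat A C \<beta> \<alpha>)"
proof -
  interpret \<alpha>: lax_arrow A B \<alpha> F F' by fact
  interpret \<beta>: lax_arrow B C \<beta> G G' by fact
  interpret \<gamma>: lax_arrow C D \<gamma> H H' by fact
  interpret \<beta>\<alpha>: lax_arrow A C "tensor_nat A C \<beta> \<alpha>" "comp_fun A G F" "comp_fun A G' F'"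
    by (rule lax_arrow_tensor[OF \<beta> \<alpha>])
  interpret \<gamma>\<beta>: lax_arrow B D "tensor_nat B D \<gamma> \<beta>" "comp_fun B H G" "comp_fun B H' G'"
    by (rule lax_arrow_tensor[OF \<gamma> \<beta>])
  interpret a: lax_pair A B C \<beta> G G' \<alpha> F F' by unfold_locales
  interpret b: lax_pair B C D \<gamma> H H' \<beta> G G' by unfold_locales
  interpret c: lax_pair A C D \<gamma> H H' "tensor_nat A C \<beta> \<alpha>" "comp_fun A G F" "comp_fun A G' F'" by unfold_locales
  interpret d: lax_pair A B D "tensor_nat B D \<gamma> \<beta>" "comp_fun B H G" "comp_fun B H' G'" \<alpha> F F' by unfold_locales
  interpret e: lax_pair A C D \<gamma> H H' "farr (postcomp A B G) \<alpha>" "comp_fun A G F" "comp_fun A G F'"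
    by (intro lax_pair.intro \<gamma> lax_arrow_postcomp[OF \<alpha>] \<beta>.dom.two_functor_axioms)
  interpret e': lax_pair A C D \<gamma> H H' "farr (precomp A B C F') \<beta>" "comp_fun A G F'" "comp_fun A G' F'"
    by (intro lax_pair.intro \<gamma> lax_arrow_precomp[OF \<beta>] \<alpha>.cod.two_functor_axioms)
  interpret P: two_functor "Lax C D" "Lax A D" "precomp A C D (comp_fun A G' F')"
    by (intro two_functor_precomp two_functor_comp_fun[OF \<alpha>.cod.two_functor_axioms \<beta>.cod.two_functor_axioms]
        \<gamma>.dom.B.two_category_axioms)
  interpret Q: two_functor "Lax A B" "Lax A D" "postcomp A B (comp_fun B H G)"
    by (intro two_functor_postcomp two_functor_comp_fun[OF \<beta>.dom.two_functor_axioms \<gamma>.dom.two_functor_axioms]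
        \<alpha>.dom.A.two_category_axioms)
  note [simp] = \<alpha>.dom.two_functor_axioms \<alpha>.cod.two_functor_axioms \<beta>.dom.two_functor_axioms
    \<beta>.cod.two_functor_axioms \<gamma>.dom.two_functor_axioms \<gamma>.cod.two_functor_axioms
    \<alpha>.dom.A.two_category_axioms \<gamma>.dom.B.two_category_axioms
  \<comment> \<open>\<open>D\<close> does not occur on the left of the rules in
    \<open>postcomp_postcomp\<close>, only in a premise, so it is instantiated explicitly for the
    simplifier.\<close>
  show ?thesis
    unfolding c.tensor_nat_eq d.tensor_nat_eq
    by (simp add: a.tensor_nat_eq b.tensor_nat_eq precomp_precomp precomp_postcomp comp_fun_assoc
        postcomp_postcomp[where D = D])
qed

text \<open>The same threefold expansion as for arrows, now with horizontal composites of whiskered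
  modifications.\<close>

lemma tensor_modif_assoc:
  assumes k: "lax_cell C D k \<gamma> \<gamma>' H H'" and n: "lax_cell B C n \<beta> \<beta>' G G'" and m: "lax_cell A B m \<alpha> \<alpha>' F F'"
  shows "tensor_modif A D (tensor_modif B D k n) m = tensor_modif A D k (tensor_modif A C n m)"
proof -
  interpret m: lax_cell A B m \<alpha> \<alpha>' F F' by fact
  interpret n: lax_cell B C n \<beta> \<beta>' G G' by fact
  interpret k: lax_cell C D k \<gamma> \<gamma>' H H' by fact
  note nm = lax_cell_tensor[OF n m] and kn = lax_cell_tensor[OF k n]
  interpret a: lax_pair A B C \<beta> G G' \<alpha> F F' by unfold_locales
  interpret b: lax_pair B C D \<gamma> H H' \<beta> G G' by unfold_locales
  interpret e: lax_pair A C D \<gamma> H H' "farr (postcomp A B G) \<alpha>" "comp_fun A G F" "comp_fun A G F'"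
    by (intro lax_pair.intro k.src.lax_arrow_axioms lax_arrow_postcomp[OF m.src.lax_arrow_axioms] n.src.dom.two_functor_axioms)
  interpret e': lax_pair A C D \<gamma> H H' "farr (precomp A B C F') \<beta>" "comp_fun A G F'" "comp_fun A G' F'"
    by (intro lax_pair.intro k.src.lax_arrow_axioms lax_arrow_precomp[OF n.src.lax_arrow_axioms] m.src.cod.two_functor_axioms)
  interpret f: lax_pair A B D "farr (precomp B C D G') \<gamma>" "comp_fun B H G'" "comp_fun B H' G'" \<alpha> F F'
    by (intro lax_pair.intro m.src.lax_arrow_axioms lax_arrow_precomp[OF k.src.lax_arrow_axioms] n.src.cod.two_functor_axioms)
  interpret f': lax_pair A B D "farr (postcomp B C H) \<beta>" "comp_fun B H G" "comp_fun B H G'" \<alpha> F F'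
    by (intro lax_pair.intro m.src.lax_arrow_axioms lax_arrow_postcomp[OF n.src.lax_arrow_axioms] k.src.dom.two_functor_axioms)
  interpret P: two_functor "Lax C D" "Lax A D" "precomp A C D (comp_fun A G' F')"
    by (intro two_functor_precomp two_functor_comp_fun[OF m.src.cod.two_functor_axioms n.src.cod.two_functor_axioms]
        k.src.dom.B.two_category_axioms)
  interpret Q: two_functor "Lax A B" "Lax A D" "postcomp A B (comp_fun B H G)"
    by (intro two_functor_postcomp two_functor_comp_fun[OF n.src.dom.two_functor_axioms k.src.dom.two_functor_axioms]
        m.src.dom.A.two_category_axioms)
  note [simp] = m.src.dom.two_functor_axioms m.src.cod.two_functor_axioms n.src.dom.two_functor_axioms
    n.src.cod.two_functor_axioms k.src.dom.two_functor_axioms k.src.cod.two_functor_axioms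
    m.src.dom.A.two_category_axioms k.src.dom.B.two_category_axioms
  show ?thesis
    unfolding tensor_modif_eq[OF k nm] tensor_modif_eq[OF kn m]
    by (simp add: tensor_modif_eq[OF k n] tensor_modif_eq[OF n m] precomp_precomp precomp_postcomp comp_fun_assoc
        postcomp_postcomp[where D = D])
qed

lemma comp_fun_obj:
  "\<lbrakk>two_functor A B F; two_functor B C G\<rbrakk> \<Longrightarrow> comp_fun A G F \<in> Obj (Lax A C)"
  using two_functor_comp_fun by (auto simp: Lax_simps)

text \<open>Both composites start with the interchanger of \<open>\<gamma>\<^sub>1\<close> and the
  image of \<open>\<alpha>\<^sub>2\<close> under \<open>G\<^sub>1\<close>. Then come \<chi> of
  \<open>\<beta>\<^sub>1\<close>, \<open>\<alpha>\<^sub>2\<close> under \<open>H\<^sub>0\<close> and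
  \<chi> of \<open>\<gamma>\<^sub>1\<close>, \<open>\<beta>\<^sub>2\<close> at
  \<open>F\<^sub>2\<close>, in opposite orders.\<close>

lemma tensor_coh_tensor:
  assumes c: "lax_arrow C D \<gamma>\<^sub>1 H\<^sub>0 H\<^sub>1" "lax_arrow C D \<gamma>\<^sub>2 H\<^sub>1 H\<^sub>2"
    and b: "lax_arrow B C \<beta>\<^sub>1 G\<^sub>0 G\<^sub>1" "lax_arrow B C \<beta>\<^sub>2 G\<^sub>1 G\<^sub>2"
    and a: "lax_arrow A B \<alpha>\<^sub>1 F\<^sub>0 F\<^sub>1" "lax_arrow A B \<alpha>\<^sub>2 F\<^sub>1 F\<^sub>2"
  shows "tensor_modif A D (tensor_coh B C D \<gamma>\<^sub>2 \<beta>\<^sub>2 \<gamma>\<^sub>1 \<beta>\<^sub>1) (id_cell (Lax A B) (\<alpha>\<^sub>2 \<odot>\<^bsub>Lax A B\<^esub> \<alpha>\<^sub>1)) \<bullet>\<^bsub>Lax A D\<^esub>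
      tensor_coh A B D (tensor_nat B D \<gamma>\<^sub>2 \<beta>\<^sub>2) \<alpha>\<^sub>2 (tensor_nat B D \<gamma>\<^sub>1 \<beta>\<^sub>1) \<alpha>\<^sub>1 =
    tensor_modif A D (id_cell (Lax C D) (\<gamma>\<^sub>2 \<odot>\<^bsub>Lax C D\<^esub> \<gamma>\<^sub>1)) (tensor_coh A B C \<beta>\<^sub>2 \<alpha>\<^sub>2 \<beta>\<^sub>1 \<alpha>\<^sub>1) \<bullet>\<^bsub>Lax A D\<^esub>
      tensor_coh A C D \<gamma>\<^sub>2 (tensor_nat A C \<beta>\<^sub>2 \<alpha>\<^sub>2) \<gamma>\<^sub>1 (tensor_nat A C \<beta>\<^sub>1 \<alpha>\<^sub>1)"
proof -
  interpret a1: lax_arrow A B \<alpha>\<^sub>1 F\<^sub>0 F\<^sub>1 by fact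
  interpret a2: lax_arrow A B \<alpha>\<^sub>2 F\<^sub>1 F\<^sub>2 by fact
  interpret b1: lax_arrow B C \<beta>\<^sub>1 G\<^sub>0 G\<^sub>1 by fact
  interpret b2: lax_arrow B C \<beta>\<^sub>2 G\<^sub>1 G\<^sub>2 by fact
  interpret c1: lax_arrow C D \<gamma>\<^sub>1 H\<^sub>0 H\<^sub>1 by fact
  interpret c2: lax_arrow C D \<gamma>\<^sub>2 H\<^sub>1 H\<^sub>2 by fact
  note fs = a1.dom.two_functor_axioms a1.cod.two_functor_axioms a2.cod.two_functor_axioms
    b1.dom.two_functor_axioms b1.cod.two_functor_axioms b2.cod.two_functor_axioms
    c1.dom.two_functor_axioms c1.cod.two_functor_axioms c2.cod.two_functor_axioms
  interpret AD: two_category "Lax A D"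
    by (intro two_category_Lax a1.dom.A.two_category_axioms c1.dom.B.two_category_axioms)
  interpret c1b1: lax_pair B C D \<gamma>\<^sub>1 H\<^sub>0 H\<^sub>1 \<beta>\<^sub>1 G\<^sub>0 G\<^sub>1 by unfold_locales
  interpret c1b2: lax_pair B C D \<gamma>\<^sub>1 H\<^sub>0 H\<^sub>1 \<beta>\<^sub>2 G\<^sub>1 G\<^sub>2 by unfold_locales
  interpret c2b2: lax_pair B C D \<gamma>\<^sub>2 H\<^sub>1 H\<^sub>2 \<beta>\<^sub>2 G\<^sub>1 G\<^sub>2 by unfold_locales
  interpret b1a1: lax_pair A B C \<beta>\<^sub>1 G\<^sub>0 G\<^sub>1 \<alpha>\<^sub>1 F\<^sub>0 F\<^sub>1 by unfold_locales
  interpret b1a2: lax_pair A B C \<beta>\<^sub>1 G\<^sub>0 G\<^sub>1 \<alpha>\<^sub>2 F\<^sub>1 F\<^sub>2 by unfold_locales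
  interpret b2a2: lax_pair A B C \<beta>\<^sub>2 G\<^sub>1 G\<^sub>2 \<alpha>\<^sub>2 F\<^sub>1 F\<^sub>2 by unfold_locales
  note ga = lax_arrow_postcomp[OF a(2) fs(5)] and bf = lax_arrow_precomp[OF b(2) fs(3)]
    and hb = lax_arrow_postcomp[OF b(1) fs(7)] and cg = lax_arrow_precomp[OF c(1) fs(5)]
  interpret z: lax_pair A C D \<gamma>\<^sub>1 H\<^sub>0 H\<^sub>1 "farr (postcomp A B G\<^sub>1) \<alpha>\<^sub>2" "comp_fun A G\<^sub>1 F\<^sub>1" "comp_fun A G\<^sub>1 F\<^sub>2"
    by (intro lax_pair.intro c ga)
  interpret PF2: two_functor "Lax B D" "Lax A D" "precomp A B D F\<^sub>2"
    by (intro two_functor_precomp fs c1.dom.B.two_category_axioms)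
  interpret P22: two_functor "Lax C D" "Lax A D" "precomp A C D (comp_fun A G\<^sub>2 F\<^sub>2)"
    by (intro two_functor_precomp two_functor_comp_fun[OF fs(3,6)] c1.dom.B.two_category_axioms)
  note A = a1.dom.A.two_category_axioms
  interpret Q00: two_functor "Lax A B" "Lax A D" "postcomp A B (comp_fun B H\<^sub>0 G\<^sub>0)"
    by (intro two_functor_postcomp two_functor_comp_fun[OF fs(4,7)] A)
  interpret Q01: two_functor "Lax A B" "Lax A D" "postcomp A B (comp_fun B H\<^sub>0 G\<^sub>1)"
    by (intro two_functor_postcomp two_functor_comp_fun[OF fs(5,7)] A)
  interpret Q11: two_functor "Lax A B" "Lax A D" "postcomp A B (comp_fun B H\<^sub>1 G\<^sub>1)"
    by (intro two_functor_postcomp two_functor_comp_fun[OF fs(5,8)] A)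
  note tn = tensor_modif_eq[OF lax_cell_tensor_coh[OF b c] lax_cell_id[OF lax_arrow_comp[OF a]]]
    tensor_modif_eq[OF lax_cell_id[OF lax_arrow_comp[OF c]] lax_cell_tensor_coh[OF a b]]
    tensor_coh_eq[OF a lax_arrow_tensor[OF c(1) b(1)] lax_arrow_tensor[OF c(2) b(2)]]
    tensor_coh_eq[OF lax_arrow_tensor[OF b(1) a(1)] lax_arrow_tensor[OF b(2) a(2)] c]
  \<comment> \<open>The tensors inside an interchanger are split by the two composition laws; the
    whiskering laws then bring the four resulting interchangers down to the three distinct
    ones.\<close>
  note tn' = tensor_coh_eq[OF b c] tensor_coh_eq[OF a b]
    c1b1.tensor_nat_eq c2b2.tensor_nat_eq b1a1.tensor_nat_eq b2a2.tensor_nat_eq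
    xchg_comp_left[OF hb cg a(2)] xchg_comp_right[OF c(1) ga bf]
    xchg_postcomp[OF b(1) a(2) fs(7)] xchg_precomp_postcomp[OF c(1) a(2) fs(5)] xchg_precomp[OF c(1) b(2) fs(3)]
  note [simp] = fs A c1.dom.B.two_category_axioms precomp_precomp precomp_postcomp comp_fun_assoc
    comp_fun_obj[where A = A and B = B and C = C] comp_fun_obj[where A = B and B = C and C = D]
    postcomp_postcomp[where D = D]
  note swap = AD.whisker_swap[of "fcell (postcomp A C H\<^sub>0) (xchg A C \<beta>\<^sub>1 \<alpha>\<^sub>2)"
      "fcell (precomp A B D F\<^sub>2) (xchg B D \<gamma>\<^sub>1 \<beta>\<^sub>2)", simplified]
  note swap' = arg_cong[OF swap, where f = "\<lambda>x. id_cell (Lax A D) (farr (precomp A C D (comp_fun A G\<^sub>2 F\<^sub>2)) \<gamma>\<^sub>2) \<star>\<^bsub>Lax A D\<^esub>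
     (x \<star>\<^bsub>Lax A D\<^esub> id_cell (Lax A D) (farr (postcomp A B (comp_fun B H\<^sub>0 G\<^sub>0)) \<alpha>\<^sub>1))", simplified]
  \<comment> \<open>The outer tensors are unfolded first, since the rules \<open>tn\<close> mention
    the inner ones in folded form. The common first cell is a tail behind the swapped pair, hence
    \<open>vcomp_swap\<close>.\<close>
  show ?thesis
    unfolding tn unfolding tn' by (simp add: AD.vcomp_swap[OF swap'])
qed

text \<open>The composite is extensional by construction, so only \<open>H\<close> carries
  extensionality premises and the rest can be checked on the carriers. The target may itself be a
  composite or a unit constraint.\<close>

lemma comp_lax_eqI:
  fixes H :: "('o, 'a, 'c, 's, 't, 'u) lax_fun"
  assumes "fobj H \<in> extensional (Obj A)" "farr H \<in> extensional (Arr A)" "fcell H \<in> extensional (Cell A)"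
    "coh H \<in> extensional (composable A)"
    and "\<And>X. X \<in> Obj A \<Longrightarrow> fobj G (fobj F X) = fobj H X"
    and "\<And>f. f \<in> Arr A \<Longrightarrow> farr G (farr F f) = farr H f"
    and "\<And>\<theta>. \<theta> \<in> Cell A \<Longrightarrow> fcell G (fcell F \<theta>) = fcell H \<theta>"
    and "\<And>f g. \<lbrakk>f \<in> Arr A; g \<in> Arr A; Cod A f = Dom A g\<rbrakk> \<Longrightarrow>
      fcell G (coh F (f, g)) \<bullet>\<^bsub>C\<^esub> coh G (farr F f, farr F g) = coh H (f, g)"
  shows "comp_lax A C G F = H"
proof -
  have "fobj (comp_lax A C G F) = fobj H" "farr (comp_lax A C G F) = farr H" "fcell (comp_lax A C G F) = fcell H"
    "coh (comp_lax A C G F) = coh H"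
    by (rule extensionalityI[of _ "Obj A"] extensionalityI[of _ "Arr A"] extensionalityI[of _ "Cell A"]
       extensionalityI[of _ "composable A"]; use assms in \<open>auto simp: comp_lax_def composable_def\<close>)+
  then show ?thesis by simp
qed

section \<open>Evaluation rules for composite, product and strict lax functors\<close>

lemma comp_lax_simps:
  "fobj (comp_lax A C G F) \<in> extensional (Obj A)" "farr (comp_lax A C G F) \<in> extensional (Arr A)"
  "fcell (comp_lax A C G F) \<in> extensional (Cell A)" "coh (comp_lax A C G F) \<in> extensional (composable A)"
  "X \<in> Obj A \<Longrightarrow> fobj (comp_lax A C G F) X = fobj G (fobj F X)"
  "f \<in> Arr A \<Longrightarrow> farr (comp_lax A C G F) f = farr G (farr F f)"
  "\<theta> \<in> Cell A \<Longrightarrow> fcell (comp_lax A C G F) \<theta> = fcell G (fcell F \<theta>)"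
  "\<lbrakk>f \<in> Arr A; g \<in> Arr A; Cod A f = Dom A g\<rbrakk> \<Longrightarrow>
    coh (comp_lax A C G F) (f, g) = fcell G (coh F (f, g)) \<bullet>\<^bsub>C\<^esub> coh G (farr F f, farr F g)"
  by (simp_all add: comp_lax_def composable_def)

lemma prod_lax_simps:
  "\<lbrakk>X \<in> Obj A; X' \<in> Obj A'\<rbrakk> \<Longrightarrow> fobj (prod_lax A A' F F') (X, X') = (fobj F X, fobj F' X')"
  "\<lbrakk>f \<in> Arr A; f' \<in> Arr A'\<rbrakk> \<Longrightarrow> farr (prod_lax A A' F F') (f, f') = (farr F f, farr F' f')"
  "\<lbrakk>\<theta> \<in> Cell A; \<theta>' \<in> Cell A'\<rbrakk> \<Longrightarrow> fcell (prod_lax A A' F F') (\<theta>, \<theta>') = (fcell F \<theta>, fcell F' \<theta>')"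
  "\<lbrakk>f \<in> Arr A; f' \<in> Arr A'; g \<in> Arr A; g' \<in> Arr A'; Cod A f = Dom A g; Cod A' f' = Dom A' g'\<rbrakk> \<Longrightarrow>
    coh (prod_lax A A' F F') ((f, f'), (g, g')) = (coh F (f, g), coh F' (f', g'))"
  by (simp_all add: prod_lax_def composable_def)

lemma strict_simps:
  "fobj (strict A B F) = fobj F" "farr (strict A B F) = farr F" "fcell (strict A B F) = fcell F"
  "coh (strict A B F) \<in> extensional (composable A)"
  "\<lbrakk>f \<in> Arr A; g \<in> Arr A; Cod A f = Dom A g\<rbrakk> \<Longrightarrow> coh (strict A B F) (f, g) = id_cell B (farr F (g \<odot>\<^bsub>A\<^esub> f))"
  by (simp_all add: strict_def composable_def)

text \<open>F preserves composites exactly, so identities have the right boundary as coherence cells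
  and both coherence laws hold trivially.\<close>

lemma lax_functor_strict:
  assumes "two_functor A B F"
  shows "lax_functor A B (strict A B F)"
proof -
  interpret two_functor A B F by fact
  show ?thesis
    by (intro lax_functor.intro two_map.intro two_map_axioms.intro lax_functor_axioms.intro
        A.two_category_axioms B.two_category_axioms)
      (auto simp: strict_simps is_arr_def is_cell_def fobj farr fcell)
qed

lemma two_functor_point:
  assumes "two_category K" "X \<in> Obj K"
  shows "two_functor unit_cat K \<lparr>fobj = (\<lambda>_. X), farr = (\<lambda>_. id_arr K X), fcell = (\<lambda>_. id_cell K (id_arr K X))\<rparr>"
proof -
  interpret K: two_category K by fact
  show ?thesis
    by (intro two_functor.intro two_map.intro two_map_axioms.intro two_functor_axioms.intro
        K.two_category_axioms two_category_unit)
      (auto simp: unit_cat_def is_arr_def is_cell_def assms)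
qed

text \<open>Precomposition sends the identity transformation to an identity, and postcomposition
  with the identity functor changes nothing. The coherence cell is an identity because \<chi>(id,
  \<gamma>) is.\<close>

lemma tensor_unit_left:
  assumes \<alpha>: "lax_arrow A B \<alpha> F H"
  shows "tensor_nat A B (id_arr (Lax B B) (id_fun B)) \<alpha> = \<alpha>"
    and "lax_cell A B m \<alpha> \<alpha>' F H \<Longrightarrow>
      tensor_modif A B (id_cell (Lax B B) (id_arr (Lax B B) (id_fun B))) m = m"
    and "lax_arrow A B \<gamma> H L \<Longrightarrow>
      tensor_coh A B B (id_arr (Lax B B) (id_fun B)) \<gamma> (id_arr (Lax B B) (id_fun B)) \<alpha> =
      id_cell (Lax A B) (\<gamma> \<odot>\<^bsub>Lax A B\<^esub> \<alpha>)"
proof -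
  interpret \<alpha>: lax_arrow A B \<alpha> F H by fact
  note AB [simp] = \<alpha>.dom.A.two_category_axioms \<alpha>.dom.B.two_category_axioms
  have I: "two_functor B B (id_fun B)" by (rule two_functor_id_fun) simp
  have \<iota>: "lax_arrow B B (id_arr (Lax B B) (id_fun B)) (id_fun B) (id_fun B)" by (rule lax_arrow_id[OF I])
  interpret \<iota>: lax_arrow B B "id_arr (Lax B B) (id_fun B)" "id_fun B" "id_fun B" by fact
  interpret p: lax_pair A B B "id_arr (Lax B B) (id_fun B)" "id_fun B" "id_fun B" \<alpha> F H by unfold_locales
  have [simp]: "comp_fun A (id_fun B) F = F" "comp_fun A (id_fun B) H = H"
    by (simp_all add: comp_fun_id(2) \<alpha>.dom.two_functor_axioms \<alpha>.cod.two_functor_axioms)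
  show "tensor_nat A B (id_arr (Lax B B) (id_fun B)) \<alpha> = \<alpha>"
    by (simp add: p.tensor_nat_eq postcomp_id)
  show "tensor_modif A B (id_cell (Lax B B) (id_arr (Lax B B) (id_fun B))) m = m" if m: "lax_cell A B m \<alpha> \<alpha>' F H"
  proof -
    interpret m: lax_cell A B m \<alpha> \<alpha>' F H by fact
    show ?thesis
      by (simp add: tensor_modif_eq[OF lax_cell_id[OF \<iota>] m] postcomp_id)
  qed
  show "tensor_coh A B B (id_arr (Lax B B) (id_fun B)) \<gamma> (id_arr (Lax B B) (id_fun B)) \<alpha> =
      id_cell (Lax A B) (\<gamma> \<odot>\<^bsub>Lax A B\<^esub> \<alpha>)" if \<gamma>: "lax_arrow A B \<gamma> H L"
  proof -
    interpret \<gamma>: lax_arrow A B \<gamma> H L by fact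
    interpret q: lax_pair A B B "id_arr (Lax B B) (id_fun B)" "id_fun B" "id_fun B" \<gamma> H L by unfold_locales
    have [simp]: "comp_fun A (id_fun B) L = L"
      by (simp add: comp_fun_id(2) \<gamma>.cod.two_functor_axioms)
    show ?thesis
      by (simp add: tensor_coh_eq[OF \<alpha> \<gamma> \<iota> \<iota>] xchg_id_left[OF I \<gamma>] postcomp_id)
  qed
qed

text \<open>Dual in the whiskerings, but the coherence cell rests on \<chi>(\<beta>, id), that is,
  on the unit condition of \<beta>.\<close>

lemma tensor_unit_right:
  assumes \<beta>: "lax_arrow A B \<beta> G K"
  shows "tensor_nat A B \<beta> (id_arr (Lax A A) (id_fun A)) = \<beta>"
    and "lax_cell A B n \<beta> \<beta>' G K \<Longrightarrow>
      tensor_modif A B n (id_cell (Lax A A) (id_arr (Lax A A) (id_fun A))) = n"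
    and "lax_arrow A B \<delta> K M \<Longrightarrow>
      tensor_coh A A B \<delta> (id_arr (Lax A A) (id_fun A)) \<beta> (id_arr (Lax A A) (id_fun A)) =
      id_cell (Lax A B) (\<delta> \<odot>\<^bsub>Lax A B\<^esub> \<beta>)"
proof -
  interpret \<beta>: lax_arrow A B \<beta> G K by fact
  note AB [simp] = \<beta>.dom.A.two_category_axioms \<beta>.dom.B.two_category_axioms
  have I: "two_functor A A (id_fun A)" by (rule two_functor_id_fun) simp
  have \<iota>: "lax_arrow A A (id_arr (Lax A A) (id_fun A)) (id_fun A) (id_fun A)" by (rule lax_arrow_id[OF I])
  interpret \<iota>: lax_arrow A A "id_arr (Lax A A) (id_fun A)" "id_fun A" "id_fun A" by fact
  interpret p: lax_pair A A B \<beta> G K "id_arr (Lax A A) (id_fun A)" "id_fun A" "id_fun A" by unfold_locales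
  have [simp]: "comp_fun A G (id_fun A) = G" "comp_fun A K (id_fun A) = K"
    by (simp_all add: comp_fun_id(1)[OF \<beta>.dom.two_functor_axioms] comp_fun_id(1)[OF \<beta>.cod.two_functor_axioms])
  show "tensor_nat A B \<beta> (id_arr (Lax A A) (id_fun A)) = \<beta>"
    by (simp add: p.tensor_nat_eq precomp_id)
  show "tensor_modif A B n (id_cell (Lax A A) (id_arr (Lax A A) (id_fun A))) = n" if n: "lax_cell A B n \<beta> \<beta>' G K"
  proof -
    interpret n: lax_cell A B n \<beta> \<beta>' G K by fact
    show ?thesis
      by (simp add: tensor_modif_eq[OF n lax_cell_id[OF \<iota>]] precomp_id)
  qed
  show "tensor_coh A A B \<delta> (id_arr (Lax A A) (id_fun A)) \<beta> (id_arr (Lax A A) (id_fun A)) =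
      id_cell (Lax A B) (\<delta> \<odot>\<^bsub>Lax A B\<^esub> \<beta>)" if \<delta>: "lax_arrow A B \<delta> K M"
  proof -
    interpret \<delta>: lax_arrow A B \<delta> K M by fact
    show ?thesis
      by (simp add: tensor_coh_eq[OF \<iota> \<iota> \<beta> \<delta>] xchg_id_right[OF \<beta> I] precomp_id)
  qed
qed

lemma lax_cell_arrowE:
  assumes "two_category A" "two_category B" "m \<in> Cell (Lax A B)"
  obtains \<alpha> \<alpha>' F H where "lax_cell A B m \<alpha> \<alpha>' F H" "lax_arrow A B \<alpha> F H"
  using lax_cellI[OF assms] by (metis lax_arrow.intro lax_cell.src_arrow)

lemma id_lax_simps:
  "X \<in> Obj A \<Longrightarrow> fobj (id_lax A) X = X" "f \<in> Arr A \<Longrightarrow> farr (id_lax A) f = f"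
  "\<theta> \<in> Cell A \<Longrightarrow> fcell (id_lax A) \<theta> = \<theta>"
  "\<lbrakk>two_category A; f \<in> Arr A; g \<in> Arr A; Cod A f = Dom A g\<rbrakk> \<Longrightarrow>
    coh (id_lax A) (f, g) = id_cell A (g \<odot>\<^bsub>A\<^esub> f)"
  by (simp_all add: id_lax_def strict_simps two_category.comp_simps)

lemma assoc_lax_simps:
  assumes "two_category A" "two_category B" "two_category C"
  shows "\<lbrakk>X \<in> Obj A; Y \<in> Obj B; Z \<in> Obj C\<rbrakk> \<Longrightarrow> fobj (assoc_lax A B C) ((X, Y), Z) = (X, Y, Z)"
    and "\<lbrakk>f \<in> Arr A; g \<in> Arr B; h \<in> Arr C\<rbrakk> \<Longrightarrow> farr (assoc_lax A B C) ((f, g), h) = (f, g, h)"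
    and "\<lbrakk>\<theta> \<in> Cell A; \<eta> \<in> Cell B; \<zeta> \<in> Cell C\<rbrakk> \<Longrightarrow> fcell (assoc_lax A B C) ((\<theta>, \<eta>), \<zeta>) = (\<theta>, \<eta>, \<zeta>)"
    and "\<lbrakk>f \<in> Arr A; g \<in> Arr B; h \<in> Arr C; f' \<in> Arr A; g' \<in> Arr B; h' \<in> Arr C;
        Cod A f = Dom A f'; Cod B g = Dom B g'; Cod C h = Dom C h'\<rbrakk> \<Longrightarrow>
      coh (assoc_lax A B C) (((f, g), h), ((f', g'), h')) =
      (id_cell A (f' \<odot>\<^bsub>A\<^esub> f), id_cell B (g' \<odot>\<^bsub>B\<^esub> g), id_cell C (h' \<odot>\<^bsub>C\<^esub> h))"
  using assms by (simp_all add: assoc_lax_def strict_simps two_category.comp_simps)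

lemma unit_cat_simps [simp]:
  "Obj unit_cat = UNIV" "Arr unit_cat = UNIV" "Cell unit_cat = UNIV"
  by (simp_all add: unit_cat_def)

text \<open>Any two arrows of the terminal 2-category are composable, so even the coherence equation
  is unconditional.\<close>

lemma point_simps:
  "fobj (point K X) u = X" "farr (point K X) u = id_arr K X" "fcell (point K X) u = id_cell K (id_arr K X)"
  "coh (point K X) (u, v) = id_cell K (id_arr K X)"
  by (simp_all add: point_def strict_def composable_def)

lemma lunit_lax_simps:
  "fobj (lunit_lax A) \<in> extensional (Obj (unit_cat \<times>\<^sub>2 A))" "farr (lunit_lax A) \<in> extensional (Arr (unit_cat \<times>\<^sub>2 A))"
  "fcell (lunit_lax A) \<in> extensional (Cell (unit_cat \<times>\<^sub>2 A))"
  "coh (lunit_lax A) \<in> extensional (composable (unit_cat \<times>\<^sub>2 A))"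
  "X \<in> Obj A \<Longrightarrow> fobj (lunit_lax A) (u, X) = X" "f \<in> Arr A \<Longrightarrow> farr (lunit_lax A) (u, f) = f"
  "\<theta> \<in> Cell A \<Longrightarrow> fcell (lunit_lax A) (u, \<theta>) = \<theta>"
  "\<lbrakk>two_category A; f \<in> Arr A; g \<in> Arr A; Cod A f = Dom A g\<rbrakk> \<Longrightarrow>
    coh (lunit_lax A) ((u, f), (v, g)) = id_cell A (g \<odot>\<^bsub>A\<^esub> f)"
  by (simp_all add: lunit_lax_def strict_simps two_category.comp_simps)

lemma runit_lax_simps:
  "fobj (runit_lax A) \<in> extensional (Obj (A \<times>\<^sub>2 unit_cat))" "farr (runit_lax A) \<in> extensional (Arr (A \<times>\<^sub>2 unit_cat))"
  "fcell (runit_lax A) \<in> extensional (Cell (A \<times>\<^sub>2 unit_cat))"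
  "coh (runit_lax A) \<in> extensional (composable (A \<times>\<^sub>2 unit_cat))"
  "X \<in> Obj A \<Longrightarrow> fobj (runit_lax A) (X, u) = X" "f \<in> Arr A \<Longrightarrow> farr (runit_lax A) (f, u) = f"
  "\<theta> \<in> Cell A \<Longrightarrow> fcell (runit_lax A) (\<theta>, u) = \<theta>"
  "\<lbrakk>two_category A; f \<in> Arr A; g \<in> Arr A; Cod A f = Dom A g\<rbrakk> \<Longrightarrow>
    coh (runit_lax A) ((f, u), (g, v)) = id_cell A (g \<odot>\<^bsub>A\<^esub> f)"
  by (simp_all add: runit_lax_def strict_simps two_category.comp_simps)

lemma tensor_point_left:
  assumes A: "two_category A" and B: "two_category B"
  shows "comp_lax (unit_cat \<times>\<^sub>2 Lax A B) (Lax A B) (tensor A B B)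
    (prod_lax unit_cat (Lax A B) (point (Lax B B) (id_fun B)) (id_lax (Lax A B))) = lunit_lax (Lax A B)"
proof -
  have I: "two_functor B B (id_fun B)" by (rule two_functor_id_fun[OF B])
  interpret AB: two_category "Lax A B" by (rule two_category_Lax[OF A B])
  interpret \<iota>: lax_arrow B B "id_arr (Lax B B) (id_fun B)" "id_fun B" "id_fun B" by (rule lax_arrow_id[OF I])
  note simps = lunit_lax_simps prod_lax_simps id_lax_simps point_simps tensor_simps AB.two_category_axioms
  show ?thesis
  proof (rule comp_lax_eqI)
    fix X assume "X \<in> Obj (unit_cat \<times>\<^sub>2 Lax A B)"
    then obtain F where X: "X = ((), F)" and F: "two_functor A B F" and F': "F \<in> Obj (Lax A B)"
      by (auto simp: Lax_simps)
    show "fobj (tensor A B B) (fobj (prod_lax unit_cat (Lax A B) (point (Lax B B) (id_fun B)) (id_lax (Lax A B))) X)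
      = fobj (lunit_lax (Lax A B)) X"
      using F' by (simp add: X simps comp_fun_id(2)[OF F])
  next
    fix f assume "f \<in> Arr (unit_cat \<times>\<^sub>2 Lax A B)"
    then obtain \<alpha> F H where f: "f = ((), \<alpha>)" and \<alpha>: "lax_arrow A B \<alpha> F H"
      using lax_arrowI by fastforce
    interpret \<alpha>: lax_arrow A B \<alpha> F H by fact
    show "farr (tensor A B B) (farr (prod_lax unit_cat (Lax A B) (point (Lax B B) (id_fun B)) (id_lax (Lax A B))) f)
      = farr (lunit_lax (Lax A B)) f"
      by (simp add: f simps tensor_unit_left(1)[OF \<alpha>])
  next
    fix \<theta> assume "\<theta> \<in> Cell (unit_cat \<times>\<^sub>2 Lax A B)"
    then obtain m where \<theta>: "\<theta> = ((), m)" and "m \<in> Cell (Lax A B)" by auto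
    then obtain \<alpha> \<alpha>' F H where m: "lax_cell A B m \<alpha> \<alpha>' F H" and \<alpha>: "lax_arrow A B \<alpha> F H"
      by (blast elim: lax_cell_arrowE[OF A B])
    interpret m: lax_cell A B m \<alpha> \<alpha>' F H by fact
    show "fcell (tensor A B B) (fcell (prod_lax unit_cat (Lax A B) (point (Lax B B) (id_fun B)) (id_lax (Lax A B))) \<theta>)
      = fcell (lunit_lax (Lax A B)) \<theta>"
      by (simp add: \<theta> simps tensor_unit_left(2)[OF \<alpha> m])
  next
    fix f g assume fg: "f \<in> Arr (unit_cat \<times>\<^sub>2 Lax A B)" "g \<in> Arr (unit_cat \<times>\<^sub>2 Lax A B)"
      "Cod (unit_cat \<times>\<^sub>2 Lax A B) f = Dom (unit_cat \<times>\<^sub>2 Lax A B) g"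
    obtain \<alpha> \<gamma> where st: "f = ((), \<alpha>)" "g = ((), \<gamma>)" by (metis old.unit.exhaust prod.exhaust)
    obtain F H L where \<alpha>: "lax_arrow A B \<alpha> F H" and \<gamma>: "lax_arrow A B \<gamma> H L"
      using fg by (auto simp: st lax_arrow_def is_arr_def)
    interpret \<alpha>: lax_arrow A B \<alpha> F H by fact
    interpret \<gamma>: lax_arrow A B \<gamma> H L by fact
    note \<gamma>\<alpha> = lax_arrow_comp[OF \<alpha> \<gamma>]
    \<comment> \<open>Both factors on the left are identities: the first is the tensor of two
      identity coherence cells, the second the coherence cell of the tensor along a unit.\<close>
    show "fcell (tensor A B B) (coh (prod_lax unit_cat (Lax A B) (point (Lax B B) (id_fun B)) (id_lax (Lax A B))) (f, g))
      \<bullet>\<^bsub>Lax A B\<^esub> coh (tensor A B B)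
        (farr (prod_lax unit_cat (Lax A B) (point (Lax B B) (id_fun B)) (id_lax (Lax A B))) f,
         farr (prod_lax unit_cat (Lax A B) (point (Lax B B) (id_fun B)) (id_lax (Lax A B))) g)
      = coh (lunit_lax (Lax A B)) (f, g)"
      by (simp add: st simps
          tensor_unit_left(2)[OF \<gamma>\<alpha> lax_cell_id[OF \<gamma>\<alpha>]] tensor_unit_left(3)[OF \<alpha> \<gamma>])
  qed (simp_all only: lunit_lax_simps)
qed

lemma tensor_point_right:
  assumes A: "two_category A" and B: "two_category B"
  shows "comp_lax (Lax A B \<times>\<^sub>2 unit_cat) (Lax A B) (tensor A A B)
    (prod_lax (Lax A B) unit_cat (id_lax (Lax A B)) (point (Lax A A) (id_fun A))) = runit_lax (Lax A B)"
proof -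
  have I: "two_functor A A (id_fun A)" by (rule two_functor_id_fun[OF A])
  interpret AB: two_category "Lax A B" by (rule two_category_Lax[OF A B])
  interpret \<iota>: lax_arrow A A "id_arr (Lax A A) (id_fun A)" "id_fun A" "id_fun A" by (rule lax_arrow_id[OF I])
  note simps = runit_lax_simps prod_lax_simps id_lax_simps point_simps tensor_simps AB.two_category_axioms
  show ?thesis
  proof (rule comp_lax_eqI)
    fix X assume "X \<in> Obj (Lax A B \<times>\<^sub>2 unit_cat)"
    then obtain F where X: "X = (F, ())" and F: "two_functor A B F" and F': "F \<in> Obj (Lax A B)"
      by (auto simp: Lax_simps)
    show "fobj (tensor A A B) (fobj (prod_lax (Lax A B) unit_cat (id_lax (Lax A B)) (point (Lax A A) (id_fun A))) X)
      = fobj (runit_lax (Lax A B)) X"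
      using F' by (simp add: X simps comp_fun_id(1)[OF F])
  next
    fix f assume "f \<in> Arr (Lax A B \<times>\<^sub>2 unit_cat)"
    then obtain \<alpha> F H where f: "f = (\<alpha>, ())" and \<alpha>: "lax_arrow A B \<alpha> F H"
      using lax_arrowI by fastforce
    interpret \<alpha>: lax_arrow A B \<alpha> F H by fact
    show "farr (tensor A A B) (farr (prod_lax (Lax A B) unit_cat (id_lax (Lax A B)) (point (Lax A A) (id_fun A))) f)
      = farr (runit_lax (Lax A B)) f"
      by (simp add: f simps tensor_unit_right(1)[OF \<alpha>])
  next
    fix \<theta> assume "\<theta> \<in> Cell (Lax A B \<times>\<^sub>2 unit_cat)"
    then obtain m where \<theta>: "\<theta> = (m, ())" and "m \<in> Cell (Lax A B)" by auto
    then obtain \<alpha> \<alpha>' F H where m: "lax_cell A B m \<alpha> \<alpha>' F H" and \<alpha>: "lax_arrow A B \<alpha> F H"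
      by (blast elim: lax_cell_arrowE[OF A B])
    interpret m: lax_cell A B m \<alpha> \<alpha>' F H by fact
    show "fcell (tensor A A B) (fcell (prod_lax (Lax A B) unit_cat (id_lax (Lax A B)) (point (Lax A A) (id_fun A))) \<theta>)
      = fcell (runit_lax (Lax A B)) \<theta>"
      by (simp add: \<theta> simps tensor_unit_right(2)[OF \<alpha> m])
  next
    fix f g assume fg: "f \<in> Arr (Lax A B \<times>\<^sub>2 unit_cat)" "g \<in> Arr (Lax A B \<times>\<^sub>2 unit_cat)"
      "Cod (Lax A B \<times>\<^sub>2 unit_cat) f = Dom (Lax A B \<times>\<^sub>2 unit_cat) g"
    obtain \<alpha> \<gamma> where st: "f = (\<alpha>, ())" "g = (\<gamma>, ())" by (metis old.unit.exhaust prod.exhaust)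
    obtain F H L where \<alpha>: "lax_arrow A B \<alpha> F H" and \<gamma>: "lax_arrow A B \<gamma> H L"
      using fg by (auto simp: st lax_arrow_def is_arr_def)
    interpret \<alpha>: lax_arrow A B \<alpha> F H by fact
    interpret \<gamma>: lax_arrow A B \<gamma> H L by fact
    note \<gamma>\<alpha> = lax_arrow_comp[OF \<alpha> \<gamma>]
    show "fcell (tensor A A B) (coh (prod_lax (Lax A B) unit_cat (id_lax (Lax A B)) (point (Lax A A) (id_fun A))) (f, g))
      \<bullet>\<^bsub>Lax A B\<^esub> coh (tensor A A B)
        (farr (prod_lax (Lax A B) unit_cat (id_lax (Lax A B)) (point (Lax A A) (id_fun A))) f,
         farr (prod_lax (Lax A B) unit_cat (id_lax (Lax A B)) (point (Lax A A) (id_fun A))) g)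
      = coh (runit_lax (Lax A B)) (f, g)"
      by (simp add: st simps
          tensor_unit_right(2)[OF \<gamma>\<alpha> lax_cell_id[OF \<gamma>\<alpha>]] tensor_unit_right(3)[OF \<alpha> \<gamma>])
  qed (simp_all only: runit_lax_simps)
qed

lemma tensor_assoc:
  assumes A: "two_category A" and B: "two_category B" and C: "two_category C" and D: "two_category D"
  shows "comp_lax ((Lax C D \<times>\<^sub>2 Lax B C) \<times>\<^sub>2 Lax A B) (Lax A D) (tensor A B D)
      (prod_lax (Lax C D \<times>\<^sub>2 Lax B C) (Lax A B) (tensor B C D) (id_lax (Lax A B))) =
    comp_lax ((Lax C D \<times>\<^sub>2 Lax B C) \<times>\<^sub>2 Lax A B) (Lax A D) (tensor A C D)
      (comp_lax ((Lax C D \<times>\<^sub>2 Lax B C) \<times>\<^sub>2 Lax A B) (Lax C D \<times>\<^sub>2 Lax A C)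
        (prod_lax (Lax C D) (Lax B C \<times>\<^sub>2 Lax A B) (id_lax (Lax C D)) (tensor A B C))
        (assoc_lax (Lax C D) (Lax B C) (Lax A B)))"
    (is "comp_lax ?K ?L ?S ?P = comp_lax ?K ?L ?S' ?P'")
proof -
  interpret AB: two_category "Lax A B" by (rule two_category_Lax[OF A B])
  interpret BC: two_category "Lax B C" by (rule two_category_Lax[OF B C])
  interpret CD: two_category "Lax C D" by (rule two_category_Lax[OF C D])
  note simps = comp_lax_simps prod_lax_simps id_lax_simps tensor_simps AB.two_category_axioms
    BC.two_category_axioms CD.two_category_axioms
    assoc_lax_simps[OF CD.two_category_axioms BC.two_category_axioms AB.two_category_axioms]
  show ?thesis
  proof (rule comp_lax_eqI)
    fix X assume "X \<in> Obj ?K"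
    then obtain H G F where X: "X = ((H, G), F)" and F: "two_functor A B F" "two_functor B C G" "two_functor C D H"
      and F': "F \<in> Obj (Lax A B)" "G \<in> Obj (Lax B C)" "H \<in> Obj (Lax C D)"
      by (auto simp: Lax_simps)
    show "fobj ?S (fobj ?P X) = fobj (comp_lax ?K ?L ?S' ?P') X"
      using F' by (simp add: X simps comp_fun_assoc[OF F(1)] comp_fun_obj[OF F(1,2)] comp_fun_obj[OF F(2,3)])
  next
    fix f assume "f \<in> Arr ?K"
    then obtain \<gamma> \<beta> \<alpha> F F' G G' H H' where f: "f = ((\<gamma>, \<beta>), \<alpha>)"
      and l: "lax_arrow C D \<gamma> H H'" "lax_arrow B C \<beta> G G'" "lax_arrow A B \<alpha> F F'"
      by (auto simp: lax_arrow_def is_arr_def)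
    interpret \<alpha>: lax_arrow A B \<alpha> F F' by fact
    interpret \<beta>: lax_arrow B C \<beta> G G' by fact
    interpret \<gamma>: lax_arrow C D \<gamma> H H' by fact
    interpret \<beta>\<alpha>: lax_arrow A C "tensor_nat A C \<beta> \<alpha>" "comp_fun A G F" "comp_fun A G' F'"
      by (rule lax_arrow_tensor[OF l(2,3)])
    interpret \<gamma>\<beta>: lax_arrow B D "tensor_nat B D \<gamma> \<beta>" "comp_fun B H G" "comp_fun B H' G'"
      by (rule lax_arrow_tensor[OF l(1,2)])
    show "farr ?S (farr ?P f) = farr (comp_lax ?K ?L ?S' ?P') f"
      by (simp add: f simps tensor_nat_assoc[OF l])
  next
    fix \<theta> assume "\<theta> \<in> Cell ?K"
    then obtain k n m where \<theta>: "\<theta> = ((k, n), m)" and c: "k \<in> Cell (Lax C D)" "n \<in> Cell (Lax B C)" "m \<in> Cell (Lax A B)"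
      by auto
    obtain \<alpha> \<alpha>' F F' where m: "lax_cell A B m \<alpha> \<alpha>' F F'" by (rule lax_cell_arrowE[OF A B c(3)])
    obtain \<beta> \<beta>' G G' where n: "lax_cell B C n \<beta> \<beta>' G G'" by (rule lax_cell_arrowE[OF B C c(2)])
    obtain \<gamma> \<gamma>' H H' where k: "lax_cell C D k \<gamma> \<gamma>' H H'" by (rule lax_cell_arrowE[OF C D c(1)])
    interpret nm: lax_cell A C "tensor_modif A C n m" "tensor_nat A C \<beta> \<alpha>" "tensor_nat A C \<beta>' \<alpha>'"
      "comp_fun A G F" "comp_fun A G' F'" by (rule lax_cell_tensor[OF n m])
    interpret kn: lax_cell B D "tensor_modif B D k n" "tensor_nat B D \<gamma> \<beta>" "tensor_nat B D \<gamma>' \<beta>'"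
      "comp_fun B H G" "comp_fun B H' G'" by (rule lax_cell_tensor[OF k n])
    show "fcell ?S (fcell ?P \<theta>) = fcell (comp_lax ?K ?L ?S' ?P') \<theta>"
      using c by (simp add: \<theta> simps tensor_modif_assoc[OF k n m])
  next
    fix f g assume fg: "f \<in> Arr ?K" "g \<in> Arr ?K" "Cod ?K f = Dom ?K g"
    obtain \<gamma>\<^sub>1 \<beta>\<^sub>1 \<alpha>\<^sub>1 \<gamma>\<^sub>2 \<beta>\<^sub>2 \<alpha>\<^sub>2 where st: "f = ((\<gamma>\<^sub>1, \<beta>\<^sub>1), \<alpha>\<^sub>1)" "g = ((\<gamma>\<^sub>2, \<beta>\<^sub>2), \<alpha>\<^sub>2)" by (metis prod.exhaust)
    obtain F\<^sub>0 F\<^sub>1 F\<^sub>2 G\<^sub>0 G\<^sub>1 G\<^sub>2 H\<^sub>0 H\<^sub>1 H\<^sub>2 where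
      c: "lax_arrow C D \<gamma>\<^sub>1 H\<^sub>0 H\<^sub>1" "lax_arrow C D \<gamma>\<^sub>2 H\<^sub>1 H\<^sub>2"
      and b: "lax_arrow B C \<beta>\<^sub>1 G\<^sub>0 G\<^sub>1" "lax_arrow B C \<beta>\<^sub>2 G\<^sub>1 G\<^sub>2"
      and a: "lax_arrow A B \<alpha>\<^sub>1 F\<^sub>0 F\<^sub>1" "lax_arrow A B \<alpha>\<^sub>2 F\<^sub>1 F\<^sub>2"
      using fg by (auto simp: st lax_arrow_def is_arr_def)
    interpret a1: lax_arrow A B \<alpha>\<^sub>1 F\<^sub>0 F\<^sub>1 by fact
    interpret a2: lax_arrow A B \<alpha>\<^sub>2 F\<^sub>1 F\<^sub>2 by fact
    interpret b1: lax_arrow B C \<beta>\<^sub>1 G\<^sub>0 G\<^sub>1 by fact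
    interpret b2: lax_arrow B C \<beta>\<^sub>2 G\<^sub>1 G\<^sub>2 by fact
    interpret c1: lax_arrow C D \<gamma>\<^sub>1 H\<^sub>0 H\<^sub>1 by fact
    interpret c2: lax_arrow C D \<gamma>\<^sub>2 H\<^sub>1 H\<^sub>2 by fact
    interpret ba1: lax_arrow A C "tensor_nat A C \<beta>\<^sub>1 \<alpha>\<^sub>1" "comp_fun A G\<^sub>0 F\<^sub>0" "comp_fun A G\<^sub>1 F\<^sub>1"
      by (rule lax_arrow_tensor[OF b(1) a(1)])
    interpret ba2: lax_arrow A C "tensor_nat A C \<beta>\<^sub>2 \<alpha>\<^sub>2" "comp_fun A G\<^sub>1 F\<^sub>1" "comp_fun A G\<^sub>2 F\<^sub>2"
      by (rule lax_arrow_tensor[OF b(2) a(2)])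
    interpret cb1: lax_arrow B D "tensor_nat B D \<gamma>\<^sub>1 \<beta>\<^sub>1" "comp_fun B H\<^sub>0 G\<^sub>0" "comp_fun B H\<^sub>1 G\<^sub>1"
      by (rule lax_arrow_tensor[OF c(1) b(1)])
    interpret cb2: lax_arrow B D "tensor_nat B D \<gamma>\<^sub>2 \<beta>\<^sub>2" "comp_fun B H\<^sub>1 G\<^sub>1" "comp_fun B H\<^sub>2 G\<^sub>2"
      by (rule lax_arrow_tensor[OF c(2) b(2)])
    interpret ba: lax_cell A C "tensor_coh A B C \<beta>\<^sub>2 \<alpha>\<^sub>2 \<beta>\<^sub>1 \<alpha>\<^sub>1" "tensor_nat A C \<beta>\<^sub>2 \<alpha>\<^sub>2 \<odot>\<^bsub>Lax A C\<^esub> tensor_nat A C \<beta>\<^sub>1 \<alpha>\<^sub>1"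
      "tensor_nat A C (\<beta>\<^sub>2 \<odot>\<^bsub>Lax B C\<^esub> \<beta>\<^sub>1) (\<alpha>\<^sub>2 \<odot>\<^bsub>Lax A B\<^esub> \<alpha>\<^sub>1)" "comp_fun A G\<^sub>0 F\<^sub>0" "comp_fun A G\<^sub>2 F\<^sub>2"
      by (rule lax_cell_tensor_coh[OF a b])
    interpret cb: lax_cell B D "tensor_coh B C D \<gamma>\<^sub>2 \<beta>\<^sub>2 \<gamma>\<^sub>1 \<beta>\<^sub>1" "tensor_nat B D \<gamma>\<^sub>2 \<beta>\<^sub>2 \<odot>\<^bsub>Lax B D\<^esub> tensor_nat B D \<gamma>\<^sub>1 \<beta>\<^sub>1"
      "tensor_nat B D (\<gamma>\<^sub>2 \<odot>\<^bsub>Lax C D\<^esub> \<gamma>\<^sub>1) (\<beta>\<^sub>2 \<odot>\<^bsub>Lax B C\<^esub> \<beta>\<^sub>1)" "comp_fun B H\<^sub>0 G\<^sub>0" "comp_fun B H\<^sub>2 G\<^sub>2"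
      by (rule lax_cell_tensor_coh[OF b c])
    \<comment> \<open>Expanding the composite coherence cells and dropping the identities
      contributed by \<open>id_lax\<close> and \<open>assoc_lax\<close> leaves exactly
      \<open>tensor_coh_tensor\<close>.\<close>
    show "fcell ?S (coh ?P (f, g)) \<bullet>\<^bsub>?L\<^esub> coh ?S (farr ?P f, farr ?P g) = coh (comp_lax ?K ?L ?S' ?P') (f, g)"
      by (simp add: st simps tensor_coh_tensor[OF c b a] tensor_modif_id[OF lax_arrow_comp[OF b] lax_arrow_comp[OF a]])
  qed (simp_all only: comp_lax_simps)
qed

theorem theorem2p22:
  shows "lax_3_category (Lax_3Cat :: (('o, 'a, 'c) two_cat,
    ('o, 'a, 'c, 'o, 'a, 'c) two_fun, ('o, 'a, 'c, 'o, 'a, 'c) lax_nat,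
    ('o, 'a, 'c, 'o, 'a, 'c) modif) enriched)"
proof (rule lax_3_category.intro, unfold Lax_3Cat_def enriched.simps mem_Collect_eq)
  fix A :: "('o, 'a, 'c) two_cat" assume A: "two_category A"
  \<comment> \<open>The unit axiom needs preparation: \<open>point\<close> is a lax functor because
    it comes from a strict 2-functor, which requires the chosen object to lie in
    \<open>Lax A A\<close>.\<close>
  have "id_fun A \<in> Obj (Lax A A)" using two_functor_id_fun[OF A] by (simp add: Lax_simps)
  then show "lax_functor unit_cat (Lax A A) (point (Lax A A) (id_fun A))"
    unfolding point_def by (intro lax_functor_strict two_functor_point two_category_Lax A)
qed (intro two_category_Lax lax_functor_tensor tensor_assoc tensor_point_left tensor_point_right; assumption)+

end
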